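(* Let $\lambda\in\mathbb{C}\setminus\mathbb{Z}$, $p\in\mathbb{Z}_{\ge0}$, and let $\chi(z)=\sum_{n=-p}^{\infty}\chi_{-n}z^{n-1}\in\mathbb{C}((z))$ satisfy $\chi_p\neq0$ and, in the case $p=0$, also $\chi_0\in\mathbb{C}\setminus\mathbb{Z}$. Then on the (underlying vector space of the) vertex algebra $\Pi(0)=\mathcal{L}_0(F)$ there exists the structure of an irreducible $\hat{\mathfrak g}$-module isomorphic to $\mathcal{L}_0(F(\tfrac{\lambda}{z},\chi))$.
   Context: $\mathfrak g=sl_2(\mathbb{C})$ with basis $e,f,h$, $[h,e]=2e$, $[h,f]=-2f$, $[e,f]=h$; $\hat{\mathfrak g}=\mathfrak g\otimes\mathbb{C}[t,t^{-1}]\oplus\mathbb{C}c$ is the affine Lie algebra (form normalized by $(e,f)=1,(h,h)=2$). Let $F$ be the irreducible module, generated by $\mathbf 1$ with $\Psi^\pm(r)\mathbf 1=0$ for $r>0$, of the Clifford algebra with generators $\Psi^{\pm}(r)$, $r\in\frac12+\mathbb{Z}$, and relations $\{\Psi^{\pm}(r),\Psi^{\mp}(s)\}=\delta_{r+s,0}$, $\{\Psi^{\pm}(r),\Psi^{\pm}(s)\}=0$; it is a vertex superalgebra generated by the fields $\Psi^\pm(z)=\sum_n\Psi^\pm(n+\frac12)z^{-n-1}$. For $\chi^\pm(z)=\sum_n\chi^\pm_nz^{-n-1}\in\mathbb{C}((z))$, $F(\chi^+,\chi^-)$ denotes the space $F$ equipped with the operators ($i\in\mathbb{Z}$) $G^{\pm}(i-\frac12)=-i\Psi^{\pm}(i-\frac12)+\sum_{k}\chi^\pm_{-k}\Psi^{\pm}(k+i-\frac12)$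 and scalars $T(n)=\frac12(\chi^+_n-\chi^-_n)$. Let $F_{-1}=V_{\mathbb{Z}\beta}$, $\langle\beta,\beta\rangle=-1$, be the lattice vertex superalgebra with trivial cocycle ($Y(e^{m\beta},z)e^{n\beta}=z^{-mn}(e^{(m+n)\beta}+O(z))$, $Y(e^{\pm\beta},z)=\sum_n e^{\pm\beta}_nz^{-n-1}$). Then $F(\chi^+,\chi^-)\otimes F_{-1}$ is a $\hat{\mathfrak g}$-module of critical level $c=-2$ via $$e(n)=\sum_{i\in\mathbb{Z}}G^+(i-\tfrac12)\otimes e^{\beta}_{n-i-1},\quad f(n)=\sum_{i\in\mathbb{Z}}G^-(i-\tfrac12)\otimes e^{-\beta}_{n-i-1},\quad h(n)=-2\beta(n)+2T(n),$$ with $(A\otimes B)(x\otimes y)=Ax\otimes By$. Let $J^f(0)$ be the charge operator on $F$ ($J^f(0)\mathbf 1=0$, $[J^f(0),\Psi^\pm(r)]=\pm\Psi^\pm(r)$) and $H(0)=J^f(0)\otimes1+1\otimes\beta(0)$. $\mathcal{L}_0(F(\chi^+,\chi^-))=\{v\in F(\chi^+,\chi^-)\otimes F_{-1}\mid H(0)v=0\}$, a $\hat{\mathfrak g}$-submodule. The vertex algebra $\Pi(0)=\mathcal{L}_0(F)$ is $\mathrm{Ker}_{F\otimes F_{-1}}H(0)$, which is the same vector space; by boson-fermion correspondence $\Pi(0)\cong M(1)\otimes\mathbb{C}[\mathbb{Z}(\alpha+\beta)]$, where $M(1)$ is the rank two Heisenberg vertex algebra of the lattice $\mathbb{Z}\alpha+\mathbb{Z}\beta$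 with $\langle\alpha,\alpha\rangle=1=-\langle\beta,\beta\rangle$, $\langle\alpha,\beta\rangle=0$. *)

theory Defs
  imports
    Complex_Main
    "HOL-Library.Poly_Mapping"
    "HOL-Library.FSet"
    "HOL-Library.Multiset"
    "HOL-Computational_Algebra.Formal_Laurent_Series"
begin

section \<open>Lie algebras and their modules\<close>

locale lie_algebra = vector_space scale
  for scale :: "'k::field \<Rightarrow> 'g::ab_group_add \<Rightarrow> 'g" +
  fixes bracket :: "'g \<Rightarrow> 'g \<Rightarrow> 'g"
  assumes bracket_add_left: "bracket (x + y) z = bracket x z + bracket y z"
    and bracket_add_right: "bracket x (y + z) = bracket x y + bracket x z"
    and bracket_scale_left: "bracket (scale a x) y = scale a (bracket x y)"
    and bracket_scale_right: "bracket x (scale a y) = scale a (bracket x y)"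
    and bracket_self: "bracket x x = 0"
    and jacobi: "bracket x (bracket y z) + bracket y (bracket z x) + bracket z (bracket x y) = 0"

text \<open>
  The space of a module may be a proper subspace of the ambient type; the action is
  only constrained on that subspace.
\<close>

record ('g, 'v) lie_rep =
  rep_space :: "'v set"
  rep_act :: "'g \<Rightarrow> 'v \<Rightarrow> 'v"

locale lie_module =
  lie_algebra scaleL bracket + V: vector_space scaleV
  for scaleL :: "'k::field \<Rightarrow> 'g::ab_group_add \<Rightarrow> 'g"
    and bracket :: "'g \<Rightarrow> 'g \<Rightarrow> 'g"
    and scaleV :: "'k \<Rightarrow> 'v::ab_group_add \<Rightarrow> 'v" +
  fixes M :: "('g, 'v) lie_rep"
  assumes subspace_space: "V.subspace (rep_space M)"
    and act_closed: "v \<in> rep_space M \<Longrightarrow> rep_act M x v \<in> rep_space M"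
    and act_add_left: "v \<in> rep_space M \<Longrightarrow> rep_act M (x + y) v = rep_act M x v + rep_act M y v"
    and act_scale_left: "v \<in> rep_space M \<Longrightarrow> rep_act M (scaleL a x) v = scaleV a (rep_act M x v)"
    and act_add_right:
      "v \<in> rep_space M \<Longrightarrow> w \<in> rep_space M \<Longrightarrow>
        rep_act M x (v + w) = rep_act M x v + rep_act M x w"
    and act_scale_right: "v \<in> rep_space M \<Longrightarrow> rep_act M x (scaleV a v) = scaleV a (rep_act M x v)"
    and act_bracket:
      "v \<in> rep_space M \<Longrightarrow>
        rep_act M (bracket x y) v = rep_act M x (rep_act M y v) - rep_act M y (rep_act M x v)"

locale irreducible_lie_module = lie_module +
  assumes nonzero: "rep_space M \<noteq> {0}"
    and irreducible:
      "U \<subseteq> rep_space M \<Longrightarrow> V.subspace U \<Longrightarrow> (\<And>x u. u \<in> U \<Longrightarrow> rep_act M x u \<in> U)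
        \<Longrightarrow> U = {0} \<or> U = rep_space M"

definition lie_module_isomorphic ::
  "('k::field \<Rightarrow> 'g::ab_group_add \<Rightarrow> 'g) \<Rightarrow> ('g \<Rightarrow> 'g \<Rightarrow> 'g)
    \<Rightarrow> ('k \<Rightarrow> 'v::ab_group_add \<Rightarrow> 'v) \<Rightarrow> ('g, 'v) lie_rep
    \<Rightarrow> ('k \<Rightarrow> 'w::ab_group_add \<Rightarrow> 'w) \<Rightarrow> ('g, 'w) lie_rep \<Rightarrow> bool"
where
  "lie_module_isomorphic scaleL bracket scaleV M scaleW N \<longleftrightarrow>
     lie_module scaleL bracket scaleV M \<and> lie_module scaleL bracket scaleW N \<and>
     (\<exists>\<phi>. bij_betw \<phi> (rep_space M) (rep_space N)
        \<and> (\<forall>v\<in>rep_space M. \<forall>w\<in>rep_space M. \<phi> (v + w) = \<phi> v + \<phi> w)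
        \<and> (\<forall>a. \<forall>v\<in>rep_space M. \<phi> (scaleV a v) = scaleW a (\<phi> v))
        \<and> (\<forall>x. \<forall>v\<in>rep_space M. \<phi> (rep_act M x v) = rep_act N x (\<phi> v)))"


section \<open>Complex vector spaces with a given basis\<close>

text \<open>
  The space with basis \<^typ>\<open>'a\<close> is \<open>'a \<Rightarrow>\<^sub>0 complex\<close>.
  The tensor product of the spaces with bases \<^typ>\<open>'a\<close> and \<^typ>\<open>'b\<close> is the
  space with basis \<^typ>\<open>'a \<times> 'b\<close>.
\<close>

definition pm_scale :: "complex \<Rightarrow> ('a \<Rightarrow>\<^sub>0 complex) \<Rightarrow> ('a \<Rightarrow>\<^sub>0 complex)" where
  "pm_scale c v = Poly_Mapping.map ((*) c) v"

definition bvec :: "'a \<Rightarrow> ('a \<Rightarrow>\<^sub>0 complex)" where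
  "bvec b = Poly_Mapping.single b 1"

definition lin_ext :: "('a \<Rightarrow> ('b \<Rightarrow>\<^sub>0 complex)) \<Rightarrow> ('a \<Rightarrow>\<^sub>0 complex) \<Rightarrow> ('b \<Rightarrow>\<^sub>0 complex)" where
  "lin_ext f v = (\<Sum>b\<in>Poly_Mapping.keys v. pm_scale (Poly_Mapping.lookup v b) (f b))"

definition tensor :: "('a \<Rightarrow>\<^sub>0 complex) \<Rightarrow> ('b \<Rightarrow>\<^sub>0 complex) \<Rightarrow> ('a \<times> 'b \<Rightarrow>\<^sub>0 complex)" where
  "tensor x y = lin_ext (\<lambda>a. lin_ext (\<lambda>b. bvec (a, b)) y) x"

definition tensor_op ::
  "(('a \<Rightarrow>\<^sub>0 complex) \<Rightarrow> ('c \<Rightarrow>\<^sub>0 complex)) \<Rightarrow> (('b \<Rightarrow>\<^sub>0 complex) \<Rightarrow> ('d \<Rightarrow>\<^sub>0 complex))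
    \<Rightarrow> ('a \<times> 'b \<Rightarrow>\<^sub>0 complex) \<Rightarrow> ('c \<times> 'd \<Rightarrow>\<^sub>0 complex)"
where
  "tensor_op A B = lin_ext (\<lambda>(a, b). tensor (A (bvec a)) (B (bvec b)))"

lemma lookup_pm_scale [simp]:
  "Poly_Mapping.lookup (pm_scale c v) k = c * Poly_Mapping.lookup v k"
  by (simp add: pm_scale_def Poly_Mapping.map.rep_eq when_def)

lemma lookup_bvec [simp]: "Poly_Mapping.lookup (bvec b) k = (if b = k then 1 else 0)"
  by (simp add: bvec_def lookup_single when_def)

interpretation pm: vector_space pm_scale
  by unfold_locales (auto intro!: poly_mapping_eqI simp: lookup_add algebra_simps)

lemma lin_ext_superset:
  assumes "finite A" "Poly_Mapping.keys v \<subseteq> A"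
  shows "lin_ext f v = (\<Sum>b\<in>A. pm_scale (Poly_Mapping.lookup v b) (f b))"
  unfolding lin_ext_def using assms
  by (intro sum.mono_neutral_left) (auto simp: in_keys_iff)

lemma lin_ext_bvec [simp]: "lin_ext f (bvec b) = f b"
  by (simp add: lin_ext_def bvec_def)

lemma lin_ext_zero [simp]: "lin_ext f 0 = 0"
  by (simp add: lin_ext_def)

lemma lin_ext_add: "lin_ext f (v + w) = lin_ext f v + lin_ext f w"
proof -
  let ?A = "Poly_Mapping.keys v \<union> Poly_Mapping.keys w"
  have "Poly_Mapping.keys (v + w) \<subseteq> ?A"
    by (rule Poly_Mapping.keys_add)
  then show ?thesis
    by (simp add: lin_ext_superset[of ?A] lookup_add pm.scale_left_distrib sum.distrib)
qed

lemma lin_ext_scale: "lin_ext f (pm_scale c v) = pm_scale c (lin_ext f v)"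
proof -
  have "Poly_Mapping.keys (pm_scale c v) \<subseteq> Poly_Mapping.keys v"
    by (auto simp: in_keys_iff)
  then show ?thesis
    by (simp add: lin_ext_superset[of "Poly_Mapping.keys v"] pm.scale_sum_right)
qed

lemma linear_lin_ext: "Vector_Spaces.linear pm_scale pm_scale (lin_ext f)"
  by unfold_locales (simp_all add: lin_ext_add lin_ext_scale)

lemma bvec_expand: "v = lin_ext bvec v"
proof (rule poly_mapping_eqI)
  fix k
  have "Poly_Mapping.lookup (lin_ext bvec v) k
      = (\<Sum>b\<in>Poly_Mapping.keys v. if b = k then Poly_Mapping.lookup v b else 0)"
    unfolding lin_ext_def lookup_sum
    by (rule sum.cong) (auto simp: bvec_def lookup_single when_def)
  then show "Poly_Mapping.lookup v k = Poly_Mapping.lookup (lin_ext bvec v) k"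
    by (simp add: in_keys_iff)
qed

lemma pm_linear_eqI:
  assumes "Vector_Spaces.linear pm_scale pm_scale f" "Vector_Spaces.linear pm_scale pm_scale g"
    and "\<And>b. f (bvec b) = g (bvec b)"
  shows "f v = g v"
proof -
  interpret f: Vector_Spaces.linear pm_scale pm_scale f by fact
  interpret g: Vector_Spaces.linear pm_scale pm_scale g by fact
  have "f (lin_ext bvec v) = g (lin_ext bvec v)"
    by (simp add: lin_ext_def f.sum g.sum f.scale g.scale assms(3))
  then show ?thesis
    by (simp flip: bvec_expand)
qed

lemma tensor_bvec [simp]: "tensor (bvec a) (bvec b) = bvec (a, b)"
  by (simp add: tensor_def)

lemma pm_linearI:
  assumes "\<And>v w. f (v + w) = f v + f w" "\<And>c v. f (pm_scale c v) = pm_scale c (f v)"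
  shows "Vector_Spaces.linear pm_scale pm_scale f"
  by unfold_locales (simp_all add: assms)

lemma lin_ext_fun_add: "lin_ext (\<lambda>b. f b + g b) v = lin_ext f v + lin_ext g v"
  by (simp add: lin_ext_def pm.scale_right_distrib sum.distrib)

lemma lin_ext_fun_scale: "lin_ext (\<lambda>b. pm_scale c (f b)) v = pm_scale c (lin_ext f v)"
  by (simp add: lin_ext_def pm.scale_sum_right mult.commute)

lemmas lin_ext_simps = lin_ext_add lin_ext_scale lin_ext_fun_add lin_ext_fun_scale

lemma tensor_linear:
  "tensor (x + x') y = tensor x y + tensor x' y" "tensor (pm_scale c x) y = pm_scale c (tensor x y)"
  "tensor x (y + y') = tensor x y + tensor x y'" "tensor x (pm_scale c y) = pm_scale c (tensor x y)"
  by (simp_all add: tensor_def lin_ext_simps)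

lemma tensor_op_tensor:
  assumes A: "Vector_Spaces.linear pm_scale pm_scale A" and B: "Vector_Spaces.linear pm_scale pm_scale B"
  shows "tensor_op A B (tensor x y) = tensor (A x) (B y)"
proof -
  interpret A: Vector_Spaces.linear pm_scale pm_scale A by fact
  interpret B: Vector_Spaces.linear pm_scale pm_scale B by fact
  note simps = tensor_op_def tensor_linear lin_ext_simps A.add A.scale B.add B.scale
  have "tensor_op A B (tensor (bvec a) y) = tensor (A (bvec a)) (B y)" for a
  proof (rule pm_linear_eqI[of "\<lambda>y. tensor_op A B (tensor (bvec a) y)" "\<lambda>y. tensor (A (bvec a)) (B y)"])
    show "Vector_Spaces.linear pm_scale pm_scale (\<lambda>y. tensor_op A B (tensor (bvec a) y))"
      by (rule pm_linearI) (simp_all add: simps)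
    show "Vector_Spaces.linear pm_scale pm_scale (\<lambda>y. tensor (A (bvec a)) (B y))"
      by (rule pm_linearI) (simp_all add: simps)
  qed (simp add: tensor_op_def)
  note * = this
  show ?thesis
  proof (rule pm_linear_eqI[of "\<lambda>x. tensor_op A B (tensor x y)" "\<lambda>x. tensor (A x) (B y)"])
    show "Vector_Spaces.linear pm_scale pm_scale (\<lambda>x. tensor_op A B (tensor x y))"
      by (rule pm_linearI) (simp_all add: simps)
    show "Vector_Spaces.linear pm_scale pm_scale (\<lambda>x. tensor (A x) (B y))"
      by (rule pm_linearI) (simp_all add: simps)
  qed (simp add: *)
qed


section \<open>The affine Lie algebra of \<open>sl\<^sub>2\<close>\<close>

datatype sl2_basis = sl2_e | sl2_f | sl2_h

fun sl2_bracket :: "sl2_basis \<Rightarrow> sl2_basis \<Rightarrow> (sl2_basis \<Rightarrow>\<^sub>0 complex)" where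
  "sl2_bracket sl2_h sl2_e = pm_scale 2 (bvec sl2_e)"
| "sl2_bracket sl2_e sl2_h = pm_scale (-2) (bvec sl2_e)"
| "sl2_bracket sl2_h sl2_f = pm_scale (-2) (bvec sl2_f)"
| "sl2_bracket sl2_f sl2_h = pm_scale 2 (bvec sl2_f)"
| "sl2_bracket sl2_e sl2_f = bvec sl2_h"
| "sl2_bracket sl2_f sl2_e = pm_scale (-1) (bvec sl2_h)"
| "sl2_bracket _ _ = 0"

fun sl2_form :: "sl2_basis \<Rightarrow> sl2_basis \<Rightarrow> complex" where
  "sl2_form sl2_e sl2_f = 1"
| "sl2_form sl2_f sl2_e = 1"
| "sl2_form sl2_h sl2_h = 2"
| "sl2_form _ _ = 0"

text \<open>\<open>Mode a n\<close> stands for \<open>a \<otimes> t\<^sup>n\<close> and \<open>Central\<close> for the central element \<open>c\<close>.\<close>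

datatype affine_basis = Mode sl2_basis int | Central

type_synonym affine = "affine_basis \<Rightarrow>\<^sub>0 complex"

fun affine_bracket_basis :: "affine_basis \<Rightarrow> affine_basis \<Rightarrow> affine" where
  "affine_bracket_basis (Mode a m) (Mode b n) =
     lin_ext (\<lambda>c. bvec (Mode c (m + n))) (sl2_bracket a b)
     + pm_scale (if m + n = 0 then of_int m * sl2_form a b else 0) (bvec Central)"
| "affine_bracket_basis _ _ = 0"

definition affine_bracket :: "affine \<Rightarrow> affine \<Rightarrow> affine" where
  "affine_bracket x y = lin_ext (\<lambda>a. lin_ext (affine_bracket_basis a) y) x"

lemma affine_bracket_linear:
  "affine_bracket (x + x') y = affine_bracket x y + affine_bracket x' y"
  "affine_bracket (pm_scale c x) y = pm_scale c (affine_bracket x y)"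
  "affine_bracket x (y + y') = affine_bracket x y + affine_bracket x y'"
  "affine_bracket x (pm_scale c y) = pm_scale c (affine_bracket x y)"
  by (simp_all add: affine_bracket_def lin_ext_simps)

lemma affine_bracket_bvec [simp]: "affine_bracket (bvec a) (bvec b) = affine_bracket_basis a b"
  by (simp add: affine_bracket_def)

lemma pm_scale_minus_one: "pm_scale (-1) v = - v"
  using pm.scale_minus_left[of 1 v] by simp

lemma sl2_bracket_swap: "sl2_bracket a b = - sl2_bracket b a"
  by (cases a; cases b) (simp_all add: pm_scale_minus_one)

lemma sl2_form_swap: "sl2_form a b = sl2_form b a"
  by (cases a; cases b) simp_all

lemma lin_ext_uminus: "lin_ext f (- v) = - lin_ext f v"
  using lin_ext_scale[of f "-1" v] by simp

lemma affine_bracket_basis_swap: "affine_bracket_basis a b = - affine_bracket_basis b a"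
proof (cases a; cases b)
  fix x y m n assume *: "a = Mode x m" "b = Mode y n"
  have "(if m + n = 0 then of_int m * sl2_form x y else 0)
      = - (if n + m = 0 then of_int n * sl2_form y x else 0)"
    by (auto simp: sl2_form_swap[of x y] add_eq_0_iff)
  then show ?thesis
    by (simp add: * sl2_bracket_swap[of x y] lin_ext_uminus add.commute[of m n])
qed simp_all

lemma affine_bracket_zero [simp]: "affine_bracket 0 x = 0" "affine_bracket x 0 = 0"
  using affine_bracket_linear(2)[of 0 0 x] affine_bracket_linear(4)[of x 0 0] by simp_all

lemma affine_bracket_Central [simp]: "affine_bracket (bvec Central) x = 0"
  by (simp add: affine_bracket_def) (simp add: lin_ext_def)

lemma affine_bracket_uminus:
  "affine_bracket (- x) y = - affine_bracket x y" "affine_bracket x (- y) = - affine_bracket x y"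
  using affine_bracket_linear(2)[of "- 1" x y] affine_bracket_linear(4)[of x "- 1" y] by simp_all

definition sl2_volume :: "sl2_basis \<Rightarrow> sl2_basis \<Rightarrow> sl2_basis \<Rightarrow> complex" where
  "sl2_volume x y z =
     (\<Sum>w\<in>{sl2_e, sl2_f, sl2_h}. Poly_Mapping.lookup (sl2_bracket y z) w * sl2_form x w)"

lemma affine_jacobi_basis:
  "affine_bracket (bvec a) (affine_bracket_basis b c)
   + affine_bracket (bvec b) (affine_bracket_basis c a)
   + affine_bracket (bvec c) (affine_bracket_basis a b) = 0"
proof (cases a; cases b; cases c)
  fix x y z m n k assume *: "a = Mode x m" "b = Mode y n" "c = Mode z k"
  note s = lin_ext_simps lin_ext_uminus affine_bracket_linear affine_bracket_uminus
  have "affine_bracket (bvec (Mode x m)) (lin_ext (\<lambda>c. bvec (Mode c (n + k))) (sl2_bracket y z))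
      = lin_ext (\<lambda>c. bvec (Mode c (m + n + k))) (lin_ext (sl2_bracket x) (sl2_bracket y z))
        + pm_scale (if m + n + k = 0 then of_int m * sl2_volume x y z else 0) (bvec Central)" for x y z m n k
    by (cases x; cases y; cases z)
      (simp_all add: s sl2_volume_def add.assoc mult.commute pm.scale_right_distrib pm.scale_right_diff_distrib)
  note 1 = this[of x m n k y z] this[of y n k m z x] this[of z k m n x y]
  have 2: "of_int m * sl2_volume x y z + of_int n * sl2_volume y z x + of_int k * sl2_volume z x y = 0"
    if "m + n + k = 0"
  proof -
    have "sl2_volume x y z = sl2_volume y z x" "sl2_volume z x y = sl2_volume y z x"
      by (cases x; cases y; cases z; simp add: sl2_volume_def)+
    then have "?thesis \<longleftrightarrow> of_int (m + n + k) * sl2_volume y z x = 0"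
      by (simp add: algebra_simps)
    then show ?thesis
      by (simp add: that)
  qed
  have 3: "lin_ext (sl2_bracket x) (sl2_bracket y z) + lin_ext (sl2_bracket y) (sl2_bracket z x)
      + lin_ext (sl2_bracket z) (sl2_bracket x y) = 0"
    by (cases x; cases y; cases z) (simp_all add: s)
  let ?N = "m + n + k" and ?L = "\<lambda>x y z. lin_ext (sl2_bracket x) (sl2_bracket y z)"
  have N: "n + k + m = ?N" "k + m + n = ?N"
    by simp_all
  have "affine_bracket (bvec a) (affine_bracket_basis b c)
      + affine_bracket (bvec b) (affine_bracket_basis c a)
      + affine_bracket (bvec c) (affine_bracket_basis a b)
    = lin_ext (\<lambda>c. bvec (Mode c ?N)) (?L x y z + ?L y z x + ?L z x y)
      + pm_scale (if ?N = 0 then of_int m * sl2_volume x y z + of_int n * sl2_volume y z x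
          + of_int k * sl2_volume z x y else 0) (bvec Central)"
    unfolding * affine_bracket_basis.simps affine_bracket_linear 1 N
    by (cases "?N = 0") (simp_all add: lin_ext_add pm.scale_left_distrib ac_simps)
  then show ?thesis
    by (simp add: 2 3)
qed simp_all

interpretation affine: lie_algebra pm_scale affine_bracket
proof
  fix x y z :: affine
  note lin = affine_bracket_linear pm.scale_right_distrib pm.scale_minus_right
  have *: "affine_bracket (bvec a) y = - affine_bracket y (bvec a)" for a y
    by (rule pm_linear_eqI[of "\<lambda>y. affine_bracket (bvec a) y" "\<lambda>y. - affine_bracket y (bvec a)" y])
      ((rule pm_linearI; simp add: lin), (rule pm_linearI; simp add: lin),
       simp add: affine_bracket_basis_swap[of a])
  have swap: "affine_bracket x y = - affine_bracket y x" for x y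
    by (rule pm_linear_eqI[of "\<lambda>x. affine_bracket x y" "\<lambda>x. - affine_bracket y x" x])
      ((rule pm_linearI; simp add: lin), (rule pm_linearI; simp add: lin), simp add: *)
  show "affine_bracket x x = 0"
  proof (rule poly_mapping_eqI)
    fix k
    have "Poly_Mapping.lookup (affine_bracket x x) k = - Poly_Mapping.lookup (affine_bracket x x) k"
      by (subst swap) simp
    then show "Poly_Mapping.lookup (affine_bracket x x) k = Poly_Mapping.lookup 0 k"
      by simp
  qed
  define J where "J x y z = affine_bracket x (affine_bracket y z)
    + affine_bracket y (affine_bracket z x) + affine_bracket z (affine_bracket x y)" for x y z
  have J: "Vector_Spaces.linear pm_scale pm_scale (\<lambda>x. J x y z)"
    "Vector_Spaces.linear pm_scale pm_scale (\<lambda>y. J x y z)"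
    "Vector_Spaces.linear pm_scale pm_scale (\<lambda>z. J x y z)" for x y z
    by (rule pm_linearI; simp add: J_def lin)+
  have 0: "Vector_Spaces.linear pm_scale pm_scale (\<lambda>_. 0)"
    by (rule pm_linearI) simp_all
  have "J (bvec a) (bvec b) z = 0" for a b z
    by (rule pm_linear_eqI[OF J(3) 0]) (simp add: J_def affine_jacobi_basis)
  then have "J (bvec a) y z = 0" for a y z
    by (rule pm_linear_eqI[OF J(2) 0])
  then have "J x y z = 0"
    by (rule pm_linear_eqI[OF J(1) 0])
  then show "affine_bracket x (affine_bracket y z) + affine_bracket y (affine_bracket z x)
      + affine_bracket z (affine_bracket x y) = 0"
    by (simp add: J_def)
qed (simp_all add: affine_bracket_linear)


section \<open>The fermionic Fock space \<open>F\<close>\<close>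

text \<open>
  \<open>F\<close> is the exterior algebra on the creation modes \<open>\<Psi>\<^sup>\<plusminus>(r)\<close>, \<open>r < 0\<close>. These are
  labelled by integers: \<open>i < 0\<close> is the label of \<open>\<Psi>\<^sup>+(i + 1/2)\<close> and \<open>i \<ge> 0\<close> is the label
  of \<open>\<Psi>\<^sup>-(-i - 1/2)\<close>. The basis vector of a finite set of labels \<open>i\<^sub>1 < \<dots> < i\<^sub>k\<close> is the
  product, in this order, of the corresponding modes applied to the vacuum.
\<close>

type_synonym fock = "int fset \<Rightarrow>\<^sub>0 complex"

definition fock_vacuum :: fock where
  "fock_vacuum = bvec {||}"

definition fermion_sign :: "int \<Rightarrow> int fset \<Rightarrow> complex" where
  "fermion_sign i D = (- 1) ^ fcard (ffilter (\<lambda>j. j < i) D)"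

definition create :: "int \<Rightarrow> fock \<Rightarrow> fock" where
  "create i = lin_ext (\<lambda>D. if i |\<in>| D then 0 else pm_scale (fermion_sign i D) (bvec (finsert i D)))"

definition annihilate :: "int \<Rightarrow> fock \<Rightarrow> fock" where
  "annihilate i = lin_ext (\<lambda>D. if i |\<in>| D then pm_scale (fermion_sign i D) (bvec (D |-| {|i|})) else 0)"

text \<open>\<open>psi_plus n\<close> is \<open>\<Psi>\<^sup>+(n + 1/2)\<close> and \<open>psi_minus n\<close> is \<open>\<Psi>\<^sup>-(n + 1/2)\<close>.\<close>

definition psi_plus :: "int \<Rightarrow> fock \<Rightarrow> fock" where
  "psi_plus n = (if n < 0 then create n else annihilate n)"

definition psi_minus :: "int \<Rightarrow> fock \<Rightarrow> fock" where
  "psi_minus n = (if n < 0 then create (- n - 1) else annihilate (- n - 1))"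

definition charge :: "fock \<Rightarrow> fock" where
  "charge = lin_ext (\<lambda>D. pm_scale
     (of_nat (fcard (ffilter (\<lambda>i. i < 0) D)) - of_nat (fcard (ffilter (\<lambda>i. i \<ge> 0) D))) (bvec D))"

lemma fermion_sign_square [simp]: "fermion_sign i D * fermion_sign i D = 1"
  by (simp add: fermion_sign_def flip: power_add mult_2)

lemma fermion_sign_finsert:
  assumes "j |\<notin>| D"
  shows "fermion_sign i (finsert j D) = (if j < i then - fermion_sign i D else fermion_sign i D)"
proof -
  have "ffilter (\<lambda>j. j < i) (finsert j D) =
      (if j < i then finsert j (ffilter (\<lambda>j. j < i) D) else ffilter (\<lambda>j. j < i) D)"
    by auto
  then show ?thesis
    using assms by (simp add: fermion_sign_def fcard_finsert_disjoint)
qed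

lemma fermion_sign_fminus:
  "j |\<in>| D \<Longrightarrow>
    fermion_sign i (D |-| {|j|}) = (if j < i then - fermion_sign i D else fermion_sign i D)"
  using fermion_sign_finsert[of j "D |-| {|j|}" i] by (auto simp: finsert_absorb)

lemma create_linear:
  "create i (v + w) = create i v + create i w" "create i (pm_scale c v) = pm_scale c (create i v)"
  by (simp_all add: create_def lin_ext_simps)

lemma annihilate_linear:
  "annihilate i (v + w) = annihilate i v + annihilate i w"
  "annihilate i (pm_scale c v) = pm_scale c (annihilate i v)"
  by (simp_all add: annihilate_def lin_ext_simps)

lemma create_bvec:
  "create i (bvec D) = (if i |\<in>| D then 0 else pm_scale (fermion_sign i D) (bvec (finsert i D)))"
  by (simp add: create_def)

lemma annihilate_bvec:
  "annihilate i (bvec D) = (if i |\<in>| D then pm_scale (fermion_sign i D) (bvec (D |-| {|i|})) else 0)"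
  by (simp add: annihilate_def)

lemma create_zero [simp]: "create i 0 = 0" and annihilate_zero [simp]: "annihilate i 0 = 0"
  by (simp_all add: create_def annihilate_def)

lemma create_create: "create i (create j v) + create j (create i v) = 0"
proof (rule pm_linear_eqI[of "\<lambda>v. create i (create j v) + create j (create i v)" "\<lambda>_. 0" v])
  fix D show "create i (create j (bvec D)) + create j (create i (bvec D)) = 0"
    by (auto simp: create_bvec create_linear fermion_sign_finsert finsert_commute
        simp flip: pm.scale_left_distrib)
qed (rule pm_linearI; simp add: create_linear pm.scale_right_distrib)+

lemma fminus_commute: "D |-| {|i|} |-| {|j|} = D |-| {|j|} |-| {|i|}"
  by auto

lemma annihilate_annihilate: "annihilate i (annihilate j v) + annihilate j (annihilate i v) = 0"
proof (rule pm_linear_eqI[of "\<lambda>v. annihilate i (annihilate j v) + annihilate j (annihilate i v)" "\<lambda>_. 0" v])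
  fix D show "annihilate i (annihilate j (bvec D)) + annihilate j (annihilate i (bvec D)) = 0"
    by (auto simp: annihilate_bvec annihilate_linear fermion_sign_fminus fminus_commute[of D j i]
        simp flip: pm.scale_left_distrib)
qed (rule pm_linearI; simp add: annihilate_linear pm.scale_right_distrib)+

lemma create_annihilate:
  "create i (annihilate j v) + annihilate j (create i v) = (if i = j then v else 0)"
proof (rule pm_linear_eqI[of "\<lambda>v. create i (annihilate j v) + annihilate j (create i v)" "\<lambda>v. if i = j then v else 0" v])
  fix D show "create i (annihilate j (bvec D)) + annihilate j (create i (bvec D)) = (if i = j then bvec D else 0)"
  proof (cases "i = j")
    case True
    then show ?thesis
      by (cases "i |\<in>| D")
        (auto simp: annihilate_bvec create_bvec create_linear annihilate_linear
          fermion_sign_fminus fermion_sign_finsert finsert_absorb)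
  next
    case False
    then have "finsert i (D |-| {|j|}) = finsert i D |-| {|j|}"
      by auto
    with False show ?thesis
      by (auto simp: annihilate_bvec create_bvec create_linear annihilate_linear
          fermion_sign_fminus fermion_sign_finsert simp flip: pm.scale_left_distrib)
  qed
qed (rule pm_linearI; simp add: annihilate_linear create_linear pm.scale_right_distrib)+

lemma clifford_relations:
  "psi_plus r (psi_minus s v) + psi_minus s (psi_plus r v) = (if r + s + 1 = 0 then v else 0)"
  "psi_plus r (psi_plus s v) + psi_plus s (psi_plus r v) = 0"
  "psi_minus r (psi_minus s v) + psi_minus s (psi_minus r v) = 0"
proof -
  have eq: "r = - s - 1 \<longleftrightarrow> r + s + 1 = 0" "- s - 1 = r \<longleftrightarrow> r + s + 1 = 0"
    by auto
  have ac: "annihilate j (create i v) + create i (annihilate j v) = (if i = j then v else 0)" for i j v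
    using create_annihilate[of i j v] by (simp add: add.commute)
  show "psi_plus r (psi_minus s v) + psi_minus s (psi_plus r v) = (if r + s + 1 = 0 then v else 0)"
    by (cases "r < 0"; cases "s < 0")
      (simp_all add: psi_plus_def psi_minus_def create_create annihilate_annihilate
        create_annihilate ac eq)
  show "psi_plus r (psi_plus s v) + psi_plus s (psi_plus r v) = 0"
    by (cases "r < 0"; cases "s < 0")
      (simp_all add: psi_plus_def create_create annihilate_annihilate create_annihilate ac)
  show "psi_minus r (psi_minus s v) + psi_minus s (psi_minus r v) = 0"
    by (cases "r < 0"; cases "s < 0")
      (simp_all add: psi_minus_def create_create annihilate_annihilate create_annihilate ac)
qed

lemma psi_vacuum:
  "n \<ge> 0 \<Longrightarrow> psi_plus n fock_vacuum = 0" "n \<ge> 0 \<Longrightarrow> psi_minus n fock_vacuum = 0"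
  by (simp_all add: psi_plus_def psi_minus_def fock_vacuum_def annihilate_bvec)

lemma lookup_annihilate:
  "Poly_Mapping.lookup (annihilate i v) E =
    (if i |\<in>| E then 0 else fermion_sign i E * Poly_Mapping.lookup v (finsert i E))"
proof -
  have "Poly_Mapping.lookup (annihilate i v) E = (\<Sum>D\<in>Poly_Mapping.keys v.
      if D = finsert i E then (if i |\<in>| E then 0 else fermion_sign i E * Poly_Mapping.lookup v D) else 0)"
    unfolding annihilate_def lin_ext_def lookup_sum
    by (rule sum.cong) (auto simp: fermion_sign_finsert fermion_sign_fminus)
  then show ?thesis
    by (simp add: in_keys_iff)
qed

text \<open>Every nonzero submodule contains the vacuum, and the vacuum generates.\<close>

lemma fock_irreducible:
  assumes U: "pm.subspace U" "U \<noteq> {0}"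
    and plus: "\<And>n v. v \<in> U \<Longrightarrow> psi_plus n v \<in> U"
    and minus: "\<And>n v. v \<in> U \<Longrightarrow> psi_minus n v \<in> U"
  shows "U = UNIV"
proof -
  have c: "create i v \<in> U" and a: "annihilate i v \<in> U" if "v \<in> U" for i v
    using plus[of v i] minus[of v "- i - 1"] that
    by (auto simp: psi_plus_def psi_minus_def split: if_splits)
  have vac: "fock_vacuum \<in> U"
    if "v \<in> U" "v \<noteq> 0" "\<And>D. D \<in> Poly_Mapping.keys v \<Longrightarrow> fcard D \<le> n" for v n
    using that
  proof (induction n arbitrary: v)
    case 0
    have eq: "v = pm_scale (Poly_Mapping.lookup v {||}) fock_vacuum"
      using 0(3) by (intro poly_mapping_eqI) (auto simp: fock_vacuum_def in_keys_iff)
    with 0 have "Poly_Mapping.lookup v {||} \<noteq> 0"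
      by auto
    then have "fock_vacuum = pm_scale (1 / Poly_Mapping.lookup v {||}) v"
      by (subst eq) simp
    with 0(1) U show ?case
      by (metis pm.subspace_scale)
  next
    case (Suc n)
    show ?case
    proof (cases "\<exists>D\<in>Poly_Mapping.keys v. D \<noteq> {||}")
      case True
      then obtain D i where D: "D \<in> Poly_Mapping.keys v" "i |\<in>| D"
        by auto
      then have "Poly_Mapping.lookup (annihilate i v) (D |-| {|i|}) \<noteq> 0"
        by (auto simp: lookup_annihilate finsert_absorb fermion_sign_def in_keys_iff)
      then have "annihilate i v \<noteq> 0"
        by auto
      moreover have "fcard E \<le> n" if "E \<in> Poly_Mapping.keys (annihilate i v)" for E
        using that Suc.prems(3)[of "finsert i E"]
        by (auto simp: in_keys_iff lookup_annihilate fcard_finsert_disjoint split: if_splits)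
      ultimately show ?thesis
        using Suc.IH[of "annihilate i v"] a Suc.prems by blast
    next
      case False
      then show ?thesis
        using Suc.IH[of v] Suc.prems by (metis fcard_fempty le0)
    qed
  qed
  obtain v where v: "v \<in> U" "v \<noteq> 0"
    using U pm.subspace_0 by blast
  have "fock_vacuum \<in> U"
    by (rule vac[OF v, of "Max (fcard ` Poly_Mapping.keys v)"]) simp
  then have basis: "bvec D \<in> U" for D
  proof (induction D)
    case (insert i D)
    have "bvec (finsert i D) = pm_scale (fermion_sign i D) (create i (bvec D))"
      using insert by (simp add: create_bvec)
    with c insert U show ?case
      by (metis pm.subspace_scale)
  qed (simp add: fock_vacuum_def)
  have "v \<in> U" for v
    by (subst bvec_expand) (auto simp: lin_ext_def intro!: pm.subspace_sum pm.subspace_scale U basis)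
  then show ?thesis
    by auto
qed

lemma charge_vacuum: "charge fock_vacuum = 0"
proof -
  have "ffilter P {||} = {||}" for P :: "int \<Rightarrow> bool"
    by auto
  then show ?thesis
    by (simp add: charge_def fock_vacuum_def)
qed

lemma charge_finsert:
  assumes "i |\<notin>| D" and "charge (bvec D) = pm_scale q (bvec D)"
  shows "charge (bvec (finsert i D)) = pm_scale (q + (if i < 0 then 1 else - 1)) (bvec (finsert i D))"
proof -
  have f: "ffilter P (finsert i D) = (if P i then finsert i (ffilter P D) else ffilter P D)" for P
    by auto
  have "q = of_nat (fcard (ffilter (\<lambda>i. i < 0) D)) - of_nat (fcard (ffilter (\<lambda>i. i \<ge> 0) D))"
    using assms(2)[THEN arg_cong, of "\<lambda>v. Poly_Mapping.lookup v D"] by (simp add: charge_def)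
  then show ?thesis
    using assms by (simp add: charge_def f fcard_finsert_disjoint)
qed

lemma charge_linear:
  "charge (v + w) = charge v + charge w" "charge (pm_scale c v) = pm_scale c (charge v)"
  by (simp_all add: charge_def lin_ext_simps)

lemma charge_eigen: "\<exists>q. charge (bvec D) = pm_scale q (bvec D)"
  by (auto simp: charge_def)

lemma charge_create:
  "charge (create i v) - create i (charge v) = pm_scale (if i < 0 then 1 else - 1) (create i v)"
proof (rule pm_linear_eqI[of "\<lambda>v. charge (create i v) - create i (charge v)"
      "\<lambda>v. pm_scale (if i < 0 then 1 else - 1) (create i v)" v])
  fix D
  obtain q where q: "charge (bvec D) = pm_scale q (bvec D)"
    using charge_eigen by blast
  show "charge (create i (bvec D)) - create i (charge (bvec D))
      = pm_scale (if i < 0 then 1 else - 1) (create i (bvec D))"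
  proof (cases "i |\<in>| D")
    case True
    then show ?thesis
      using charge_linear(2)[of 0 0] by (simp add: q create_bvec create_linear)
  next
    case False
    show ?thesis
      by (rule poly_mapping_eqI)
        (use False in \<open>simp add: q create_bvec create_linear charge_linear charge_finsert[OF False q]
          lookup_minus algebra_simps\<close>)
  qed
qed (rule pm_linearI; simp add: create_linear charge_linear pm.scale_right_distrib
    pm.scale_right_diff_distrib pm.scale_left_commute)+

lemma charge_annihilate:
  "charge (annihilate i v) - annihilate i (charge v) = pm_scale (if i < 0 then - 1 else 1) (annihilate i v)"
proof (rule pm_linear_eqI[of "\<lambda>v. charge (annihilate i v) - annihilate i (charge v)"
      "\<lambda>v. pm_scale (if i < 0 then - 1 else 1) (annihilate i v)" v])
  fix D
  show "charge (annihilate i (bvec D)) - annihilate i (charge (bvec D))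
      = pm_scale (if i < 0 then - 1 else 1) (annihilate i (bvec D))"
  proof (cases "i |\<in>| D")
    case True
    then obtain E where E: "D = finsert i E" "i |\<notin>| E"
      by (metis mk_disjoint_finsert)
    obtain q where q: "charge (bvec E) = pm_scale q (bvec E)"
      using charge_eigen by blast
    have "D |-| {|i|} = E"
      using E by auto
    with True show ?thesis
      by (intro poly_mapping_eqI) (simp add: E q annihilate_bvec annihilate_linear charge_linear
          charge_finsert[OF E(2) q] lookup_minus algebra_simps)
  next
    case False
    obtain q where q: "charge (bvec D) = pm_scale q (bvec D)"
      using charge_eigen by blast
    with False show ?thesis
      using charge_linear(2)[of 0 0] by (simp add: q annihilate_bvec annihilate_linear)
  qed
qed (rule pm_linearI; simp add: annihilate_linear charge_linear pm.scale_right_distrib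
    pm.scale_right_diff_distrib pm.scale_left_commute)+

lemma charge_psi:
  "charge (psi_plus n v) - psi_plus n (charge v) = psi_plus n v"
  "charge (psi_minus n v) - psi_minus n (charge v) = - psi_minus n v"
  by (simp_all add: psi_plus_def psi_minus_def charge_create charge_annihilate)

text \<open>The mode \<open>\<chi>\<^sub>n\<close> of \<open>\<chi>(z) = \<Sum>\<^sub>n \<chi>\<^sub>n z\<^bsup>-n-1\<^esup>\<close>.\<close>

definition fls_mode :: "complex fls \<Rightarrow> int \<Rightarrow> complex" where
  "fls_mode \<chi> n = fls_nth \<chi> (- n - 1)"

lemma fls_mode_over_z: "fls_mode (fls_const a / fls_X) n = (if n = 0 then a else 0)"
  by (simp add: fls_mode_def fls_divide_def)

text \<open>
  With \<open>\<psi> n = \<Psi>\<^sup>\<plusminus>(n + 1/2)\<close>, \<open>dressed_mode \<psi> \<chi> i\<close> is \<open>G\<^sup>\<plusminus>(i - 1/2)\<close>. On each vector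
  only finitely many terms of the sum are nonzero.
\<close>

definition dressed_mode :: "(int \<Rightarrow> fock \<Rightarrow> fock) \<Rightarrow> complex fls \<Rightarrow> int \<Rightarrow> fock \<Rightarrow> fock" where
  "dressed_mode \<psi> \<chi> i v =
     pm_scale (- of_int i) (\<psi> (i - 1) v)
     + Sum_any (\<lambda>k. pm_scale (fls_mode \<chi> (- k)) (\<psi> (k + i - 1) v))"


section \<open>The lattice vertex superalgebra \<open>F\<^sub>-\<^sub>1\<close>\<close>

text \<open>
  The basis vector \<open>(m, {#j\<^sub>1, \<dots>, j\<^sub>k#})\<close> is \<open>\<beta>(-j\<^sub>1-1) \<cdots> \<beta>(-j\<^sub>k-1) e\<^bsup>m\<beta>\<^esup>\<close>.
  The signs in \<open>beta\<close> come from \<open>\<langle>\<beta>,\<beta>\<rangle> = -1\<close>.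
\<close>

type_synonym lattice = "int \<times> nat multiset \<Rightarrow>\<^sub>0 complex"

definition beta :: "int \<Rightarrow> lattice \<Rightarrow> lattice" where
  "beta n = lin_ext (\<lambda>(m, \<mu>).
     if n < 0 then bvec (m, add_mset (nat (- n - 1)) \<mu>)
     else if n = 0 then pm_scale (- of_int m) (bvec (m, \<mu>))
     else pm_scale (- of_int n * of_nat (count \<mu> (nat (n - 1)))) (bvec (m, \<mu> - {#nat (n - 1)#})))"

lemma beta_linear:
  "beta n (v + w) = beta n v + beta n w" "beta n (pm_scale c v) = pm_scale c (beta n v)"
  by (simp_all add: beta_def lin_ext_simps)

lemma beta_zero [simp]: "beta n 0 = 0"
  by (simp add: beta_def)

lemma beta_uminus: "beta n (- v) = - beta n v"
  by (simp add: beta_def lin_ext_uminus)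

lemma beta_bvec:
  "n < 0 \<Longrightarrow> beta n (bvec (k, \<mu>)) = bvec (k, add_mset (nat (- n - 1)) \<mu>)"
  "beta 0 (bvec (k, \<mu>)) = pm_scale (- of_int k) (bvec (k, \<mu>))"
  "n > 0 \<Longrightarrow> beta n (bvec (k, \<mu>)) =
    pm_scale (- of_int n * of_nat (count \<mu> (nat (n - 1)))) (bvec (k, \<mu> - {#nat (n - 1)#}))"
  by (simp_all add: beta_def)

lemma beta_commutator_pos_neg:
  assumes "m > 0" "n < 0"
  shows "beta m (beta n (bvec (k, \<mu>))) - beta n (beta m (bvec (k, \<mu>)))
    = pm_scale (if m + n = 0 then - of_int m else 0) (bvec (k, \<mu>))"
proof -
  define i j where ij: "i = nat (m - 1)" "j = nat (- n - 1)"
  have eq: "m + n = 0 \<longleftrightarrow> i = j"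
    using assms by (auto simp: ij)
  have "add_mset j \<mu> - {#i#} = add_mset j (\<mu> - {#i#})" if "count \<mu> i \<noteq> 0"
    using that by (simp add: multiset_eq_iff)
  then show ?thesis
    using assms
    by (cases "count \<mu> i = 0")
      (auto simp: beta_bvec beta_linear beta_uminus eq ring_distribs pm.scale_left_distrib
        pm.scale_left_diff_distrib simp flip: ij)
qed

lemma beta_commutator:
  "beta m (beta n v) - beta n (beta m v) = pm_scale (if m + n = 0 then - of_int m else 0) v"
proof (rule pm_linear_eqI[of "\<lambda>v. beta m (beta n v) - beta n (beta m v)"
      "\<lambda>v. pm_scale (if m + n = 0 then - of_int m else 0) v" v])
  fix b :: "int \<times> nat multiset"
  obtain k \<mu> where b: "b = (k, \<mu>)" by fastforce
  show "beta m (beta n (bvec b)) - beta n (beta m (bvec b))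
      = pm_scale (if m + n = 0 then - of_int m else 0) (bvec b)"
  proof -
    consider "m > 0" "n < 0" | "m < 0" "n > 0" | "m = 0" | "n = 0" | "m > 0" "n > 0" | "m < 0" "n < 0"
      by linarith
    then show ?thesis
    proof cases
      case 1
      then show ?thesis
        by (simp add: b beta_commutator_pos_neg)
    next
      case 2
      have "beta m (beta n (bvec b)) - beta n (beta m (bvec b))
          = - (beta n (beta m (bvec b)) - beta m (beta n (bvec b)))"
        by simp
      also have "\<dots> = pm_scale (if m + n = 0 then - of_int m else 0) (bvec b)"
        using 2 by (auto simp: b beta_commutator_pos_neg add_eq_0_iff simp flip: pm.scale_minus_left)
      finally show ?thesis .
    next
      case 3
      then show ?thesis
        by (cases n "0 :: int" rule: linorder_cases) (simp_all add: b beta_bvec beta_linear beta_uminus mult.commute)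
    next
      case 4
      then show ?thesis
        by (cases m "0 :: int" rule: linorder_cases) (simp_all add: b beta_bvec beta_linear beta_uminus mult.commute)
    next
      case 5
      then show ?thesis
        by (cases "m = n") (simp_all add: b beta_bvec beta_linear beta_uminus diff_diff_add_mset add_mset_commute ac_simps)
    next
      case 6
      then show ?thesis
        by (simp add: b beta_bvec add_mset_commute)
    qed
  qed
qed (rule pm_linearI; simp add: beta_linear pm.scale_right_distrib
    pm.scale_right_diff_distrib pm.scale_left_commute)+

text \<open>
  For \<open>A(w) = \<Sum>\<^bsub>j\<ge>1\<^esub> A\<^sub>j w\<^sup>j\<close> with operator coefficients, \<open>series_power A k a\<close> is the
  coefficient of \<open>w\<^sup>a\<close> in \<open>A(w)\<^sup>k\<close> and \<open>series_exp A a\<close> the coefficient of \<open>w\<^sup>a\<close> in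
  \<open>exp (A(w))\<close>; powers \<open>k > a\<close> do not contribute.
\<close>

fun series_power ::
  "(nat \<Rightarrow> ('a \<Rightarrow>\<^sub>0 complex) \<Rightarrow> ('a \<Rightarrow>\<^sub>0 complex)) \<Rightarrow> nat \<Rightarrow> nat \<Rightarrow> ('a \<Rightarrow>\<^sub>0 complex) \<Rightarrow> ('a \<Rightarrow>\<^sub>0 complex)"
where
  "series_power A 0 a v = (if a = 0 then v else 0)"
| "series_power A (Suc k) a v = (\<Sum>j=1..a. A j (series_power A k (a - j) v))"

definition series_exp ::
  "(nat \<Rightarrow> ('a \<Rightarrow>\<^sub>0 complex) \<Rightarrow> ('a \<Rightarrow>\<^sub>0 complex)) \<Rightarrow> nat \<Rightarrow> ('a \<Rightarrow>\<^sub>0 complex) \<Rightarrow> ('a \<Rightarrow>\<^sub>0 complex)"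
where
  "series_exp A a v = (\<Sum>k\<le>a. pm_scale (1 / fact k) (series_power A k a v))"

definition beta_exp_minus :: "int \<Rightarrow> nat \<Rightarrow> lattice \<Rightarrow> lattice" where
  "beta_exp_minus l = series_exp (\<lambda>j v. pm_scale (of_int l / of_nat j) (beta (- int j) v))"

definition beta_exp_plus :: "int \<Rightarrow> nat \<Rightarrow> lattice \<Rightarrow> lattice" where
  "beta_exp_plus l = series_exp (\<lambda>j v. pm_scale (- of_int l / of_nat j) (beta (int j) v))"

text \<open>
  \<open>lattice_mode l n\<close> is the coefficient \<open>e\<^bsup>l\<beta>\<^esup>\<^sub>n\<close> of \<open>z\<^bsup>-n-1\<^esup>\<close> in
  \<open>Y(e\<^bsup>l\<beta>\<^esup>,z) = exp (\<Sum>\<^bsub>j\<ge>1\<^esub> l\<beta>(-j) z\<^sup>j / j) exp (-\<Sum>\<^bsub>j\<ge>1\<^esub> l\<beta>(j) z\<^bsup>-j\<^esup> / j) e\<^bsup>l\<beta>\<^esup> z\<^bsup>l\<beta>(0)\<^esup>\<close>.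
  Here \<open>z\<^bsup>l\<beta>(0)\<^esup>\<close> is \<open>z\<^bsup>-lm\<^esup>\<close> on \<open>(m, \<mu>)\<close>, so the term with \<open>z\<^bsup>-b\<^esup>\<close> from the second
  exponential is paired with the one with \<open>z\<^bsup>b+lm-n-1\<^esup>\<close> from the first. Only
  finitely many \<open>b\<close> contribute.
\<close>

definition lattice_mode :: "int \<Rightarrow> int \<Rightarrow> lattice \<Rightarrow> lattice" where
  "lattice_mode l n = lin_ext (\<lambda>(m, \<mu>). Sum_any (\<lambda>b::nat.
     if int b + l * m - n - 1 \<ge> 0
     then beta_exp_minus l (nat (int b + l * m - n - 1)) (beta_exp_plus l b (bvec (m + l, \<mu>)))
     else 0))"


lemma series_power_kernel:
  assumes "\<And>j. j \<ge> 1 \<Longrightarrow> A j v = 0" "\<And>j. A j 0 = 0"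
  shows "series_power A k a v = (if k = 0 \<and> a = 0 then v else 0)"
proof (induction k arbitrary: a)
  case (Suc k)
  show ?case
    by (auto simp: Suc assms intro!: sum.neutral)
qed simp

lemma series_exp_kernel:
  assumes "\<And>j. j \<ge> 1 \<Longrightarrow> A j v = 0" "\<And>j. A j 0 = 0"
  shows "series_exp A a v = (if a = 0 then v else 0)"
  by (auto simp: series_exp_def series_power_kernel[OF assms] intro!: sum.neutral)

lemma series_exp_0 [simp]: "series_exp A 0 v = v"
  by (simp add: series_exp_def)

lemma lattice_mode_leading:
  "lattice_mode l (l * m - 1) (bvec (m, {#})) = bvec (m + l, {#})"
  "n > l * m - 1 \<Longrightarrow> lattice_mode l n (bvec (m, {#})) = 0"
proof -
  have p: "beta_exp_plus l b (bvec (m + l, {#})) = (if b = 0 then bvec (m + l, {#}) else 0)" for b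
    unfolding beta_exp_plus_def by (rule series_exp_kernel) (simp_all add: beta_bvec)
  have z: "beta_exp_minus l a 0 = 0" for a
    unfolding beta_exp_minus_def by (subst series_exp_kernel) simp_all
  have *: "lattice_mode l n (bvec (m, {#})) = Sum_any (\<lambda>b::nat.
      if b = 0 then if l * m - n - 1 \<ge> 0 then beta_exp_minus l (nat (l * m - n - 1)) (bvec (m + l, {#}))
        else 0 else 0)" for n
    unfolding lattice_mode_def lin_ext_bvec prod.case p
    by (rule arg_cong[of _ _ Sum_any]) (auto simp: fun_eq_iff z)
  show "lattice_mode l (l * m - 1) (bvec (m, {#})) = bvec (m + l, {#})"
    unfolding * by (simp add: beta_exp_minus_def Sum_any.expand_set cong: if_cong)
  show "n > l * m - 1 \<Longrightarrow> lattice_mode l n (bvec (m, {#})) = 0"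
    unfolding * by (simp cong: if_cong)
qed

section \<open>The affine action on \<open>F(\<chi>\<^sup>+,\<chi>\<^sup>-) \<otimes> F\<^sub>-\<^sub>1\<close>\<close>

type_synonym state = "int fset \<times> (int \<times> nat multiset) \<Rightarrow>\<^sub>0 complex"

text \<open>The scalar \<open>T(n)\<close>.\<close>

definition T_mode :: "complex fls \<Rightarrow> complex fls \<Rightarrow> int \<Rightarrow> complex" where
  "T_mode \<chi>p \<chi>m n = (fls_mode \<chi>p n - fls_mode \<chi>m n) / 2"

fun affine_op :: "complex fls \<Rightarrow> complex fls \<Rightarrow> affine_basis \<Rightarrow> state \<Rightarrow> state" where
  "affine_op \<chi>p \<chi>m (Mode sl2_e n) v =
     Sum_any (\<lambda>i. tensor_op (dressed_mode psi_plus \<chi>p i) (lattice_mode 1 (n - i - 1)) v)"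
| "affine_op \<chi>p \<chi>m (Mode sl2_f n) v =
     Sum_any (\<lambda>i. tensor_op (dressed_mode psi_minus \<chi>m i) (lattice_mode (- 1) (n - i - 1)) v)"
| "affine_op \<chi>p \<chi>m (Mode sl2_h n) v =
     pm_scale (- 2) (tensor_op id (beta n) v) + pm_scale (2 * T_mode \<chi>p \<chi>m n) v"
| "affine_op \<chi>p \<chi>m Central v = pm_scale (- 2) v"

definition affine_act :: "complex fls \<Rightarrow> complex fls \<Rightarrow> affine \<Rightarrow> state \<Rightarrow> state" where
  "affine_act \<chi>p \<chi>m x v = lin_ext (\<lambda>b. affine_op \<chi>p \<chi>m b v) x"

definition H0 :: "state \<Rightarrow> state" where
  "H0 v = tensor_op charge id v + tensor_op id (beta 0) v"

definition L0 :: "complex fls \<Rightarrow> complex fls \<Rightarrow> (affine, state) lie_rep" where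
  "L0 \<chi>p \<chi>m = \<lparr>rep_space = {v. H0 v = 0}, rep_act = affine_act \<chi>p \<chi>m\<rparr>"

text \<open>
  The underlying vector space of the vertex algebra \<open>\<Pi>(0)\<close>, the kernel of \<open>H(0)\<close> on
  \<open>F \<otimes> F\<^sub>-\<^sub>1\<close>.
\<close>

definition Pi0 :: "state set" where
  "Pi0 = {v. H0 v = 0}"

end

theory Submission
  imports Defs
begin

text \<open>
  The module asserted to exist is \<open>\<L>\<^sub>0(F(\<lambda>/z,\<chi>))\<close> itself, whose space is the kernel of
  \<open>H(0)\<close>. Two things have to be shown: that the given operators define an action of the affine Lie
  algebra, and that the action on the kernel is irreducible.

  The action. Both factors of \<open>e(z) = G\<^sup>+(z) \<otimes> Y(e\<^sup>\<beta>,z)\<close> are odd, so commutators of such products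
  reduce to anticommutators of the factors. The anticommutator \<open>{G\<^sup>+(z), G\<^sup>-(w)}\<close> is a scalar
  distribution supported on the diagonal, with derivatives of the delta function up to order two
  (\<open>dressed_plus_minus\<close>). Hence \<open>[e(z), f(w)]\<close> only depends on the expansion of
  \<open>Y(e\<^sup>\<beta>,z) Y(e\<^bsup>-\<beta>\<^esup>,w)\<close> to second order around \<open>z = w\<close>, which is
  \<open>(z - w) (1 + (z - w) \<beta>(w) + \<dots>)\<close> (\<open>diagonal_quadratic\<close>). The triple pole \<open>-2 (z - w)\<^sup>-\<^sup>3\<close>
  of \<open>G\<^sup>+(z) G\<^sup>-(w)\<close> then yields the level \<open>-2\<close> and the summand \<open>-2\<beta>\<close> of \<open>h\<close>, its double poles yield
  \<open>2T = \<chi>\<^sup>+ - \<chi>\<^sup>-\<close>, and its simple pole is cancelled. For \<open>[e(z), e(w)]\<close> the fermionic factor vanishes on the diagonal, where \<open>{Y(e\<^sup>\<beta>,z), Y(e\<^sup>\<beta>,w)}\<close> is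
  supported.

  The quadratic relations of the lattice vertex operators rest on two observations. By the formula
  for the exponentials, \<open>[\<beta>(k), Y(e\<^bsup>l\<beta>\<^esup>,z)] = - l z\<^sup>k Y(e\<^bsup>l\<beta>\<^esup>,z)\<close> (\<open>beta_lattice_mode\<close>). And since the
  Heisenberg algebra acts irreducibly on each charge sector, a family of operators closed under
  commutators with it vanishes as soon as its vacuum coefficients do (\<open>heisenberg_family_zero\<close>).
  So every relation is a statement about the scalar series \<open>(z - w)\<^bsup>-st\<^esup>\<close> (\<open>lattice_pair_vacuum\<close>).

  Irreducibility. Since \<open>h(n)\<close> is \<open>-2\<beta>(n)\<close> plus a scalar, a submodule \<open>U\<close> is stable under the
  Heisenberg algebra, so it is determined by the vectors \<open>w \<in> F\<close> that occur in it next to the vacua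
  \<open>e\<^bsup>m\<beta>\<^esup>\<close>. Taking vacuum components of \<open>e(z)\<close> and \<open>f(z)\<close> shows that these vectors form a subspace
  stable under all modes of \<open>G\<^sup>\<plusminus>\<close> (\<open>vacuum_vectors_stable\<close>). The hypotheses on \<open>\<lambda>\<close> and \<open>\<chi>\<close> ensure
  that the fermionic modes can be recovered from these: \<open>G\<^sup>+(i - 1/2) = (\<lambda> - i) \<Psi>\<^sup>+(i - 1/2)\<close>, and
  \<open>G\<^sup>-(i - 1/2)\<close> is a nonzero multiple of \<open>\<Psi>\<^sup>-(i - p - 1/2)\<close> plus higher modes, which annihilate
  any given vector when high enough (\<open>undress_modes\<close>). So the subspace is \<open>0\<close> or \<open>F\<close> by irreducibility
  of \<open>F\<close>, and \<open>U\<close> is \<open>0\<close> or the whole kernel.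
\<close>

section \<open>Locally finite sums and fields of operators\<close>

abbreviation pm_linear :: "(('a \<Rightarrow>\<^sub>0 complex) \<Rightarrow> ('b \<Rightarrow>\<^sub>0 complex)) \<Rightarrow> bool" where
  "pm_linear \<equiv> Vector_Spaces.linear pm_scale pm_scale"

lemma pm_linear_simps:
  assumes "pm_linear f"
  shows "f (v + w) = f v + f w" "f (pm_scale c v) = pm_scale c (f v)" "f 0 = 0"
    "f (- v) = - f v" "f (v - w) = f v - f w" "f (sum g A) = (\<Sum>a\<in>A. f (g a))"
proof -
  interpret f: Vector_Spaces.linear pm_scale pm_scale f by fact
  show "f (v + w) = f v + f w" "f (pm_scale c v) = pm_scale c (f v)" "f 0 = 0"
    "f (- v) = - f v" "f (v - w) = f v - f w" "f (sum g A) = (\<Sum>a\<in>A. f (g a))"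
    by (simp_all add: f.add f.scale f.neg f.diff f.sum)
qed

lemma pm_linear_add: "pm_linear f \<Longrightarrow> pm_linear g \<Longrightarrow> pm_linear (\<lambda>v. f v + g v)"
  by (intro pm_linearI) (simp_all add: pm_linear_simps pm.scale_right_distrib)

lemma pm_linear_diff: "pm_linear f \<Longrightarrow> pm_linear g \<Longrightarrow> pm_linear (\<lambda>v. f v - g v)"
  by (intro pm_linearI) (simp_all add: pm_linear_simps pm.scale_right_diff_distrib)

lemma pm_linear_scale: "pm_linear f \<Longrightarrow> pm_linear (\<lambda>v. pm_scale c (f v))"
  by (intro pm_linearI) (simp_all add: pm_linear_simps pm.scale_right_distrib mult.commute)

lemma pm_linear_compose: "pm_linear f \<Longrightarrow> pm_linear g \<Longrightarrow> pm_linear (\<lambda>v. f (g v))"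
  by (intro pm_linearI) (simp_all add: pm_linear_simps)

lemma pm_linear_zero: "pm_linear (\<lambda>v. 0)"
  by (intro pm_linearI) simp_all

lemma pm_linear_id: "pm_linear (\<lambda>v. v)"
  by (intro pm_linearI) simp_all

lemma pm_linear_sum: "(\<And>a. a \<in> A \<Longrightarrow> pm_linear (f a)) \<Longrightarrow> pm_linear (\<lambda>v. \<Sum>a\<in>A. f a v)"
  by (intro pm_linearI) (simp_all add: pm_linear_simps sum.distrib pm.scale_sum_right)

lemmas pm_linear_intros =
  pm_linear_add pm_linear_diff pm_linear_scale pm_linear_zero pm_linear_id
  pm_linear_sum linear_lin_ext

lemma Sum_any_linear:
  assumes "pm_linear f" "finite {a. g a \<noteq> 0}"
  shows "f (Sum_any g) = Sum_any (\<lambda>a. f (g a))"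
proof -
  have "Sum_any (\<lambda>a. f (g a)) = (\<Sum>a | g a \<noteq> 0. f (g a))"
    by (rule Sum_any.expand_superset) (use assms in \<open>auto simp: pm_linear_simps(3)\<close>)
  then show ?thesis
    by (simp add: Sum_any.expand_set pm_linear_simps(6)[OF assms(1)])
qed

lemma Sum_any_scale:
  assumes "finite {a. g a \<noteq> 0}"
  shows "pm_scale c (Sum_any g) = Sum_any (\<lambda>a. pm_scale c (g a))"
  by (rule Sum_any_linear[OF pm_linear_scale[OF pm_linear_id] assms])

lemma Sum_any_uminus:
  fixes g :: "'a \<Rightarrow> ('b \<Rightarrow>\<^sub>0 complex)"
  assumes "finite {a. g a \<noteq> 0}"
  shows "- Sum_any g = Sum_any (\<lambda>a. - g a)"
  using Sum_any_scale[OF assms, of "-1"] by (simp add: pm_scale_minus_one)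

lemma Sum_any_diff:
  fixes g h :: "'a \<Rightarrow> ('b \<Rightarrow>\<^sub>0 complex)"
  assumes "finite {a. g a \<noteq> 0}" "finite {a. h a \<noteq> 0}"
  shows "Sum_any (\<lambda>a. g a - h a) = Sum_any g - Sum_any h"
  using Sum_any.distrib[of g "\<lambda>a. - h a"] assms by (simp add: Sum_any_uminus)

lemma pm_linear_Sum_any:
  assumes "\<And>a. pm_linear (F a)" "\<And>v. finite {a. F a v \<noteq> 0}"
  shows "pm_linear (\<lambda>v. Sum_any (\<lambda>a. F a v))"
  by (rule pm_linearI)
    (simp_all add: pm_linear_simps[OF assms(1)] Sum_any.distrib assms(2) Sum_any_scale)

text \<open>
  Local finiteness of a family of linear maps need only be tested on a basis, since a vector has
  finite support.
\<close>

lemma finite_support_linear: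
  assumes "\<And>a. pm_linear (F a)" "\<And>b. finite {a. F a (bvec b) \<noteq> 0}"
  shows "finite {a. F a v \<noteq> 0}"
proof (rule finite_subset)
  show "{a. F a v \<noteq> 0} \<subseteq> (\<Union>b\<in>Poly_Mapping.keys v. {a. F a (bvec b) \<noteq> 0})"
  proof
    fix a assume a: "a \<in> {a. F a v \<noteq> 0}"
    have "F a v = (\<Sum>b\<in>Poly_Mapping.keys v. pm_scale (Poly_Mapping.lookup v b) (F a (bvec b)))"
      by (subst bvec_expand) (simp add: lin_ext_def pm_linear_simps[OF assms(1)])
    with a show "a \<in> (\<Union>b\<in>Poly_Mapping.keys v. {a. F a (bvec b) \<noteq> 0})"
      by (auto intro: ccontr simp: sum.neutral)
  qed
qed (use assms(2) in auto)

text \<open>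
  The coefficients \<open>A\<^sub>n\<close> of a field \<open>A(z) = \<Sum>\<^sub>n A\<^sub>n z\<^bsup>-n-1\<^esup>\<close> in the sense of vertex algebras.
\<close>

definition is_field :: "(int \<Rightarrow> ('a \<Rightarrow>\<^sub>0 complex) \<Rightarrow> ('a \<Rightarrow>\<^sub>0 complex)) \<Rightarrow> bool" where
  "is_field A \<longleftrightarrow> (\<forall>n. pm_linear (A n)) \<and> (\<forall>v. \<exists>N. \<forall>n\<ge>N. A n v = 0)"

lemma is_field_linear: "is_field A \<Longrightarrow> pm_linear (A n)"
  by (simp add: is_field_def)

lemma is_field_truncation:
  assumes "is_field A"
  obtains N where "\<And>n. n \<ge> N \<Longrightarrow> A n v = 0"
  using assms unfolding is_field_def by metis

lemma is_fieldI:
  fixes A :: "int \<Rightarrow> ('a \<Rightarrow>\<^sub>0 complex) \<Rightarrow> ('a \<Rightarrow>\<^sub>0 complex)"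
  assumes lin: "\<And>n. pm_linear (A n)" and basis: "\<And>b. \<exists>N. \<forall>n\<ge>N. A n (bvec b) = 0"
  shows "is_field A"
  unfolding is_field_def
proof (intro conjI allI)
  fix v :: "'a \<Rightarrow>\<^sub>0 complex"
  have "\<exists>N. \<forall>b. \<forall>n\<ge>N b. A n (bvec b) = 0"
    using basis by metis
  then obtain N where N: "A n (bvec b) = 0" if "n \<ge> N b" for n b by metis
  define M where "M = Max (insert 0 (N ` Poly_Mapping.keys v))"
  have "A n v = 0" if n: "n \<ge> M" for n
  proof -
    have "N b \<le> n" if "b \<in> Poly_Mapping.keys v" for b
      using that n order.trans[of "N b" M n] by (simp add: M_def)
    then show ?thesis
      by (subst bvec_expand) (simp add: lin_ext_def pm_linear_simps[OF lin] N sum.neutral)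
  qed
  then show "\<exists>N. \<forall>n\<ge>N. A n v = 0" by blast
qed (rule lin)

section \<open>Products of fields on a tensor product\<close>

lemma tensor_zero [simp]: "tensor 0 y = 0" "tensor x 0 = 0"
  by (simp_all add: tensor_def) (simp add: lin_ext_def)

lemma tensor_pm_linear: "pm_linear (\<lambda>x. tensor x y)" "pm_linear (\<lambda>y. tensor x y)"
  by (intro pm_linearI; simp add: tensor_linear)+

lemmas tensor_simps = tensor_linear pm_linear_simps[OF tensor_pm_linear(1)]
  pm_linear_simps[OF tensor_pm_linear(2)]

lemma pm_linear_tensor_op: "pm_linear (tensor_op A B)"
  by (simp add: tensor_op_def linear_lin_ext)

lemma pm_linear_eq_tensor:
  assumes "pm_linear f" "pm_linear g" "\<And>x y. f (tensor x y) = g (tensor x y)"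
  shows "f v = g v"
  using assms(1,2)
proof (rule pm_linear_eqI)
  fix b :: "'a \<times> 'b"
  show "f (bvec b) = g (bvec b)"
    using assms(3)[of "bvec (fst b)" "bvec (snd b)"] by simp
qed

text \<open>The \<open>n\<close>-th mode of \<open>A(z) \<otimes> B(z)\<close>, where \<open>A\<^sub>i\<close> is the coefficient of \<open>z\<^bsup>-i-1\<^esup>\<close>.\<close>

definition tensor_field ::
  "(int \<Rightarrow> ('a \<Rightarrow>\<^sub>0 complex) \<Rightarrow> ('a \<Rightarrow>\<^sub>0 complex)) \<Rightarrow> (int \<Rightarrow> ('b \<Rightarrow>\<^sub>0 complex) \<Rightarrow> ('b \<Rightarrow>\<^sub>0 complex))
    \<Rightarrow> int \<Rightarrow> ('a \<times> 'b \<Rightarrow>\<^sub>0 complex) \<Rightarrow> ('a \<times> 'b \<Rightarrow>\<^sub>0 complex)"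
where
  "tensor_field A B n v = Sum_any (\<lambda>i. tensor_op (A i) (B (n - i - 1)) v)"

context
  fixes A :: "int \<Rightarrow> ('a \<Rightarrow>\<^sub>0 complex) \<Rightarrow> ('a \<Rightarrow>\<^sub>0 complex)"
    and B :: "int \<Rightarrow> ('b \<Rightarrow>\<^sub>0 complex) \<Rightarrow> ('b \<Rightarrow>\<^sub>0 complex)"
  assumes A: "is_field A" and B: "is_field B"
begin

lemma tensor_field_finite_tensor: "finite {i. tensor (A i x) (B (n - i - 1) y) \<noteq> 0}"
proof -
  obtain M where M: "\<And>i. i \<ge> M \<Longrightarrow> A i x = 0"
    using A is_field_truncation by metis
  obtain N where N: "\<And>i. i \<ge> N \<Longrightarrow> B i y = 0"
    using B is_field_truncation by metis
  have "{i. tensor (A i x) (B (n - i - 1) y) \<noteq> 0} \<subseteq> {n - N - 1..M}"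
  proof
    fix i assume "i \<in> {i. tensor (A i x) (B (n - i - 1) y) \<noteq> 0}"
    then have "A i x \<noteq> 0" "B (n - i - 1) y \<noteq> 0"
      by auto
    then show "i \<in> {n - N - 1..M}"
      using M[of i] N[of "n - i - 1"] by force
  qed
  then show ?thesis
    by (rule finite_subset) simp
qed

lemma tensor_field_finite: "finite {i. tensor_op (A i) (B (n - i - 1)) v \<noteq> 0}"
proof (rule finite_support_linear)
  fix b :: "'a \<times> 'b"
  show "finite {i. tensor_op (A i) (B (n - i - 1)) (bvec b) \<noteq> 0}"
    using tensor_field_finite_tensor[of "bvec (fst b)" n "bvec (snd b)"]
    by (simp add: tensor_op_def split_beta)
qed (rule pm_linear_tensor_op)

lemma tensor_field_linear: "pm_linear (tensor_field A B n)"
  unfolding tensor_field_def[abs_def]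
  by (rule pm_linear_Sum_any[OF pm_linear_tensor_op tensor_field_finite])

lemma tensor_field_tensor:
  "tensor_field A B n (tensor x y) = Sum_any (\<lambda>i. tensor (A i x) (B (n - i - 1) y))"
  using A B by (simp add: tensor_field_def tensor_op_tensor is_field_linear)

end

lemma Sum_any_pairs:
  fixes g :: "'a \<Rightarrow> 'b \<Rightarrow> 'c::comm_monoid_add"
  assumes "finite {(a, b). g a b \<noteq> 0}"
  shows "Sum_any (\<lambda>a. Sum_any (g a)) = Sum_any (\<lambda>(a, b). g a b)"
proof (rule Sum_any.cartesian_product)
  let ?S = "{(a, b). g a b \<noteq> 0}"
  show "finite (fst ` ?S \<times> snd ` ?S)" using assms by simp
  show "{a. \<exists>b. g a b \<noteq> 0} \<times> {b. \<exists>a. g a b \<noteq> 0} \<subseteq> fst ` ?S \<times> snd ` ?S"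
    by (force simp: image_iff)
qed

lemma Sum_any_swap_pairs:
  "Sum_any (\<lambda>(a, b). g a b) = Sum_any (\<lambda>(b, a). g a b)"
  by (rule Sum_any.reindex_cong[of prod.swap]) (auto simp: fun_eq_iff)

lemma tensor_field_compose_finite:
  assumes "is_field A" "is_field A'" "is_field B" "is_field B'"
  shows "finite {(i, j). tensor (A i (A' j x)) (B (m - i - 1) (B' (n - j - 1) y)) \<noteq> 0}"
proof (rule finite_subset)
  show "{(i, j). tensor (A i (A' j x)) (B (m - i - 1) (B' (n - j - 1) y)) \<noteq> 0}
    \<subseteq> (\<lambda>(j, i). (i, j)) ` (SIGMA j:{j. tensor (A' j x) (B' (n - j - 1) y) \<noteq> 0}.
          {i. tensor (A i (A' j x)) (B (m - i - 1) (B' (n - j - 1) y)) \<noteq> 0})"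
  proof clarify
    fix i j assume *: "tensor (A i (A' j x)) (B (m - i - 1) (B' (n - j - 1) y)) \<noteq> 0"
    have "tensor (A i (A' j x)) (B (m - i - 1) (B' (n - j - 1) y))
        = tensor_op (A i) (B (m - i - 1)) (tensor (A' j x) (B' (n - j - 1) y))"
      using assms by (simp add: tensor_op_tensor is_field_linear)
    with * have "tensor (A' j x) (B' (n - j - 1) y) \<noteq> 0"
      by (metis pm_linear_simps(3) pm_linear_tensor_op)
    with * show "(i, j) \<in> (\<lambda>(j, i). (i, j)) ` (SIGMA j:{j. tensor (A' j x) (B' (n - j - 1) y) \<noteq> 0}.
          {i. tensor (A i (A' j x)) (B (m - i - 1) (B' (n - j - 1) y)) \<noteq> 0})"
      by force
  qed
qed (intro finite_imageI finite_SigmaI tensor_field_finite_tensor assms)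

lemma tensor_field_compose:
  assumes "is_field A" "is_field A'" "is_field B" "is_field B'"
  shows "tensor_field A B m (tensor_field A' B' n (tensor x y))
    = Sum_any (\<lambda>(i, j). tensor (A i (A' j x)) (B (m - i - 1) (B' (n - j - 1) y)))"
proof -
  let ?g = "\<lambda>i j. tensor (A i (A' j x)) (B (m - i - 1) (B' (n - j - 1) y))"
  have fin: "finite {(i, j). ?g i j \<noteq> 0}"
    by (rule tensor_field_compose_finite[OF assms])
  have fin': "finite {(j, i). ?g i j \<noteq> 0}"
  proof -
    have "{(j, i). ?g i j \<noteq> 0} = prod.swap ` {(i, j). ?g i j \<noteq> 0}"
      by auto
    with fin show ?thesis by simp
  qed
  have "tensor_field A B m (tensor_field A' B' n (tensor x y))
      = Sum_any (\<lambda>j. tensor_field A B m (tensor (A' j x) (B' (n - j - 1) y)))"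
    by (simp add: tensor_field_tensor assms Sum_any_linear tensor_field_linear
        tensor_field_finite_tensor)
  also have "\<dots> = Sum_any (\<lambda>j. Sum_any (\<lambda>i. ?g i j))"
    by (simp add: tensor_field_tensor assms)
  also have "\<dots> = Sum_any (\<lambda>(j, i). ?g i j)"
    by (rule Sum_any_pairs[OF fin'])
  also have "\<dots> = Sum_any (\<lambda>(i, j). ?g i j)"
    by (rule Sum_any_swap_pairs[symmetric])
  finally show ?thesis .
qed

section \<open>Exponentials of commuting operator series\<close>

text \<open>
  For commuting coefficients, \<open>E(w) = exp (A(w))\<close> satisfies \<open>w E'(w) = w A'(w) E(w)\<close>. All
  properties of the exponentials in the lattice vertex operators follow from this recursion for
  the coefficients of \<open>E\<close>.
\<close>

lemma sum_triangle_swap: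
  "(\<Sum>j=1..a::nat. \<Sum>i=1..a-j. f i j) = (\<Sum>i=1..a. \<Sum>j=1..a-i. f i j)"
proof -
  have "(\<Sum>j=1..a. \<Sum>i=1..a-j. f i j) = (\<Sum>j=1..a. \<Sum>i\<in>{i. i \<in> {1..a} \<and> i + j \<le> a}. f i j)"
    by (intro sum.cong) auto
  also have "\<dots> = (\<Sum>i=1..a. \<Sum>j\<in>{j. j \<in> {1..a} \<and> i + j \<le> a}. f i j)"
    by (rule sum.swap_restrict) auto
  also have "\<dots> = (\<Sum>i=1..a. \<Sum>j=1..a-i. f i j)"
    by (intro sum.cong) auto
  finally show ?thesis .
qed

context
  fixes A :: "nat \<Rightarrow> ('a \<Rightarrow>\<^sub>0 complex) \<Rightarrow> ('a \<Rightarrow>\<^sub>0 complex)"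
  assumes lin: "\<And>j. pm_linear (A j)"
begin

lemma series_power_linear: "pm_linear (series_power A k a)"
proof (induction k arbitrary: a)
  case 0
  show ?case by (rule pm_linearI) simp_all
next
  case (Suc k)
  then have "pm_linear (\<lambda>v. \<Sum>j=1..a. A j (series_power A k (a - j) v))"
    by (intro pm_linear_sum pm_linear_compose[OF lin])
  then show ?case
    by (simp add: series_power.simps[abs_def])
qed

lemma series_exp_linear: "pm_linear (series_exp A a)"
  unfolding series_exp_def[abs_def] by (intro pm_linear_intros series_power_linear)

lemma series_power_eq_0: "k > a \<Longrightarrow> series_power A k a v = 0"
  by (induction k arbitrary: a) (auto intro!: sum.neutral simp: pm_linear_simps[OF lin])

lemma series_power_commute:
  assumes "pm_linear D" "\<And>j v. j \<ge> 1 \<Longrightarrow> D (A j v) = A j (D v)"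
  shows "D (series_power A k a v) = series_power A k a (D v)"
  by (induction k arbitrary: a)
    (auto simp: pm_linear_simps[OF assms(1)] assms(2) intro!: sum.cong)

lemma series_exp_commute:
  assumes "pm_linear D" "\<And>j v. j \<ge> 1 \<Longrightarrow> D (A j v) = A j (D v)"
  shows "D (series_exp A a v) = series_exp A a (D v)"
  by (simp add: series_exp_def pm_linear_simps[OF assms(1)] series_power_commute[OF assms])

lemma series_exp_superset:
  assumes "n \<ge> a"
  shows "series_exp A a v = (\<Sum>k\<le>n. pm_scale (1 / fact k) (series_power A k a v))"
  unfolding series_exp_def using assms
  by (intro sum.mono_neutral_left) (auto simp: series_power_eq_0 not_le)

text \<open>
  The Euler operator \<open>w d/dw\<close> applied to \<open>A(w)\<^bsup>k+1\<^esup>\<close> is \<open>(k + 1) (w A'(w)) A(w)\<^sup>k\<close>, as the coefficients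
  commute.
\<close>

lemma series_power_euler:
  assumes comm: "\<And>i j v. A i (A j v) = A j (A i v)"
  shows "pm_scale (of_nat a) (series_power A (Suc k) a v)
    = pm_scale (of_nat (Suc k)) (\<Sum>j=1..a. pm_scale (of_nat j) (A j (series_power A k (a - j) v)))"
proof (induction k arbitrary: a)
  case 0
  show ?case
    by (auto simp: pm.scale_sum_right pm_linear_simps[OF lin] intro!: sum.cong)
next
  case (Suc k)
  let ?P = "\<lambda>k a. series_power A k a v"
  have "pm_scale (of_nat a) (?P (Suc (Suc k)) a)
      = (\<Sum>j=1..a. pm_scale (of_nat a) (A j (?P (Suc k) (a - j))))"
    by (simp add: pm.scale_sum_right)
  also have "\<dots> = (\<Sum>j=1..a. pm_scale (of_nat j) (A j (?P (Suc k) (a - j)))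
      + A j (pm_scale (of_nat (a - j)) (?P (Suc k) (a - j))))"
    by (intro sum.cong)
      (auto simp: pm_linear_simps[OF lin] of_nat_diff simp flip: pm.scale_left_distrib
        simp del: series_power.simps)
  also have "\<dots> = (\<Sum>j=1..a. pm_scale (of_nat j) (A j (?P (Suc k) (a - j))))
      + (\<Sum>j=1..a. A j (pm_scale (of_nat (Suc k))
          (\<Sum>i=1..a-j. pm_scale (of_nat i) (A i (?P k (a - j - i))))))"
    by (simp only: Suc sum.distrib)
  also have "(\<Sum>j=1..a. A j (pm_scale (of_nat (Suc k))
          (\<Sum>i=1..a-j. pm_scale (of_nat i) (A i (?P k (a - j - i))))))
      = pm_scale (of_nat (Suc k))
          (\<Sum>j=1..a. \<Sum>i=1..a-j. pm_scale (of_nat i) (A i (A j (?P k (a - i - j)))))"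
  proof -
    have "A j (A i (?P k (a - j - i))) = A i (A j (?P k (a - i - j)))" for i j
      by (simp only: comm[of j i] cancel_ab_semigroup_add_class.diff_right_commute[of a i j])
    then show ?thesis
      by (simp only: pm_linear_simps[OF lin] pm.scale_sum_right)
  qed
  also have "\<dots> = pm_scale (of_nat (Suc k))
      (\<Sum>i=1..a. pm_scale (of_nat i) (A i (?P (Suc k) (a - i))))"
    by (subst sum_triangle_swap) (simp add: pm_linear_simps[OF lin] pm.scale_sum_right)
  finally show ?case
    unfolding of_nat_Suc[of "Suc k"] pm.scale_left_distrib pm.scale_one .
qed

lemma series_exp_euler:
  assumes comm: "\<And>i j v. A i (A j v) = A j (A i v)"
  shows "pm_scale (of_nat a) (series_exp A a v)
    = (\<Sum>j=1..a. pm_scale (of_nat j) (A j (series_exp A (a - j) v)))"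
proof (cases a)
  case (Suc n)
  let ?P = "\<lambda>k a. series_power A k a v"
  have "pm_scale (of_nat a) (series_exp A a v)
      = (\<Sum>k\<le>Suc n. pm_scale (1 / fact k) (pm_scale (of_nat a) (?P k a)))"
    unfolding series_exp_def pm.scale_sum_right Suc by (intro sum.cong refl pm.scale_left_commute)
  also have "\<dots> = (\<Sum>k\<le>n. pm_scale (1 / fact (Suc k)) (pm_scale (of_nat a) (?P (Suc k) a)))"
    by (subst sum.atMost_Suc_shift) (simp add: Suc del: series_power.simps(2))
  also have "\<dots> = (\<Sum>k\<le>n. pm_scale (1 / fact k)
      (\<Sum>j=1..a. pm_scale (of_nat j) (A j (?P k (a - j)))))"
  proof (intro sum.cong refl)
    fix k
    have "1 / fact (Suc k) * of_nat (Suc k) = (1 / fact k :: complex)"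
      by (simp add: fact_Suc divide_simps del: of_nat_Suc)
    then show "pm_scale (1 / fact (Suc k)) (pm_scale (of_nat a) (?P (Suc k) a))
        = pm_scale (1 / fact k) (\<Sum>j=1..a. pm_scale (of_nat j) (A j (?P k (a - j))))"
      by (simp only: series_power_euler[OF comm] pm.scale_scale)
  qed
  also have "\<dots> = (\<Sum>j=1..a. pm_scale (of_nat j) (A j (\<Sum>k\<le>n. pm_scale (1 / fact k) (?P k (a - j)))))"
    by (simp only: pm.scale_sum_right pm_linear_simps[OF lin] pm.scale_left_commute
        sum.swap[of _ "{1..a}"])
  also have "\<dots> = (\<Sum>j=1..a. pm_scale (of_nat j) (A j (series_exp A (a - j) v)))"
    by (intro sum.cong refl) (subst series_exp_superset[of _ n], auto simp: Suc)
  finally show ?thesis .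
qed simp

text \<open>
  If the commutator of \<open>D\<close> with \<open>A(w)\<close> is the scalar series \<open>c w\<^sup>k\<close>, then its commutator with
  \<open>exp (A(w))\<close> is \<open>c w\<^sup>k exp (A(w))\<close>.
\<close>

lemma series_exp_derivation:
  assumes comm: "\<And>i j v. A i (A j v) = A j (A i v)"
    and D: "pm_linear D" and k: "k \<ge> 1"
    and DA: "\<And>j v. j \<ge> 1 \<Longrightarrow> D (A j v) - A j (D v) = (if j = k then pm_scale c v else 0)"
  shows "D (series_exp A a v) - series_exp A a (D v)
    = (if k \<le> a then pm_scale c (series_exp A (a - k) v) else 0)"
proof (induction a rule: less_induct)
  case (less a)
  let ?E = "\<lambda>a. series_exp A a v" and ?E' = "\<lambda>a. series_exp A a (D v)"
  show ?case
  proof (cases "a = 0")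
    case False
    have "pm_scale (of_nat a) (D (?E a) - ?E' a)
        = (\<Sum>j=1..a. pm_scale (of_nat j) (D (A j (?E (a - j))) - A j (?E' (a - j))))"
      unfolding pm.scale_right_diff_distrib pm_linear_simps(2)[OF D, symmetric]
        series_exp_euler[OF comm] pm_linear_simps(6)[OF D] sum_subtractf
      by (simp only: pm_linear_simps(2)[OF D])
    also have "\<dots> = (\<Sum>j=1..a. pm_scale (of_nat j) (A j (D (?E (a - j)) - ?E' (a - j)))
        + (if j = k then pm_scale (of_nat j * c) (?E (a - j)) else 0))"
    proof (intro sum.cong refl)
      fix j assume "j \<in> {1..a}"
      then have "D (A j (?E (a - j))) = A j (D (?E (a - j)))
          + (if j = k then pm_scale c (?E (a - j)) else 0)"
        using DA[of j "?E (a - j)"] by (simp add: algebra_simps split: if_splits)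
      then show "pm_scale (of_nat j) (D (A j (?E (a - j))) - A j (?E' (a - j)))
          = pm_scale (of_nat j) (A j (D (?E (a - j)) - ?E' (a - j)))
            + (if j = k then pm_scale (of_nat j * c) (?E (a - j)) else 0)"
        by (simp add: pm_linear_simps[OF lin] pm.scale_right_distrib pm.scale_right_diff_distrib)
    qed
    also have "\<dots> = (\<Sum>j=1..a. if j + k \<le> a then pm_scale (of_nat j * c) (A j (?E (a - k - j))) else 0)
        + (if k \<le> a then pm_scale (of_nat k * c) (?E (a - k)) else 0)"
    proof -
      have "(\<Sum>j=1..a. pm_scale (of_nat j) (A j (D (?E (a - j)) - ?E' (a - j))))
          = (\<Sum>j=1..a. if j + k \<le> a then pm_scale (of_nat j * c) (A j (?E (a - k - j))) else 0)"
        by (intro sum.cong refl) (auto simp: less pm_linear_simps[OF lin] add.commute)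
      moreover have "(\<Sum>j=1..a. if j = k then pm_scale (of_nat j * c) (?E (a - j)) else 0)
          = (if k \<le> a then pm_scale (of_nat k * c) (?E (a - k)) else 0)"
        using k by (simp add: sum.delta)
      ultimately show ?thesis
        by (simp only: sum.distrib)
    qed
    also have "\<dots> = pm_scale (of_nat a) (if k \<le> a then pm_scale c (?E (a - k)) else 0)"
    proof (cases "k \<le> a")
      case True
      have "(\<Sum>j=1..a. if j + k \<le> a then pm_scale (of_nat j * c) (A j (?E (a - k - j))) else 0)
          = (\<Sum>j=1..a-k. pm_scale (of_nat j * c) (A j (?E (a - k - j))))"
        using True by (intro sum.mono_neutral_cong_right) auto
      also have "\<dots> = pm_scale c (pm_scale (of_nat (a - k)) (?E (a - k)))"
        by (simp add: series_exp_euler[OF comm] pm.scale_sum_right mult.commute)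
      finally show ?thesis
        using True by (simp add: of_nat_diff algebra_simps flip: pm.scale_left_distrib)
    qed auto
    finally have "pm_scale (of_nat a) (D (?E a) - ?E' a)
        = pm_scale (of_nat a) (if k \<le> a then pm_scale c (?E (a - k)) else 0)" .
    with False show ?thesis
      by (subst (asm) pm.scale_cancel_left) simp
  qed (use k in simp)
qed

end

section \<open>The vertex operators of the lattice vertex superalgebra\<close>

lemma beta_pm_linear: "pm_linear (beta n)"
  by (rule pm_linearI) (rule beta_linear)+

lemmas beta_simps = pm_linear_simps[OF beta_pm_linear]

lemma beta_commute: "m + n \<noteq> 0 \<Longrightarrow> beta m (beta n v) = beta n (beta m v)"
  using beta_commutator[of m n v] by simp

lemma beta_commute_same_sign:
  "beta (int i) (beta (int j) v) = beta (int j) (beta (int i) v)"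
  "beta (- int i) (beta (- int j) v) = beta (- int j) (beta (- int i) v)"
  by (cases "i = j", simp, rule beta_commute, linarith)+

lemma beta_exp_minus_linear: "pm_linear (beta_exp_minus l a)"
  unfolding beta_exp_minus_def by (intro series_exp_linear pm_linear_scale beta_pm_linear)

lemma beta_exp_plus_linear: "pm_linear (beta_exp_plus l a)"
  unfolding beta_exp_plus_def by (intro series_exp_linear pm_linear_scale beta_pm_linear)

lemma beta_exp_minus_euler:
  "pm_scale (of_nat a) (beta_exp_minus l a v)
    = pm_scale (of_int l) (\<Sum>j=1..a. beta (- int j) (beta_exp_minus l (a - j) v))"
  unfolding beta_exp_minus_def
  by (subst series_exp_euler)
    (auto simp: pm_linear_scale beta_pm_linear beta_linear beta_commute_same_sign(2)
      mult.commute pm.scale_sum_right intro!: sum.cong)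

lemma beta_exp_plus_euler:
  "pm_scale (of_nat b) (beta_exp_plus l b v)
    = pm_scale (- of_int l) (\<Sum>j=1..b. beta (int j) (beta_exp_plus l (b - j) v))"
  unfolding beta_exp_plus_def
  by (subst series_exp_euler)
    (auto simp: pm_linear_scale beta_pm_linear beta_linear beta_commute_same_sign(1)
      mult.commute pm.scale_sum_right sum_negf intro!: sum.cong
      simp del: pm.scale_minus_left mult_minus_left)

lemma beta_exp_minus_commute: "k \<le> 0 \<Longrightarrow> beta k (beta_exp_minus l a v) = beta_exp_minus l a (beta k v)"
  unfolding beta_exp_minus_def
  by (rule series_exp_commute) (auto simp: pm_linear_scale beta_pm_linear beta_linear beta_commute
    simp del: pm.scale_minus_left)

lemma beta_exp_plus_commute: "k \<ge> 0 \<Longrightarrow> beta k (beta_exp_plus l a v) = beta_exp_plus l a (beta k v)"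
  unfolding beta_exp_plus_def
  by (rule series_exp_commute) (auto simp: pm_linear_scale beta_pm_linear beta_linear beta_commute
    simp del: pm.scale_minus_left)

lemma beta_exp_minus_commutator:
  assumes "k \<ge> 1"
  shows "beta (int k) (beta_exp_minus l a v) - beta_exp_minus l a (beta (int k) v)
    = (if k \<le> a then pm_scale (- of_int l) (beta_exp_minus l (a - k) v) else 0)"
  unfolding beta_exp_minus_def
proof (rule series_exp_derivation)
  fix j :: nat and v assume "j \<ge> 1"
  then have "pm_scale (of_int l / of_nat j) (beta (int k) (beta (- int j) v) - beta (- int j) (beta (int k) v))
      = (if j = k then pm_scale (- of_int l) v else 0)"
    by (simp add: beta_commutator)
  then show "beta (int k) (pm_scale (of_int l / of_nat j) (beta (- int j) v))
      - pm_scale (of_int l / of_nat j) (beta (- int j) (beta (int k) v))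
      = (if j = k then pm_scale (- of_int l) v else 0)"
    by (simp add: beta_linear pm.scale_right_diff_distrib)
qed (use assms in \<open>auto simp: pm_linear_scale beta_pm_linear beta_linear
  beta_commute_same_sign(2) mult.commute\<close>)

lemma beta_exp_plus_commutator:
  assumes "k \<ge> 1"
  shows "beta (- int k) (beta_exp_plus l b v) - beta_exp_plus l b (beta (- int k) v)
    = (if k \<le> b then pm_scale (- of_int l) (beta_exp_plus l (b - k) v) else 0)"
  unfolding beta_exp_plus_def
proof (rule series_exp_derivation)
  fix j :: nat and v assume "j \<ge> 1"
  then have "pm_scale (- of_int l / of_nat j) (beta (- int k) (beta (int j) v) - beta (int j) (beta (- int k) v))
      = (if j = k then pm_scale (- of_int l) v else 0)"
    by (auto simp: beta_commutator)
  then show "beta (- int k) (pm_scale (- of_int l / of_nat j) (beta (int j) v))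
      - pm_scale (- of_int l / of_nat j) (beta (int j) (beta (- int k) v))
      = (if j = k then pm_scale (- of_int l) v else 0)"
    by (simp only: beta_linear pm.scale_right_diff_distrib)
qed (use assms in \<open>auto simp: pm_linear_scale beta_pm_linear beta_linear
  beta_commute_same_sign(1) mult.commute simp del: pm.scale_minus_left\<close>)

text \<open>\<open>\<beta>(j)\<close> with \<open>j > 0\<close> acts on the partition, independently of the lattice point.\<close>

lemma beta_pos_bvec:
  assumes "j \<ge> 1"
  shows "beta (int j) (bvec (m, \<mu>))
    = pm_scale (- of_nat j * of_nat (count \<mu> (j - 1))) (bvec (m, \<mu> - {#j - 1#}))"
proof -
  have "nat (int j - 1) = j - 1" by linarith
  then show ?thesis using assms by (simp add: beta_bvec)
qed

text \<open>
  The energy of a partition. The label \<open>i\<close> stands for \<open>\<beta>(-i-1)\<close>, which raises it by \<open>i + 1\<close>.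
\<close>

definition weight :: "nat multiset \<Rightarrow> nat" where
  "weight \<mu> = (\<Sum>i\<in>#\<mu>. i + 1)"

text \<open>
  The coefficient of index \<open>b\<close> lowers the energy by \<open>b\<close>.
\<close>

lemma beta_exp_plus_eq_0:
  "b > weight \<mu> \<Longrightarrow> beta_exp_plus l b (bvec (m, \<mu>)) = 0"
proof (induction b arbitrary: \<mu> rule: less_induct)
  case (less b)
  have "beta (int j) (beta_exp_plus l (b - j) (bvec (m, \<mu>))) = 0" if j: "j \<in> {1..b}" for j
  proof (cases "j - 1 \<in># \<mu>")
    case True
    then obtain \<nu> where \<nu>: "\<mu> = add_mset (j - 1) \<nu>"
      by (metis mset_add)
    have "weight \<nu> < b - j"
      using less.prems j by (simp add: \<nu> weight_def)
    with j less.IH[of "b - j" \<nu>] show ?thesis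
      by (simp add: beta_exp_plus_commute beta_pos_bvec \<nu> pm_linear_simps[OF beta_exp_plus_linear])
  next
    case False
    with j show ?thesis
      by (simp add: beta_exp_plus_commute beta_pos_bvec not_in_iff pm_linear_simps[OF beta_exp_plus_linear])
  qed
  then have "pm_scale (of_nat b) (beta_exp_plus l b (bvec (m, \<mu>))) = 0"
    by (simp add: beta_exp_plus_euler)
  with less.prems show ?case by simp
qed


lemma beta_0_eigen_support:
  assumes "beta 0 v = pm_scale (- of_int m) v" "Poly_Mapping.lookup v (m', \<mu>) \<noteq> 0"
  shows "m' = m"
proof -
  have "Poly_Mapping.lookup (beta 0 v) (m', \<mu>)
      = (\<Sum>b\<in>Poly_Mapping.keys v. if b = (m', \<mu>) then - of_int m' * Poly_Mapping.lookup v b else 0)"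
    unfolding beta_def lin_ext_def lookup_sum
    by (rule sum.cong) (auto split: if_splits)
  also have "\<dots> = - of_int m' * Poly_Mapping.lookup v (m', \<mu>)"
    using assms(2) by (simp add: in_keys_iff)
  finally show ?thesis
    using assms by simp
qed

lemma lookup_linear_basis:
  assumes "pm_linear f" "\<And>b. Poly_Mapping.lookup (f (bvec b)) k = (if b = k' then c else 0)"
  shows "Poly_Mapping.lookup (f v) k = c * Poly_Mapping.lookup v k'"
proof -
  have "Poly_Mapping.lookup (f v) k = (\<Sum>b\<in>Poly_Mapping.keys v.
      Poly_Mapping.lookup v b * Poly_Mapping.lookup (f (bvec b)) k)"
    by (subst bvec_expand[of v]) (simp add: lin_ext_def pm_linear_simps[OF assms(1)] lookup_sum)
  also have "\<dots> = (\<Sum>b\<in>Poly_Mapping.keys v. if b = k' then c * Poly_Mapping.lookup v b else 0)"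
    by (intro sum.cong) (auto simp: assms(2))
  finally show ?thesis
    by (simp add: in_keys_iff)
qed

lemma lookup_beta_pos:
  assumes "j \<ge> 1"
  shows "Poly_Mapping.lookup (beta (int j) v) (m, \<mu>)
    = - of_nat j * of_nat (Suc (count \<mu> (j - 1))) * Poly_Mapping.lookup v (m, add_mset (j - 1) \<mu>)"
proof (rule lookup_linear_basis[OF beta_pm_linear])
  fix b :: "int \<times> nat multiset"
  obtain m' \<nu> where b: "b = (m', \<nu>)" by fastforce
  show "Poly_Mapping.lookup (beta (int j) (bvec b)) (m, \<mu>)
      = (if b = (m, add_mset (j - 1) \<mu>) then - of_nat j * of_nat (Suc (count \<mu> (j - 1))) else 0)"
  proof (cases "j - 1 \<in># \<nu>")
    case True
    then obtain \<rho> where "\<nu> = add_mset (j - 1) \<rho>"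
      by (metis mset_add)
    then show ?thesis
      using assms by (auto simp: b beta_pos_bvec)
  next
    case False
    then show ?thesis
      using assms by (auto simp: b beta_pos_bvec not_in_iff)
  qed
qed

lemma lookup_beta_neg_vacuum:
  assumes "j \<ge> 1"
  shows "Poly_Mapping.lookup (beta (- int j) v) (m, {#}) = 0"
  using lookup_linear_basis[OF beta_pm_linear, of "- int j" "(m, {#})" undefined 0 v] assms
  by (auto simp: beta_bvec split_paired_all)

lemma lookup_beta_exp_minus_vacuum:
  "Poly_Mapping.lookup (beta_exp_minus l a v) (m, {#}) = (if a = 0 then Poly_Mapping.lookup v (m, {#}) else 0)"
proof (cases "a = 0")
  case False
  have "of_nat a * Poly_Mapping.lookup (beta_exp_minus l a v) (m, {#})
      = Poly_Mapping.lookup (pm_scale (of_nat a) (beta_exp_minus l a v)) (m, {#})"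
    by simp
  also have "\<dots> = 0"
    by (simp only: beta_exp_minus_euler lookup_pm_scale lookup_sum)
      (simp add: lookup_beta_neg_vacuum)
  finally show ?thesis using False by simp
qed (simp add: beta_exp_minus_def)

text \<open>
  The first exponential with its coefficients indexed by all integers, so that shifting the index
  needs no case distinction.
\<close>

definition beta_exp_minus_int :: "int \<Rightarrow> int \<Rightarrow> lattice \<Rightarrow> lattice" where
  "beta_exp_minus_int l a v = (if a \<ge> 0 then beta_exp_minus l (nat a) v else 0)"

lemma beta_exp_minus_int_linear: "pm_linear (beta_exp_minus_int l a)"
  by (rule pm_linearI) (simp_all add: beta_exp_minus_int_def pm_linear_simps[OF beta_exp_minus_linear])

lemma beta_exp_minus_int_commutator:
  assumes "k \<ge> 1"
  shows "beta (int k) (beta_exp_minus_int l a v)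
    = beta_exp_minus_int l a (beta (int k) v) - pm_scale (of_int l) (beta_exp_minus_int l (a - int k) v)"
proof (cases "a \<ge> 0")
  case True
  moreover have "nat (a - int k) = nat a - k"
    by linarith
  moreover have "k \<le> nat a \<longleftrightarrow> int k \<le> a"
    using True by linarith
  ultimately show ?thesis
    using beta_exp_minus_commutator[OF assms, of l "nat a" v]
    by (auto simp: beta_exp_minus_int_def algebra_simps split: if_splits)
qed (simp add: beta_exp_minus_int_def beta_simps)

lemma lattice_mode_linear: "pm_linear (lattice_mode l n)"
  by (simp add: lattice_mode_def linear_lin_ext)

lemma lattice_mode_bvec:
  assumes "B \<ge> weight \<mu>"
  shows "lattice_mode l n (bvec (m, \<mu>))
    = (\<Sum>b\<le>B. beta_exp_minus_int l (int b + l * m - n - 1) (beta_exp_plus l b (bvec (m + l, \<mu>))))"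
proof -
  have "lattice_mode l n (bvec (m, \<mu>)) = Sum_any (\<lambda>b.
      beta_exp_minus_int l (int b + l * m - n - 1) (beta_exp_plus l b (bvec (m + l, \<mu>))))"
    unfolding lattice_mode_def lin_ext_bvec prod.case beta_exp_minus_int_def by simp
  also have "\<dots> = (\<Sum>b\<le>B. beta_exp_minus_int l (int b + l * m - n - 1) (beta_exp_plus l b (bvec (m + l, \<mu>))))"
  proof (rule Sum_any.expand_superset)
    show "{b. beta_exp_minus_int l (int b + l * m - n - 1) (beta_exp_plus l b (bvec (m + l, \<mu>))) \<noteq> 0} \<subseteq> {..B}"
      using assms by (force simp: beta_exp_plus_eq_0 pm_linear_simps[OF beta_exp_minus_int_linear] not_le intro: ccontr)
  qed simp
  finally show ?thesis .
qed

lemma lattice_mode_field: "is_field (lattice_mode l)"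
proof (rule is_fieldI[OF lattice_mode_linear])
  fix b :: "int \<times> nat multiset"
  obtain m \<mu> where b: "b = (m, \<mu>)" by fastforce
  have "lattice_mode l n (bvec b) = 0" if "n \<ge> int (weight \<mu>) + l * m" for n
    unfolding b lattice_mode_bvec[OF order.refl]
    by (rule sum.neutral) (use that in \<open>auto simp: beta_exp_minus_int_def\<close>)
  then show "\<exists>N. \<forall>n\<ge>N. lattice_mode l n (bvec b) = 0"
    by blast
qed

lemma lattice_mode_beta_pos:
  assumes "k \<ge> 1"
  shows "beta (int k) (lattice_mode l n (bvec (m, \<mu>)))
    = lattice_mode l n (beta (int k) (bvec (m, \<mu>))) - pm_scale (of_int l) (lattice_mode l (n + int k) (bvec (m, \<mu>)))"
proof -
  let ?B = "weight \<mu>"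
  let ?E = "\<lambda>b. beta_exp_minus_int l (int b + l * m - n - 1)"
  have w: "weight (\<mu> - {#j#}) \<le> ?B" for j
    by (cases "j \<in># \<mu>") (auto simp: weight_def dest!: multi_member_split)
  have "beta (int k) (lattice_mode l n (bvec (m, \<mu>)))
      = (\<Sum>b\<le>?B. ?E b (beta_exp_plus l b (beta (int k) (bvec (m + l, \<mu>)))))
        - pm_scale (of_int l) (\<Sum>b\<le>?B. beta_exp_minus_int l (int b + l * m - (n + int k) - 1) (beta_exp_plus l b (bvec (m + l, \<mu>))))"
    using assms by (simp add: lattice_mode_bvec[OF order.refl] beta_simps beta_exp_minus_int_commutator
        beta_exp_plus_commute sum_subtractf pm.scale_sum_right algebra_simps)
  also have "(\<Sum>b\<le>?B. ?E b (beta_exp_plus l b (beta (int k) (bvec (m + l, \<mu>)))))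
      = lattice_mode l n (beta (int k) (bvec (m, \<mu>)))"
    using assms by (simp add: beta_pos_bvec lattice_mode_bvec[OF w] pm_linear_simps[OF lattice_mode_linear]
        pm_linear_simps[OF beta_exp_plus_linear] pm_linear_simps[OF beta_exp_minus_int_linear] pm.scale_sum_right sum_negf)
  finally show ?thesis
    by (simp only: lattice_mode_bvec[OF order.refl])
qed

lemma lattice_mode_beta_neg:
  assumes "k \<ge> 1"
  shows "beta (- int k) (lattice_mode l n (bvec (m, \<mu>)))
    = lattice_mode l n (beta (- int k) (bvec (m, \<mu>))) - pm_scale (of_int l) (lattice_mode l (n - int k) (bvec (m, \<mu>)))"
proof -
  let ?\<nu> = "add_mset (k - 1) \<mu>"
  let ?B = "weight \<mu> + k"
  let ?v = "bvec (m + l, \<mu>)"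
  let ?E = "\<lambda>b. beta_exp_minus_int l (b + l * m - n - 1)"
  have w: "weight ?\<nu> \<le> ?B"
    using assms by (simp add: weight_def)
  have nat_k: "nat (int k - 1) = k - 1"
    by linarith
  have minus: "beta (- int k) (?E b u) = ?E b (beta (- int k) u)" for b u
    by (simp add: beta_exp_minus_int_def beta_exp_minus_commute beta_simps)
  have plus: "beta (- int k) (beta_exp_plus l b ?v)
      = beta_exp_plus l b (beta (- int k) ?v) - (if k \<le> b then pm_scale (of_int l) (beta_exp_plus l (b - k) ?v) else 0)" for b
    using beta_exp_plus_commutator[OF assms, of l b ?v] by (auto simp: algebra_simps split: if_splits)
  have "beta (- int k) (lattice_mode l n (bvec (m, \<mu>)))
      = (\<Sum>b\<le>?B. ?E (int b) (beta_exp_plus l b (beta (- int k) ?v)))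
        - (\<Sum>b\<le>?B. if k \<le> b then pm_scale (of_int l) (?E (int b) (beta_exp_plus l (b - k) ?v)) else 0)"
    by (simp add: lattice_mode_bvec[of \<mu> ?B] beta_simps minus plus sum_subtractf[symmetric]
        pm_linear_simps[OF beta_exp_minus_int_linear] if_distrib[of "?E _"] cong: if_cong)
  also have "(\<Sum>b\<le>?B. ?E (int b) (beta_exp_plus l b (beta (- int k) ?v)))
      = lattice_mode l n (beta (- int k) (bvec (m, \<mu>)))"
    using assms by (simp add: beta_bvec nat_k lattice_mode_bvec[OF w, unfolded One_nat_def])
  also have "(\<Sum>b\<le>?B. if k \<le> b then pm_scale (of_int l) (?E (int b) (beta_exp_plus l (b - k) ?v)) else 0)
      = (\<Sum>b\<in>{k..?B}. pm_scale (of_int l) (?E (int b) (beta_exp_plus l (b - k) ?v)))"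
    by (rule sum.mono_neutral_cong_right) auto
  also have "\<dots> = (\<Sum>b\<le>weight \<mu>. pm_scale (of_int l) (?E (int (b + k)) (beta_exp_plus l b ?v)))"
    by (rule sum.reindex_bij_witness[of _ "\<lambda>b. b + k" "\<lambda>b. b - k"]) auto
  also have "\<dots> = pm_scale (of_int l) (lattice_mode l (n - int k) (bvec (m, \<mu>)))"
    by (simp add: lattice_mode_bvec[OF order.refl] pm.scale_sum_right algebra_simps)
  finally show ?thesis .
qed

lemma lattice_mode_beta_0:
  "beta 0 (lattice_mode l n (bvec (m, \<mu>)))
    = lattice_mode l n (beta 0 (bvec (m, \<mu>))) - pm_scale (of_int l) (lattice_mode l n (bvec (m, \<mu>)))"
proof -
  have "beta 0 (beta_exp_minus_int l a u) = beta_exp_minus_int l a (beta 0 u)" for a u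
    by (simp add: beta_exp_minus_int_def beta_exp_minus_commute beta_simps)
  then show ?thesis
    by (simp add: lattice_mode_bvec[OF order.refl] beta_simps beta_bvec beta_exp_plus_commute
        pm_linear_simps[OF lattice_mode_linear] pm_linear_simps[OF beta_exp_plus_linear]
        pm_linear_simps[OF beta_exp_minus_int_linear] pm.scale_left_diff_distrib pm.scale_left_distrib
        pm.scale_right_distrib sum_negf sum.distrib sum_subtractf
        flip: pm.scale_sum_right)
qed

text \<open>The field \<open>Y(e\<^bsup>l\<beta>\<^esup>,z)\<close> is primary for the Heisenberg algebra.\<close>

lemma beta_lattice_mode:
  "beta k (lattice_mode l n v) = lattice_mode l n (beta k v) - pm_scale (of_int l) (lattice_mode l (n + k) v)"
proof (rule pm_linear_eqI[of "\<lambda>v. beta k (lattice_mode l n v)"])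
  fix b :: "int \<times> nat multiset"
  obtain m \<mu> where b: "b = (m, \<mu>)" by fastforce
  consider i where "i \<ge> 1" "k = int i" | i where "i \<ge> 1" "k = - int i" | "k = 0"
    by (metis One_nat_def Suc_leI int_cases2 of_nat_0 not_gr0 minus_zero)
  then show "beta k (lattice_mode l n (bvec b)) = lattice_mode l n (beta k (bvec b))
      - pm_scale (of_int l) (lattice_mode l (n + k) (bvec b))"
    by cases (simp_all add: b lattice_mode_beta_pos lattice_mode_beta_neg lattice_mode_beta_0)
qed (rule pm_linearI; simp add: beta_simps pm_linear_simps[OF lattice_mode_linear] algebra_simps
    pm.scale_right_distrib pm.scale_right_diff_distrib)+

section \<open>Quadratic relations of the lattice vertex operators\<close>

lemmas lattice_mode_simps = pm_linear_simps[OF lattice_mode_linear]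

abbreviation vac :: "int \<Rightarrow> lattice" where
  "vac m \<equiv> bvec (m, {#})"

lemma beta_pos_vac: "k > 0 \<Longrightarrow> beta k (vac m) = 0"
  by (simp add: beta_bvec)

text \<open>
  Commuting with all \<open>\<beta>(-k)\<close> moves an operator to the vectors \<open>e\<^bsup>m\<beta>\<^esup>\<close>, and commuting with
  \<open>\<beta>(k)\<close> strips every coefficient of the result down to a vacuum coefficient. So a family of
  operators that is closed under commutators with the Heisenberg algebra vanishes as soon as all
  its vacuum coefficients do. This reduces identities between vertex operators to computations
  with scalars.
\<close>

lemma heisenberg_family_zero:
  fixes A :: "'i \<Rightarrow> lattice \<Rightarrow> lattice"
  assumes lin: "\<And>i. pm_linear (A i)"
    and comm: "\<And>k i v. beta k (A i v) = A i (beta k v)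
      + pm_scale (c k i) (A (g k i) v) + pm_scale (d k i) (A (h k i) v)"
    and vac: "\<And>i m m'. Poly_Mapping.lookup (A i (vac m)) (m', {#}) = 0"
  shows "A i v = 0"
proof -
  have coeff: "Poly_Mapping.lookup (A i (vac m)) (m', \<mu>) = 0" for i m m' \<mu>
  proof (induction \<mu> arbitrary: i)
    case empty
    show ?case by (rule vac)
  next
    case (add j \<mu>)
    have "- of_nat (Suc j) * of_nat (Suc (count \<mu> j)) * Poly_Mapping.lookup (A i (vac m)) (m', add_mset j \<mu>)
        = Poly_Mapping.lookup (beta (int (Suc j)) (A i (vac m))) (m', \<mu>)"
      using lookup_beta_pos[of "Suc j"] by simp
    also have "\<dots> = 0"
      unfolding comm lookup_add lookup_pm_scale
      by (simp add: add pm_linear_simps[OF lin] beta_pos_vac)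
    finally show ?case
      by (simp del: of_nat_Suc)
  qed
  have vac0: "A i (vac m) = 0" for i m
    by (rule poly_mapping_eqI) (use coeff in \<open>simp add: split_paired_all\<close>)
  have "A i (bvec (m, \<mu>)) = 0" for i m \<mu>
  proof (induction \<mu> arbitrary: i)
    case empty
    show ?case by (rule vac0)
  next
    case (add j \<mu>)
    have "bvec (m, add_mset j \<mu>) = beta (- int (Suc j)) (bvec (m, \<mu>))"
      by (simp add: beta_bvec)
    then show ?case
      using comm[of "- int (Suc j)" i "bvec (m, \<mu>)"] by (simp add: add beta_simps)
  qed
  then have "A i (bvec b) = 0" for b
    by (cases b) simp
  then show ?thesis
    using pm_linear_eqI[OF lin pm_linear_zero, of i v] by blast
qed

lemma heisenberg_commutant_zero:
  assumes "pm_linear A" "\<And>k v. beta k (A v) = A (beta k v)"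
    and "\<And>m m'. Poly_Mapping.lookup (A (vac m)) (m', {#}) = 0"
  shows "A v = 0"
  using heisenberg_family_zero[of "\<lambda>_::unit. A" "\<lambda>_ _. 0" "\<lambda>_. id" "\<lambda>_ _. 0" "\<lambda>_. id" _ v] assms
  by simp

lemma lattice_mode_charge:
  assumes "beta 0 v = pm_scale (- of_int m) v"
  shows "beta 0 (lattice_mode l n v) = pm_scale (- of_int (m + l)) (lattice_mode l n v)"
  using assms by (simp add: beta_lattice_mode lattice_mode_simps pm.scale_left_distrib algebra_simps
      pm.scale_left_diff_distrib)

lemma lookup_lattice_mode_charge:
  assumes "beta 0 v = pm_scale (- of_int m) v" "m' \<noteq> m + l"
  shows "Poly_Mapping.lookup (lattice_mode l n v) (m', \<mu>) = 0"
  using beta_0_eigen_support[OF lattice_mode_charge[OF assms(1)]] assms(2) by blast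

lemma lookup_linear_superset:
  assumes "pm_linear f"
  shows "Poly_Mapping.lookup (f v) k = (\<Sum>b\<in>Poly_Mapping.keys v.
      Poly_Mapping.lookup v b * Poly_Mapping.lookup (f (bvec b)) k)"
  by (subst bvec_expand[of v]) (simp add: lin_ext_def pm_linear_simps[OF assms] lookup_sum)

text \<open>
  The recursion for the second exponential becomes a recursion for vacuum coefficients: the first
  exponential does not contribute to them. In terms of formal series it is the
  Knizhnik-Zamolodchikov equation.
\<close>

lemma lattice_mode_vacuum_bvec:
  "Poly_Mapping.lookup (lattice_mode l n (bvec (m, \<mu>))) (m', {#})
    = (if n + 1 \<ge> l * m then Poly_Mapping.lookup (beta_exp_plus l (nat (n + 1 - l * m)) (bvec (m + l, \<mu>))) (m', {#}) else 0)"
proof -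
  define B where "B = weight \<mu> + nat (n + 1 - l * m)"
  have "Poly_Mapping.lookup (lattice_mode l n (bvec (m, \<mu>))) (m', {#})
      = (\<Sum>b\<le>B. if int b + l * m - n - 1 = 0
          then Poly_Mapping.lookup (beta_exp_plus l b (bvec (m + l, \<mu>))) (m', {#}) else 0)"
    by (auto simp: lattice_mode_bvec[of \<mu> B] B_def lookup_sum beta_exp_minus_int_def
        lookup_beta_exp_minus_vacuum intro!: sum.cong)
  also have "\<dots> = (\<Sum>b\<le>B. if b = nat (n + 1 - l * m) \<and> n + 1 \<ge> l * m
          then Poly_Mapping.lookup (beta_exp_plus l b (bvec (m + l, \<mu>))) (m', {#}) else 0)"
    by (intro sum.cong if_cong refl) auto
  also have "\<dots> = (if n + 1 \<ge> l * m then Poly_Mapping.lookup (beta_exp_plus l (nat (n + 1 - l * m)) (bvec (m + l, \<mu>))) (m', {#}) else 0)"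
    by (cases "n + 1 \<ge> l * m") (auto simp: B_def sum.delta)
  finally show ?thesis .
qed

lemma lattice_mode_vacuum_recursion_bvec:
  assumes d: "n + 1 - l * m = int d"
  shows "of_nat d * Poly_Mapping.lookup (lattice_mode l n (bvec (m, \<mu>))) (m', {#})
    = - of_int l * (\<Sum>j=1..d. Poly_Mapping.lookup (lattice_mode l (n - int j) (beta (int j) (bvec (m, \<mu>)))) (m', {#}))"
proof -
  have "of_nat d * Poly_Mapping.lookup (lattice_mode l n (bvec (m, \<mu>))) (m', {#})
      = Poly_Mapping.lookup (pm_scale (of_nat d) (beta_exp_plus l d (bvec (m + l, \<mu>)))) (m', {#})"
    using d by (simp add: lattice_mode_vacuum_bvec)
  also have "\<dots> = - of_int l * (\<Sum>j=1..d. Poly_Mapping.lookup (beta_exp_plus l (d - j) (beta (int j) (bvec (m + l, \<mu>)))) (m', {#}))"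
    by (simp only: beta_exp_plus_euler lookup_pm_scale lookup_sum) (simp add: beta_exp_plus_commute)
  also have "(\<Sum>j=1..d. Poly_Mapping.lookup (beta_exp_plus l (d - j) (beta (int j) (bvec (m + l, \<mu>)))) (m', {#}))
    = (\<Sum>j=1..d. Poly_Mapping.lookup (lattice_mode l (n - int j) (beta (int j) (bvec (m, \<mu>)))) (m', {#}))"
  proof (intro sum.cong refl)
    fix j assume j: "j \<in> {1..d}"
    then have "nat (n - int j + 1 - l * m) = d - j" "n - int j + 1 \<ge> l * m"
      using d by auto
    with j show "Poly_Mapping.lookup (beta_exp_plus l (d - j) (beta (int j) (bvec (m + l, \<mu>)))) (m', {#})
      = Poly_Mapping.lookup (lattice_mode l (n - int j) (beta (int j) (bvec (m, \<mu>)))) (m', {#})"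
      by (simp add: beta_pos_bvec lattice_mode_simps pm_linear_simps[OF beta_exp_plus_linear] lattice_mode_vacuum_bvec)
  qed
  finally show ?thesis .
qed

context
  fixes v :: lattice and m :: int
  assumes sector: "beta 0 v = pm_scale (- of_int m) v"
begin

lemma sector_keys: "b \<in> Poly_Mapping.keys v \<Longrightarrow> fst b = m"
  using beta_0_eigen_support[OF sector, of "fst b" "snd b"] by (simp add: in_keys_iff)

lemma lattice_mode_vacuum_recursion:
  assumes d: "n + 1 - l * m = int d"
  shows "of_nat d * Poly_Mapping.lookup (lattice_mode l n v) (m', {#})
    = - of_int l * (\<Sum>j=1..d. Poly_Mapping.lookup (lattice_mode l (n - int j) (beta (int j) v)) (m', {#}))"
proof -
  let ?c = "\<lambda>b. Poly_Mapping.lookup v b"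
  have "of_nat d * Poly_Mapping.lookup (lattice_mode l n v) (m', {#})
      = (\<Sum>b\<in>Poly_Mapping.keys v. ?c b * (of_nat d * Poly_Mapping.lookup (lattice_mode l n (bvec b)) (m', {#})))"
    by (subst lookup_linear_superset[OF lattice_mode_linear]) (simp add: sum_distrib_left algebra_simps)
  also have "\<dots> = (\<Sum>b\<in>Poly_Mapping.keys v. ?c b * (- of_int l *
      (\<Sum>j=1..d. Poly_Mapping.lookup (lattice_mode l (n - int j) (beta (int j) (bvec b))) (m', {#}))))"
  proof (intro sum.cong refl)
    fix b assume "b \<in> Poly_Mapping.keys v"
    then obtain \<mu> where "b = (m, \<mu>)"
      using sector_keys by (cases b) auto
    then show "?c b * (of_nat d * Poly_Mapping.lookup (lattice_mode l n (bvec b)) (m', {#}))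
      = ?c b * (- of_int l *
      (\<Sum>j=1..d. Poly_Mapping.lookup (lattice_mode l (n - int j) (beta (int j) (bvec b))) (m', {#})))"
      by (simp only: lattice_mode_vacuum_recursion_bvec[OF d])
  qed
  also have "\<dots> = - of_int l * (\<Sum>j=1..d. \<Sum>b\<in>Poly_Mapping.keys v.
      ?c b * Poly_Mapping.lookup (lattice_mode l (n - int j) (beta (int j) (bvec b))) (m', {#}))"
    by (subst sum.swap) (simp add: sum_distrib_left sum_negf algebra_simps)
  also have "\<dots> = - of_int l * (\<Sum>j=1..d. Poly_Mapping.lookup (lattice_mode l (n - int j) (beta (int j) v)) (m', {#}))"
    by (subst lookup_linear_superset[of "\<lambda>v. lattice_mode l _ (beta _ v)" v, symmetric])
      (simp_all add: pm_linear_compose[OF lattice_mode_linear beta_pm_linear])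
  finally show ?thesis .
qed

lemma lattice_mode_vacuum_initial:
  assumes "n + 1 - l * m \<le> 0"
  shows "Poly_Mapping.lookup (lattice_mode l n v) (m + l, {#})
    = (if n + 1 = l * m then Poly_Mapping.lookup v (m, {#}) else 0)"
proof -
  have "Poly_Mapping.lookup (lattice_mode l n v) (m + l, {#})
      = (\<Sum>b\<in>Poly_Mapping.keys v. if b = (m, {#}) then (if n + 1 = l * m then Poly_Mapping.lookup v b else 0) else 0)"
    unfolding lookup_linear_superset[OF lattice_mode_linear, of _ _ v]
  proof (intro sum.cong refl)
    fix b assume "b \<in> Poly_Mapping.keys v"
    then obtain \<mu> where "b = (m, \<mu>)"
      using sector_keys by (cases b) auto
    then show "Poly_Mapping.lookup v b * Poly_Mapping.lookup (lattice_mode l n (bvec b)) (m + l, {#})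
      = (if b = (m, {#}) then (if n + 1 = l * m then Poly_Mapping.lookup v b else 0) else 0)"
      using assms by (auto simp: lattice_mode_vacuum_bvec beta_exp_plus_def)
  qed
  then show ?thesis
    by (simp add: in_keys_iff)
qed

end

text \<open>
  The vacuum coefficients of \<open>Y(e\<^bsup>s\<beta>\<^esup>,z) Y(e\<^bsup>t\<beta>\<^esup>,w)\<close> are those of \<open>(z - w)\<^bsup>-st\<^esup>\<close> up to a shift:
  for \<open>st = 1\<close> the geometric series, for \<open>st = -1\<close> the polynomial \<open>1 - w/z\<close>.
\<close>

definition pair_coeff :: "int \<Rightarrow> nat \<Rightarrow> complex" where
  "pair_coeff e d = (if e = 1 \<or> d = 0 then 1 else if d = 1 then -1 else 0)"

lemma pair_coeff_recursion:
  assumes "e = 1 \<or> e = -1"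
  shows "of_int e * (\<Sum>j=1..d. pair_coeff e (d - j)) = of_nat d * pair_coeff e d"
proof -
  have "(\<Sum>j=1..d. pair_coeff e (d - j)) = (\<Sum>i<d. pair_coeff e i)"
    by (rule sum.reindex_bij_witness[of _ "\<lambda>i. d - i" "\<lambda>j. d - j"]) auto
  also have "of_int e * \<dots> = of_nat d * pair_coeff e d"
  proof (cases "e = 1")
    case False
    then have "(\<Sum>i<d. pair_coeff e i) = (if d = 1 then 1 else 0)"
      by (induction d) (auto simp: pair_coeff_def)
    with False assms show ?thesis
      by (auto simp: pair_coeff_def)
  qed (simp add: pair_coeff_def)
  finally show ?thesis .
qed

lemma beta_0_vac: "beta 0 (vac m) = pm_scale (- of_int m) (vac m)"
  by (simp add: beta_bvec)

lemma lookup_lattice_mode_vac: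
  "Poly_Mapping.lookup (lattice_mode t b (vac m)) (m + t, {#}) = (if b = t * m - 1 then 1 else 0)"
proof -
  have "beta_exp_plus t d (vac (m + t)) = (if d = 0 then vac (m + t) else 0)" for d
    using beta_exp_plus_eq_0[of "{#}" d] by (simp add: weight_def beta_exp_plus_def)
  then show ?thesis
    by (auto simp: lattice_mode_vacuum_bvec)
qed

lemma lattice_pair_vacuum:
  assumes st: "s * t = 1 \<or> s * t = -1"
  shows "Poly_Mapping.lookup (lattice_mode s a (lattice_mode t b (vac m))) (m + t + s, {#})
    = (if a + b = s * (m + t) + t * m - 2 \<and> a + 1 \<ge> s * (m + t)
       then pair_coeff (s * t) (nat (a + 1 - s * (m + t))) else 0)"
proof -
  let ?F = "\<lambda>a b. Poly_Mapping.lookup (lattice_mode s a (lattice_mode t b (vac m))) (m + t + s, {#})"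
  have sector: "beta 0 (lattice_mode t b (vac m)) = pm_scale (- of_int (m + t)) (lattice_mode t b (vac m))" for b
    by (rule lattice_mode_charge[OF beta_0_vac])
  have main: "?F a b = (if a + b = s * (m + t) + t * m - 2 then pair_coeff (s * t) d else 0)"
    if "a + 1 - s * (m + t) = int d" for a b d
    using that
  proof (induction d arbitrary: a b rule: less_induct)
    case (less d)
    show ?case
    proof (cases "d = 0")
      case True
      with less.prems show ?thesis
        by (auto simp: lattice_mode_vacuum_initial[OF sector] lookup_lattice_mode_vac pair_coeff_def)
    next
      case False
      have "of_nat d * ?F a b = - of_int s * (\<Sum>j=1..d. - of_int t * ?F (a - int j) (b + int j))"
        unfolding lattice_mode_vacuum_recursion[OF sector less.prems]
        by (intro arg_cong[of _ _ "(*) _"] sum.cong refl)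
          (simp add: beta_lattice_mode beta_pos_vac lattice_mode_simps)
      also have "\<dots> = of_int (s * t) * (\<Sum>j=1..d. ?F (a - int j) (b + int j))"
        by (simp add: sum_distrib_left sum_negf mult.assoc)
      also have "(\<Sum>j=1..d. ?F (a - int j) (b + int j))
          = (\<Sum>j=1..d. if a + b = s * (m + t) + t * m - 2 then pair_coeff (s * t) (d - j) else 0)"
      proof (intro sum.cong refl)
        fix j assume j: "j \<in> {1..d}"
        have "?F (a - int j) (b + int j) = (if (a - int j) + (b + int j) = s * (m + t) + t * m - 2
            then pair_coeff (s * t) (d - j) else 0)"
          by (rule less.IH) (use j less.prems in auto)
        then show "?F (a - int j) (b + int j) = (if a + b = s * (m + t) + t * m - 2 then pair_coeff (s * t) (d - j) else 0)"
          by simp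
      qed
      also have "of_int (s * t) * \<dots> = of_nat d * (if a + b = s * (m + t) + t * m - 2 then pair_coeff (s * t) d else 0)"
        using pair_coeff_recursion[OF st, of d] by simp
      finally show ?thesis
        using False by simp
    qed
  qed
  show ?thesis
  proof (cases "a + 1 \<ge> s * (m + t)")
    case True
    then show ?thesis
      using main[of a "nat (a + 1 - s * (m + t))" b] by simp
  next
    case False
    then show ?thesis
      using lattice_mode_vacuum_initial[OF sector, of a s b] by simp
  qed
qed

lemma lookup_lattice_pair_charge:
  assumes "m' \<noteq> m + t + s"
  shows "Poly_Mapping.lookup (lattice_mode s a (lattice_mode t b (vac m))) (m', {#}) = 0"
  by (rule lookup_lattice_mode_charge[OF lattice_mode_charge[OF beta_0_vac] assms])

lemma pm_linear_lattice_pair: "pm_linear (\<lambda>v. lattice_mode s a (lattice_mode t b v))"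
  by (rule pm_linear_compose[OF lattice_mode_linear lattice_mode_linear])

lemma beta_lattice_pair:
  "beta k (lattice_mode s a (lattice_mode t b v)) = lattice_mode s a (lattice_mode t b (beta k v))
    - pm_scale (of_int s) (lattice_mode s (a + k) (lattice_mode t b v))
    - pm_scale (of_int t) (lattice_mode s a (lattice_mode t (b + k) v))"
  by (simp add: beta_lattice_mode lattice_mode_simps)

text \<open>
  The vacuum coefficients of the two orders of \<open>Y(e\<^sup>\<beta>,z)\<close> and \<open>Y(e\<^bsup>-\<beta>\<^esup>,w)\<close> are those of the polynomials
  \<open>z - w\<close> and \<open>w - z\<close>, up to the same monomial. No expansion is involved, so they cancel exactly.
\<close>

lemma lattice_mode_anticommute:
  assumes "s = 1 \<or> s = -1"
  shows "lattice_mode s a (lattice_mode (- s) b v) + lattice_mode (- s) b (lattice_mode s a v) = 0"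
proof -
  define A where "A = (\<lambda>(a, b) v. lattice_mode s a (lattice_mode (- s) b v) + lattice_mode (- s) b (lattice_mode s a v))"
  have "A (a, b) v = 0"
  proof (rule heisenberg_family_zero[of A "\<lambda>_ _. - of_int s" "\<lambda>k (a, b). (a + k, b)"
        "\<lambda>_ _. of_int s" "\<lambda>k (a, b). (a, b + k)"])
    show "pm_linear (A i)" for i
      by (auto simp: A_def split_beta intro!: pm_linear_add pm_linear_lattice_pair)
    show "beta k (A i v) = A i (beta k v) + pm_scale (- of_int s) (A (case i of (a, b) \<Rightarrow> (a + k, b)) v)
        + pm_scale (of_int s) (A (case i of (a, b) \<Rightarrow> (a, b + k)) v)" for k i v
      by (simp add: A_def split_beta beta_linear beta_lattice_pair pm.scale_right_distrib algebra_simps)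
    show "Poly_Mapping.lookup (A i (vac m)) (m', {#}) = 0" for i m m'
    proof -
      obtain a b where i: "i = (a, b)" by fastforce
      show ?thesis
      proof (cases "m' = m")
        case True
        have "Poly_Mapping.lookup (lattice_mode s a (lattice_mode (- s) b (vac m))) (m, {#})
            = (if a + b = -3 \<and> a \<ge> s * m - 2 then pair_coeff (- 1) (nat (a + 2 - s * m)) else 0)"
          using lattice_pair_vacuum[of s "- s" a b m] assms by (auto simp: algebra_simps)
        moreover have "Poly_Mapping.lookup (lattice_mode (- s) b (lattice_mode s a (vac m))) (m, {#})
            = (if a + b = -3 \<and> b \<ge> - s * m - 2 then pair_coeff (- 1) (nat (b + 2 + s * m)) else 0)"
          using lattice_pair_vacuum[of "- s" s b a m] assms by (auto simp: algebra_simps)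
        moreover have "nat (a + 2 - s * m) = 0 \<longleftrightarrow> a + 2 - s * m \<le> 0" "nat (a + 2 - s * m) = 1 \<longleftrightarrow> a + 2 - s * m = 1"
          "nat (b + 2 + s * m) = 0 \<longleftrightarrow> b + 2 + s * m \<le> 0" "nat (b + 2 + s * m) = 1 \<longleftrightarrow> b + 2 + s * m = 1"
          by linarith+
        ultimately show ?thesis
          unfolding True i A_def prod.case lookup_add pair_coeff_def
          by (simp only:) (simp; linarith)
      next
        case False
        then show ?thesis
          by (simp add: A_def i lookup_add lookup_lattice_pair_charge)
      qed
    qed
  qed
  then show ?thesis
    by (simp add: A_def)
qed

text \<open>
  For equal charges the vacuum coefficients are those of \<open>(z - w)\<^sup>-\<^sup>1\<close> and \<open>(w - z)\<^sup>-\<^sup>1\<close>, expanded in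
  opposite domains. Their sum is a delta function, which is killed by the factor \<open>z - w\<close>.
\<close>

lemma lattice_mode_self_locality:
  assumes "s = 1 \<or> s = -1"
  shows "lattice_mode s (a + 1) (lattice_mode s b v) + lattice_mode s b (lattice_mode s (a + 1) v)
    = lattice_mode s a (lattice_mode s (b + 1) v) + lattice_mode s (b + 1) (lattice_mode s a v)"
proof -
  define P where "P a b v = lattice_mode s a (lattice_mode s b v)" for a b v
  define A where "A = (\<lambda>(a, b) v. P (a + 1) b v + P b (a + 1) v - P a (b + 1) v - P (b + 1) a v)"
  have P: "pm_linear (P a b)" for a b
    unfolding P_def by (rule pm_linear_lattice_pair)
  have betaP: "beta k (P a b v) = P a b (beta k v) - pm_scale (of_int s) (P (a + k) b v)
      - pm_scale (of_int s) (P a (b + k) v)" for k a b v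
    by (simp add: P_def beta_lattice_pair)
  have "A (a, b) v = 0"
  proof (rule heisenberg_family_zero[of A "\<lambda>_ _. - of_int s" "\<lambda>k (a, b). (a + k, b)"
        "\<lambda>_ _. - of_int s" "\<lambda>k (a, b). (a, b + k)"])
    show "pm_linear (A i)" for i
      by (auto simp: A_def split_beta intro!: pm_linear_add pm_linear_diff P)
    show "beta k (A i v) = A i (beta k v) + pm_scale (- of_int s) (A (case i of (a, b) \<Rightarrow> (a + k, b)) v)
        + pm_scale (- of_int s) (A (case i of (a, b) \<Rightarrow> (a, b + k)) v)" for k i v
      by (simp add: A_def split_beta beta_simps betaP pm.scale_right_distrib
          pm.scale_right_diff_distrib algebra_simps)
    show "Poly_Mapping.lookup (A i (vac m)) (m', {#}) = 0" for i m m'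
    proof -
      obtain a b where i: "i = (a, b)" by fastforce
      show ?thesis
      proof (cases "m' = m + s + s")
        case True
        have ss: "s * s = 1" using assms by auto
        have "Poly_Mapping.lookup (P a b (vac m)) (m', {#})
            = (if a + b = 2 * s * m - 1 \<and> a \<ge> s * m then 1 else 0)" for a b
          using lattice_pair_vacuum[of s s a b m] ss
          by (auto simp: P_def True pair_coeff_def algebra_simps)
        then show ?thesis
          by (auto simp: i A_def lookup_add lookup_minus)
      next
        case False
        then show ?thesis
          by (simp add: A_def i P_def lookup_add lookup_minus lookup_lattice_pair_charge)
      qed
    qed
  qed
  then show ?thesis
    by (simp add: A_def P_def algebra_simps)
qed

lemma lattice_mode_self_anticommutator:
  assumes s: "s = 1 \<or> s = -1" and sum: "a + b = c + d"
  shows "lattice_mode s a (lattice_mode s b v) + lattice_mode s b (lattice_mode s a v)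
    = lattice_mode s c (lattice_mode s d v) + lattice_mode s d (lattice_mode s c v)"
proof -
  define B where "B a b = lattice_mode s a (lattice_mode s b v) + lattice_mode s b (lattice_mode s a v)" for a b
  have shift: "B (c + int k) (d - int k) = B c d" for k c d
  proof (induction k)
    case (Suc k)
    have "B (c + int k + 1) (d - int k - 1) = B (c + int k) (d - int k)"
      using lattice_mode_self_locality[OF s, of "c + int k" "d - int k - 1" v] by (simp add: B_def)
    with Suc show ?case
      by (simp add: algebra_simps)
  qed simp
  have "B a b = B c d"
  proof (cases "a \<ge> c")
    case True
    with sum have "a = c + int (nat (a - c))" "b = d - int (nat (a - c))" by linarith+
    then show ?thesis using shift by metis
  next
    case False
    with sum have "c = a + int (nat (c - a))" "d = b - int (nat (c - a))" by linarith+
    then show ?thesis using shift by metis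
  qed
  then show ?thesis by (simp add: B_def)
qed

section \<open>The product of the two opposite vertex operators near the diagonal\<close>

lemma Sum_any_shift: "Sum_any (\<lambda>a::int. g (a + k)) = Sum_any g"
  by (rule Sum_any.reindex_cong[of "\<lambda>a. a + k", symmetric])
    (auto simp: fun_eq_iff intro!: bijI injI surjI[of _ "\<lambda>a. a - k"])

lemma finite_support_add:
  fixes g h :: "'a \<Rightarrow> 'b::comm_monoid_add"
  assumes "finite {a. g a \<noteq> 0}" "finite {a. h a \<noteq> 0}"
  shows "finite {a. g a + h a \<noteq> 0}"
  by (rule finite_subset[OF _ finite_UnI[OF assms]]) auto

lemma finite_support_diff:
  fixes g h :: "'a \<Rightarrow> 'b::ab_group_add"
  assumes "finite {a. g a \<noteq> 0}" "finite {a. h a \<noteq> 0}"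
  shows "finite {a. g a - h a \<noteq> 0}"
  by (rule finite_subset[OF _ finite_UnI[OF assms]]) auto

lemma lookup_Sum_any:
  assumes "finite {a. g a \<noteq> 0}"
  shows "Poly_Mapping.lookup (Sum_any g) k = Sum_any (\<lambda>a. Poly_Mapping.lookup (g a) k)"
proof -
  have "Sum_any (\<lambda>a. Poly_Mapping.lookup (g a) k) = (\<Sum>a | g a \<noteq> 0. Poly_Mapping.lookup (g a) k)"
    by (rule Sum_any.expand_superset) (use assms in auto)
  then show ?thesis
    by (simp add: Sum_any.expand_set lookup_sum)
qed

definition opposite_pair :: "int \<Rightarrow> int \<Rightarrow> lattice \<Rightarrow> lattice" where
  "opposite_pair a b v = lattice_mode 1 a (lattice_mode (- 1) b v)"

lemma opposite_pair_linear: "pm_linear (opposite_pair a b)"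
  unfolding opposite_pair_def[abs_def] by (rule pm_linear_lattice_pair)

lemma opposite_pair_swap: "opposite_pair a b v = - lattice_mode (- 1) b (lattice_mode 1 a v)"
  using lattice_mode_anticommute[of 1 a b v] by (simp add: opposite_pair_def eq_neg_iff_add_eq_0)

text \<open>
  Because of the anticommutation, \<open>Y(e\<^sup>\<beta>,z) Y(e\<^bsup>-\<beta>\<^esup>,w)\<close> may be restricted to \<open>z = w\<close>, and so may
  its \<open>z\<close>-derivatives.
\<close>

lemma opposite_pair_finite: "finite {a. opposite_pair a (N - a) v \<noteq> 0}"
proof -
  obtain K where K: "\<And>n. n \<ge> K \<Longrightarrow> lattice_mode 1 n v = 0"
    using lattice_mode_field is_field_truncation by metis
  obtain L where L: "\<And>n. n \<ge> L \<Longrightarrow> lattice_mode (- 1) n v = 0"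
    using lattice_mode_field is_field_truncation by metis
  have "{a. opposite_pair a (N - a) v \<noteq> 0} \<subseteq> {N - L..K}"
  proof
    fix a assume a: "a \<in> {a. opposite_pair a (N - a) v \<noteq> 0}"
    then have "lattice_mode 1 a v \<noteq> 0"
      by (auto simp: opposite_pair_swap lattice_mode_simps)
    moreover have "lattice_mode (- 1) (N - a) v \<noteq> 0"
      using a by (auto simp: opposite_pair_def lattice_mode_simps)
    ultimately show "a \<in> {N - L..K}"
      using K[of a] L[of "N - a"] by force
  qed
  then show ?thesis
    by (rule finite_subset) simp
qed

lemma opposite_pair_finite_scale: "finite {a. pm_scale (p a) (opposite_pair a (N - a) v) \<noteq> 0}"
  by (rule finite_subset[OF _ opposite_pair_finite]) auto

text \<open>
  The restriction to \<open>z = w\<close> of \<open>(z\<partial>\<^sub>z)\<^sup>r Y(e\<^sup>\<beta>,z) Y(e\<^bsup>-\<beta>\<^esup>,w)\<close>, up to a shift and signs.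
\<close>

definition diagonal_moment :: "nat \<Rightarrow> int \<Rightarrow> lattice \<Rightarrow> lattice" where
  "diagonal_moment r N v = Sum_any (\<lambda>a. pm_scale (of_int a ^ r) (opposite_pair a (N - a) v))"

lemma diagonal_moment_linear: "pm_linear (diagonal_moment r N)"
  unfolding diagonal_moment_def[abs_def]
  by (rule pm_linear_Sum_any[OF pm_linear_scale[OF opposite_pair_linear] opposite_pair_finite_scale])

lemma beta_diagonal_moment:
  "beta k (diagonal_moment r N v) = diagonal_moment r N (beta k v)
    + Sum_any (\<lambda>a. pm_scale (of_int a ^ r - of_int (a - k) ^ r) (opposite_pair a (N + k - a) v))"
proof -
  let ?X = "\<lambda>a. opposite_pair a (N + k - a) v"
  have fin: "finite {a. pm_scale (of_int a ^ r) (opposite_pair (a + k) (N - a) v) \<noteq> 0}"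
  proof (rule finite_subset)
    show "{a. pm_scale (of_int a ^ r) (opposite_pair (a + k) (N - a) v) \<noteq> 0} \<subseteq> (\<lambda>a. a - k) ` {a. ?X a \<noteq> 0}"
    proof
      fix a assume "a \<in> {a. pm_scale (of_int a ^ r) (opposite_pair (a + k) (N - a) v) \<noteq> 0}"
      then have "?X (a + k) \<noteq> 0" by auto
      then show "a \<in> (\<lambda>a. a - k) ` {a. ?X a \<noteq> 0}"
        by (intro image_eqI[of _ _ "a + k"]) auto
    qed
  qed (rule finite_imageI[OF opposite_pair_finite])
  have "beta k (opposite_pair a (N - a) v) = opposite_pair a (N - a) (beta k v)
      - opposite_pair (a + k) (N - a) v + ?X a" for a
    by (simp add: opposite_pair_def beta_lattice_pair algebra_simps)
  then have "beta k (diagonal_moment r N v)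
      = Sum_any (\<lambda>a. pm_scale (of_int a ^ r) (opposite_pair a (N - a) (beta k v))
          - pm_scale (of_int a ^ r) (opposite_pair (a + k) (N - a) v) + pm_scale (of_int a ^ r) (?X a))"
    by (simp add: diagonal_moment_def Sum_any_linear[OF beta_pm_linear opposite_pair_finite_scale]
        beta_linear pm.scale_right_distrib pm.scale_right_diff_distrib)
  also have "\<dots> = Sum_any (\<lambda>a. pm_scale (of_int a ^ r) (opposite_pair a (N - a) (beta k v))
          - pm_scale (of_int a ^ r) (opposite_pair (a + k) (N - a) v)) + Sum_any (\<lambda>a. pm_scale (of_int a ^ r) (?X a))"
    by (rule Sum_any.distrib[OF finite_support_diff[OF opposite_pair_finite_scale fin] opposite_pair_finite_scale])
  also have "\<dots> = diagonal_moment r N (beta k v) - Sum_any (\<lambda>a. pm_scale (of_int a ^ r) (opposite_pair (a + k) (N - a) v))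
          + Sum_any (\<lambda>a. pm_scale (of_int a ^ r) (?X a))"
    by (simp add: Sum_any_diff[OF opposite_pair_finite_scale fin] diagonal_moment_def)
  also have "Sum_any (\<lambda>a. pm_scale (of_int a ^ r) (opposite_pair (a + k) (N - a) v))
      = Sum_any (\<lambda>a. pm_scale (of_int (a - k) ^ r) (?X a))"
    using Sum_any_shift[of "\<lambda>a. pm_scale (of_int (a - k) ^ r) (?X a)" k] by simp
  also have "diagonal_moment r N (beta k v) - \<dots> + Sum_any (\<lambda>a. pm_scale (of_int a ^ r) (?X a))
      = diagonal_moment r N (beta k v) + (Sum_any (\<lambda>a. pm_scale (of_int a ^ r) (?X a))
          - Sum_any (\<lambda>a. pm_scale (of_int (a - k) ^ r) (?X a)))"
    by simp
  also have "Sum_any (\<lambda>a. pm_scale (of_int a ^ r) (?X a)) - Sum_any (\<lambda>a. pm_scale (of_int (a - k) ^ r) (?X a))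
      = Sum_any (\<lambda>a. pm_scale (of_int a ^ r - of_int (a - k) ^ r) (?X a))"
    unfolding pm.scale_left_diff_distrib
    by (rule Sum_any_diff[OF opposite_pair_finite_scale opposite_pair_finite_scale, symmetric])
  finally show ?thesis .
qed

lemma lookup_diagonal_moment_vac:
  "Poly_Mapping.lookup (diagonal_moment r N (vac m)) (m', {#})
    = (if m' = m \<and> N = -3 then of_int (m - 2) ^ r - of_int (m - 1) ^ r else 0)"
proof -
  have coeff: "Poly_Mapping.lookup (opposite_pair a (N - a) (vac m)) (m', {#})
      = (if m' = m \<and> N = -3 then (if a = m - 2 then 1 else 0) - (if a = m - 1 then 1 else 0) else 0)" for a
  proof (cases "m' = m")
    case True
    have "Poly_Mapping.lookup (opposite_pair a (N - a) (vac m)) (m, {#})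
      = (if N = -3 \<and> a \<ge> m - 2 then pair_coeff (- 1) (nat (a + 2 - m)) else 0)"
      using lattice_pair_vacuum[of 1 "-1" a "N - a" m] by (auto simp: opposite_pair_def algebra_simps)
    moreover have "nat (a + 2 - m) = 0 \<longleftrightarrow> a + 2 - m \<le> 0" "nat (a + 2 - m) = 1 \<longleftrightarrow> a + 2 - m = 1"
      by linarith+
    ultimately show ?thesis
      unfolding True pair_coeff_def by (simp only:) auto
  next
    case False
    then show ?thesis
      by (simp add: opposite_pair_def lookup_lattice_pair_charge)
  qed
  have "Poly_Mapping.lookup (diagonal_moment r N (vac m)) (m', {#})
      = Sum_any (\<lambda>a. of_int a ^ r * Poly_Mapping.lookup (opposite_pair a (N - a) (vac m)) (m', {#}))"
    by (simp add: diagonal_moment_def lookup_Sum_any[OF opposite_pair_finite_scale])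
  also have "\<dots> = Sum_any (\<lambda>a. if m' = m \<and> N = -3 then (if a = m - 2 then of_int (m - 2) ^ r else 0)
      - (if a = m - 1 then of_int (m - 1) ^ r else 0) else 0)"
    by (rule Sum_any.cong) (auto simp: coeff)
  also have "\<dots> = (if m' = m \<and> N = -3 then of_int (m - 2) ^ r - of_int (m - 1) ^ r else 0)"
    by (subst Sum_any.expand_superset[of "{m - 2, m - 1}"]) (auto split: if_splits)
  finally show ?thesis .
qed

text \<open>
  The expansion \<open>Y(e\<^sup>\<beta>,z) Y(e\<^bsup>-\<beta>\<^esup>,w) = (z - w) (1 + (z - w) \<beta>(w) + \<dots>)\<close> to second order. Each
  coefficient has the commutators with the Heisenberg algebra predicted by the previous ones, so
  it is determined by its vacuum coefficients.
\<close>

lemma diagonal_moment_0: "diagonal_moment 0 N v = 0"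
  by (rule heisenberg_commutant_zero[OF diagonal_moment_linear])
    (simp_all add: beta_diagonal_moment lookup_diagonal_moment_vac)

lemma diagonal_moment_1: "diagonal_moment 1 N v = (if N = -3 then - v else 0)"
proof -
  define A where "A v = diagonal_moment 1 N v + pm_scale (if N = -3 then 1 else 0) v" for v
  have "Sum_any (\<lambda>a. pm_scale (of_int k) (opposite_pair a (M - a) v)) = pm_scale (of_int k) (diagonal_moment 0 M v)" for k M v
    by (simp add: diagonal_moment_def Sum_any_scale opposite_pair_finite)
  then have "A v = 0"
    by (intro heisenberg_commutant_zero)
      (auto simp: A_def[abs_def] beta_diagonal_moment beta_linear lookup_diagonal_moment_vac lookup_add
        diagonal_moment_0 intro!: pm_linear_intros diagonal_moment_linear)
  then show ?thesis
    by (auto simp: A_def eq_neg_iff_add_eq_0)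
qed

lemma diagonal_moment_2:
  "diagonal_moment 2 N v = pm_scale 2 (beta (N + 3) v) + (if N = -3 then pm_scale 3 v else 0)"
proof -
  define A where "A v = diagonal_moment 2 N v - pm_scale 2 (beta (N + 3) v) - pm_scale (if N = -3 then 3 else 0) v" for v
  have sum: "Sum_any (\<lambda>a. pm_scale ((of_int a)\<^sup>2 - (of_int (a - k))\<^sup>2) (opposite_pair a (M - a) v))
      = pm_scale (2 * of_int k) (diagonal_moment 1 M v) - pm_scale ((of_int k)\<^sup>2) (diagonal_moment 0 M v)" for k M v
  proof -
    have "pm_scale ((of_int a)\<^sup>2 - (of_int (a - k))\<^sup>2) (opposite_pair a (M - a) v)
        = pm_scale (2 * of_int k) (pm_scale (of_int a) (opposite_pair a (M - a) v))
          - pm_scale ((of_int k)\<^sup>2) (opposite_pair a (M - a) v)" for a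
      by (simp add: power2_eq_square algebra_simps flip: pm.scale_left_diff_distrib)
    then show ?thesis
      using opposite_pair_finite_scale[of "\<lambda>a. 2 * of_int k * of_int a" M v]
        opposite_pair_finite_scale[of "\<lambda>_. (of_int k)\<^sup>2" M v] opposite_pair_finite[of M v]
        Sum_any_scale[OF opposite_pair_finite_scale, of "2 * of_int k" "of_int" M v]
      by (simp add: diagonal_moment_def Sum_any_diff Sum_any_scale del: pm.scale_eq_0_iff)
  qed
  have "A v = 0"
  proof (rule heisenberg_commutant_zero[of A])
    show "pm_linear A"
      unfolding A_def[abs_def] by (intro pm_linear_diff pm_linear_scale pm_linear_id diagonal_moment_linear beta_pm_linear)
    show "beta k (A v) = A (beta k v)" for k v
    proof -
      have *: "beta k (diagonal_moment 2 N v) = diagonal_moment 2 N (beta k v) + pm_scale (2 * of_int k) (if N + k = -3 then - v else 0)"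
        unfolding beta_diagonal_moment sum diagonal_moment_0 diagonal_moment_1 by simp
      have **: "beta k (beta (N + 3) v) = beta (N + 3) (beta k v) + pm_scale (if N + k = -3 then - of_int k else 0) v"
        using beta_commutator[of k "N + 3" v] by (auto simp: algebra_simps split: if_splits)
      show ?thesis
        by (simp add: A_def beta_simps * ** pm.scale_right_distrib)
    qed
    show "Poly_Mapping.lookup (A (vac m)) (m', {#}) = 0" for m m'
    proof -
      have "N + 3 > 0 \<or> N = -3 \<or> nat (- N - 3) \<ge> 1 \<and> N + 3 = - int (nat (- N - 3))"
        by linarith
      then consider "N + 3 > 0" | j where "j \<ge> 1" "N + 3 = - int j" | "N = -3"
        by blast
      then have "Poly_Mapping.lookup (beta (N + 3) (vac m)) (m', {#}) = (if m' = m \<and> N = -3 then - of_int m else 0)"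
        by cases (auto simp: beta_pos_vac lookup_beta_neg_vacuum beta_0_vac)
      then show ?thesis
        by (auto simp: A_def lookup_add lookup_minus lookup_diagonal_moment_vac power2_eq_square algebra_simps)
    qed
  qed
  then show ?thesis
    by (auto simp: A_def algebra_simps)
qed

lemma diagonal_quadratic:
  "Sum_any (\<lambda>a. pm_scale (c0 + c1 * of_int a + c2 * (of_int a)\<^sup>2) (opposite_pair a (N - a) v))
    = pm_scale (2 * c2) (beta (N + 3) v) + pm_scale (if N = -3 then 3 * c2 - c1 else 0) v"
proof -
  let ?X = "\<lambda>a. opposite_pair a (N - a) v"
  have "Sum_any (\<lambda>a. pm_scale (c0 + c1 * of_int a + c2 * (of_int a)\<^sup>2) (?X a))
      = Sum_any (\<lambda>a. pm_scale c0 (pm_scale (of_int a ^ 0) (?X a)) + pm_scale c1 (pm_scale (of_int a ^ 1) (?X a))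
        + pm_scale c2 (pm_scale (of_int a ^ 2) (?X a)))"
    by (simp add: pm.scale_left_distrib)
  also have "\<dots> = pm_scale c0 (diagonal_moment 0 N v) + pm_scale c1 (diagonal_moment 1 N v) + pm_scale c2 (diagonal_moment 2 N v)"
  proof -
    have fin: "finite {a. pm_scale c (pm_scale (of_int a ^ r) (?X a)) \<noteq> 0}" for c r
      by (rule finite_subset[OF _ opposite_pair_finite]) auto
    have fin2: "finite {a. pm_scale c (pm_scale (of_int a ^ r) (?X a)) + pm_scale c' (pm_scale (of_int a ^ r') (?X a)) \<noteq> 0}" for c r c' r'
      by (rule finite_subset[OF _ opposite_pair_finite[of N v]]) auto
    show ?thesis
      unfolding diagonal_moment_def Sum_any_scale[OF opposite_pair_finite_scale]
      by (subst Sum_any.distrib[OF fin2 fin], subst Sum_any.distrib[OF fin fin]) (rule refl)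
  qed
  finally show ?thesis
    unfolding diagonal_moment_0 diagonal_moment_1 diagonal_moment_2
    by (auto simp: pm.scale_right_distrib mult.commute pm.scale_left_diff_distrib)
qed

section \<open>The fermionic fields\<close>

lemma create_pm_linear: "pm_linear (create i)"
  by (rule pm_linearI) (rule create_linear)+

lemma annihilate_pm_linear: "pm_linear (annihilate i)"
  by (rule pm_linearI) (rule annihilate_linear)+

lemma charge_pm_linear: "pm_linear charge"
  by (rule pm_linearI) (rule charge_linear)+

lemma annihilate_bvec_eventually: "\<exists>N. \<forall>n\<ge>N. annihilate n (bvec D) = 0"
  "\<exists>N. \<forall>n\<ge>N. annihilate (- n - 1) (bvec D) = 0"
proof -
  have "\<exists>N. \<forall>i\<in>fset D. i < N \<and> - i < N"
    by (intro exI[of _ "1 + (\<Sum>i\<in>fset D. \<bar>i\<bar>)"] ballI)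
      (use member_le_sum[of _ "fset D" abs] in fastforce)
  then obtain N where N: "\<And>i. i |\<in>| D \<Longrightarrow> i < N \<and> - i < N"
    by blast
  show "\<exists>N. \<forall>n\<ge>N. annihilate n (bvec D) = 0"
    using N by (intro exI[of _ N]) (force simp: annihilate_bvec)
  show "\<exists>N. \<forall>n\<ge>N. annihilate (- n - 1) (bvec D) = 0"
    using N by (intro exI[of _ N]) (force simp: annihilate_bvec)
qed

lemma psi_plus_field: "is_field psi_plus"
proof (rule is_fieldI)
  fix D
  obtain N where "\<forall>n\<ge>N. annihilate n (bvec D) = 0"
    using annihilate_bvec_eventually(1) by blast
  then show "\<exists>N. \<forall>n\<ge>N. psi_plus n (bvec D) = 0"
    by (intro exI[of _ "max N 0"]) (simp add: psi_plus_def)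
qed (simp add: psi_plus_def create_pm_linear annihilate_pm_linear)

lemma psi_minus_field: "is_field psi_minus"
proof (rule is_fieldI)
  fix D
  obtain N where "\<forall>n\<ge>N. annihilate (- n - 1) (bvec D) = 0"
    using annihilate_bvec_eventually(2) by blast
  then show "\<exists>N. \<forall>n\<ge>N. psi_minus n (bvec D) = 0"
    by (intro exI[of _ "max N 0"]) (simp add: psi_minus_def)
qed (simp add: psi_minus_def create_pm_linear annihilate_pm_linear)

lemma fls_mode_eventually_zero: "\<exists>N. \<forall>n\<ge>N. fls_mode \<chi> n = 0"
  by (intro exI[of _ "- fls_subdegree \<chi>"]) (simp add: fls_mode_def fls_eq0_below_subdegree)

context
  fixes \<psi> :: "int \<Rightarrow> fock \<Rightarrow> fock"
  assumes field: "is_field \<psi>"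
begin

lemmas \<psi>_linear = is_field_linear[OF field]

lemma dressed_mode_finite:
  assumes "pm_linear H"
  shows "finite {k. pm_scale (fls_mode \<chi> (- k)) (H (\<psi> (k + i - 1) v)) \<noteq> 0}"
proof -
  obtain M where M: "\<And>n. n \<ge> M \<Longrightarrow> fls_mode \<chi> n = 0"
    using fls_mode_eventually_zero by blast
  obtain N where N: "\<And>n. n \<ge> N \<Longrightarrow> \<psi> n v = 0"
    using field is_field_truncation by metis
  have "{k. pm_scale (fls_mode \<chi> (- k)) (H (\<psi> (k + i - 1) v)) \<noteq> 0} \<subseteq> {- M..N - i + 1}"
  proof
    fix k assume "k \<in> {k. pm_scale (fls_mode \<chi> (- k)) (H (\<psi> (k + i - 1) v)) \<noteq> 0}"
    then have "fls_mode \<chi> (- k) \<noteq> 0" "\<psi> (k + i - 1) v \<noteq> 0"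
      by (auto simp: pm_linear_simps[OF assms])
    then show "k \<in> {- M..N - i + 1}"
      using M[of "- k"] N[of "k + i - 1"] by force
  qed
  then show ?thesis
    by (rule finite_subset) simp
qed

lemmas dressed_mode_finite_id = dressed_mode_finite[OF pm_linear_id]

lemma dressed_mode_linear: "pm_linear (dressed_mode \<psi> \<chi> i)"
  unfolding dressed_mode_def[abs_def]
  by (intro pm_linear_add pm_linear_scale \<psi>_linear pm_linear_Sum_any dressed_mode_finite_id)

lemma linear_dressed_mode:
  assumes "pm_linear H"
  shows "H (dressed_mode \<psi> \<chi> i v) = pm_scale (- of_int i) (H (\<psi> (i - 1) v))
    + Sum_any (\<lambda>k. pm_scale (fls_mode \<chi> (- k)) (H (\<psi> (k + i - 1) v)))"
  by (simp add: dressed_mode_def pm_linear_simps[OF assms] Sum_any_linear[OF assms dressed_mode_finite_id])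

lemma dressed_mode_field: "is_field (dressed_mode \<psi> \<chi>)"
  unfolding is_field_def
proof (intro conjI allI)
  fix v
  obtain M where M: "\<And>n. n \<ge> M \<Longrightarrow> fls_mode \<chi> n = 0"
    using fls_mode_eventually_zero by blast
  obtain N where N: "\<And>n. n \<ge> N \<Longrightarrow> \<psi> n v = 0"
    using field is_field_truncation by metis
  have "dressed_mode \<psi> \<chi> i v = 0" if i: "i \<ge> 1 + N + max M 0" for i
  proof -
    have "pm_scale (fls_mode \<chi> (- k)) (\<psi> (k + i - 1) v) = 0" for k
      using i M[of "- k"] N[of "k + i - 1"] by (cases "- k \<ge> M") auto
    then show ?thesis
      using i by (simp add: dressed_mode_def N del: pm.scale_eq_0_iff)
  qed
  then show "\<exists>N. \<forall>i\<ge>N. dressed_mode \<psi> \<chi> i v = 0" by blast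
qed (rule dressed_mode_linear)

lemma dressed_mode_anticommutator:
  assumes H: "pm_linear H"
    and anti: "\<And>r v. H (\<psi> r v) + \<psi> r (H v) = pm_scale (\<kappa> r) v"
  shows "H (dressed_mode \<psi> \<chi> i v) + dressed_mode \<psi> \<chi> i (H v)
    = pm_scale (- of_int i * \<kappa> (i - 1) + Sum_any (\<lambda>k. fls_mode \<chi> (- k) * \<kappa> (k + i - 1))) v"
proof -
  let ?c = "\<lambda>k. fls_mode \<chi> (- k)"
  have "H (dressed_mode \<psi> \<chi> i v) + dressed_mode \<psi> \<chi> i (H v)
      = pm_scale (- of_int i) (H (\<psi> (i - 1) v) + \<psi> (i - 1) (H v))
        + (Sum_any (\<lambda>k. pm_scale (?c k) (H (\<psi> (k + i - 1) v))) + Sum_any (\<lambda>k. pm_scale (?c k) (\<psi> (k + i - 1) (H v))))"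
    unfolding linear_dressed_mode[OF H] dressed_mode_def[of _ _ _ "H v"]
    by (simp add: pm.scale_right_distrib)
  also have "Sum_any (\<lambda>k. pm_scale (?c k) (H (\<psi> (k + i - 1) v))) + Sum_any (\<lambda>k. pm_scale (?c k) (\<psi> (k + i - 1) (H v)))
      = Sum_any (\<lambda>k. pm_scale (?c k) (H (\<psi> (k + i - 1) v)) + pm_scale (?c k) (\<psi> (k + i - 1) (H v)))"
    by (rule Sum_any.distrib[OF dressed_mode_finite[OF H] dressed_mode_finite_id, symmetric])
  also have "\<dots> = Sum_any (\<lambda>k. pm_scale (?c k * \<kappa> (k + i - 1)) v)"
    by (simp add: anti flip: pm.scale_right_distrib)
  also have "\<dots> = pm_scale (Sum_any (\<lambda>k. ?c k * \<kappa> (k + i - 1))) v"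
  proof (cases "v = 0")
    case False
    have "{k. pm_scale (?c k * \<kappa> (k + i - 1)) v \<noteq> 0} = {k. ?c k * \<kappa> (k + i - 1) \<noteq> 0}"
      using False by simp
    moreover have "finite {k. pm_scale (?c k * \<kappa> (k + i - 1)) v \<noteq> 0}"
      using finite_support_add[OF dressed_mode_finite[OF H] dressed_mode_finite_id, of \<chi> i v \<chi> i "H v"]
      by (simp only: anti pm.scale_scale flip: pm.scale_right_distrib)
    ultimately show ?thesis
      by (simp only: Sum_any.expand_set pm.scale_sum_left)
  qed simp
  finally show ?thesis
    by (simp add: anti pm.scale_left_distrib pm.scale_left_diff_distrib)
qed

lemma dressed_mode_charge:
  assumes "\<And>r v. charge (\<psi> r v) = \<psi> r (charge v) + pm_scale q (\<psi> r v)"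
  shows "charge (dressed_mode \<psi> \<chi> i v) = dressed_mode \<psi> \<chi> i (charge v) + pm_scale q (dressed_mode \<psi> \<chi> i v)"
proof -
  let ?c = "\<lambda>k. fls_mode \<chi> (- k)"
  have "charge (dressed_mode \<psi> \<chi> i v) = pm_scale (- of_int i) (\<psi> (i - 1) (charge v) + pm_scale q (\<psi> (i - 1) v))
      + Sum_any (\<lambda>k. pm_scale (?c k) (\<psi> (k + i - 1) (charge v)) + pm_scale (?c k) (pm_scale q (\<psi> (k + i - 1) v)))"
    by (simp only: linear_dressed_mode[OF charge_pm_linear] assms pm.scale_right_distrib)
  also have "Sum_any (\<lambda>k. pm_scale (?c k) (\<psi> (k + i - 1) (charge v)) + pm_scale (?c k) (pm_scale q (\<psi> (k + i - 1) v)))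
      = Sum_any (\<lambda>k. pm_scale (?c k) (\<psi> (k + i - 1) (charge v))) + Sum_any (\<lambda>k. pm_scale (?c k) (pm_scale q (\<psi> (k + i - 1) v)))"
    by (rule Sum_any.distrib[OF dressed_mode_finite_id dressed_mode_finite[OF pm_linear_scale[OF pm_linear_id]]])
  finally show ?thesis
    by (simp add: linear_dressed_mode[OF pm_linear_scale[OF pm_linear_id]] dressed_mode_def[of _ _ _ "charge v"]
        pm.scale_right_distrib mult.commute)
qed

end

text \<open>The scalar \<open>{G\<^sup>+(i - 1/2), G\<^sup>-(j - 1/2)}\<close>.\<close>

definition dressed_pairing :: "complex fls \<Rightarrow> complex fls \<Rightarrow> int \<Rightarrow> int \<Rightarrow> complex" where
  "dressed_pairing \<chi>p \<chi>m i j = (if i + j = 1 then of_int (i * j) else 0)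
     - of_int i * fls_mode \<chi>m (i + j - 1) - of_int j * fls_mode \<chi>p (i + j - 1)
     + Sum_any (\<lambda>k. fls_mode \<chi>m (- k) * fls_mode \<chi>p (i + j + k - 1))"

lemma dressed_psi_minus:
  "psi_minus r (dressed_mode psi_plus \<chi> i v) + dressed_mode psi_plus \<chi> i (psi_minus r v)
    = pm_scale ((if i + r = 0 then - of_int i else 0) + fls_mode \<chi> (i + r)) v"
proof -
  have "psi_minus r (psi_plus s v) + psi_plus s (psi_minus r v) = pm_scale (if s + r + 1 = 0 then 1 else 0) v" for s v
    using clifford_relations(1)[of s r v] by (simp add: add.commute)
  note dressed_mode_anticommutator[OF psi_plus_field is_field_linear[OF psi_minus_field] this, of \<chi> i v]
  moreover have "Sum_any (\<lambda>k. fls_mode \<chi> (- k) * (if k + i - 1 + r + 1 = 0 then 1 else 0)) = fls_mode \<chi> (i + r)"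
  proof -
    have "(\<lambda>k. fls_mode \<chi> (- k) * (if k + i - 1 + r + 1 = 0 then 1 else 0))
        = (\<lambda>k. if k = - i - r then fls_mode \<chi> (- k) else 0)"
      by (auto simp: fun_eq_iff)
    then show ?thesis
      by (simp add: add.commute cong del: Sum_any.cong)
  qed
  ultimately show ?thesis
    by (simp add: if_distrib cong: if_cong)
qed

lemma dressed_plus_minus:
  "dressed_mode psi_plus \<chi>p i (dressed_mode psi_minus \<chi>m j v) + dressed_mode psi_minus \<chi>m j (dressed_mode psi_plus \<chi>p i v)
    = pm_scale (dressed_pairing \<chi>p \<chi>m i j) v"
proof -
  let ?G = "dressed_mode psi_plus \<chi>p i"
  let ?\<kappa> = "\<lambda>r. (if i + r = 0 then - of_int i else 0) + fls_mode \<chi>p (i + r)"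
  have lin: "pm_linear ?G"
    by (rule dressed_mode_linear[OF psi_plus_field])
  have "?G (psi_minus r v) + psi_minus r (?G v) = pm_scale (?\<kappa> r) v" for r v
    using dressed_psi_minus[of r \<chi>p i v] by (simp add: add.commute)
  note main = dressed_mode_anticommutator[OF psi_minus_field lin this, of \<chi>m j v]
  obtain M where M: "\<And>n. n \<ge> M \<Longrightarrow> fls_mode \<chi>m n = 0"
    using fls_mode_eventually_zero by blast
  obtain N where N: "\<And>n. n \<ge> N \<Longrightarrow> fls_mode \<chi>p n = 0"
    using fls_mode_eventually_zero by blast
  have "{k. fls_mode \<chi>m (- k) * fls_mode \<chi>p (i + j + k - 1) \<noteq> 0} \<subseteq> {- M..N - i - j + 1}"
  proof
    fix k assume "k \<in> {k. fls_mode \<chi>m (- k) * fls_mode \<chi>p (i + j + k - 1) \<noteq> 0}"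
    then show "k \<in> {- M..N - i - j + 1}"
      using M[of "- k"] N[of "i + j + k - 1"] by force
  qed
  then have fin: "finite {k. fls_mode \<chi>m (- k) * fls_mode \<chi>p (i + j + k - 1) \<noteq> 0}"
    by (rule finite_subset) simp
  have "Sum_any (\<lambda>k. fls_mode \<chi>m (- k) * ?\<kappa> (k + j - 1))
      = Sum_any (\<lambda>k. (if k = 1 - i - j then - of_int i * fls_mode \<chi>m (- k) else 0)
          + fls_mode \<chi>m (- k) * fls_mode \<chi>p (i + j + k - 1))"
    by (rule Sum_any.cong) (auto simp: algebra_simps)
  also have "\<dots> = - of_int i * fls_mode \<chi>m (i + j - 1) + Sum_any (\<lambda>k. fls_mode \<chi>m (- k) * fls_mode \<chi>p (i + j + k - 1))"
  proof -
    have "finite {k. (if k = 1 - i - j then - of_int i * fls_mode \<chi>m (- k) else 0) \<noteq> 0}"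
      by (rule finite_subset[of _ "{1 - i - j}"]) auto
    moreover have "- (1 - i - j) = i + j - 1"
      by simp
    ultimately show ?thesis
      by (simp only: Sum_any.distrib[OF _ fin] Sum_any.delta)
  qed
  finally have sum: "Sum_any (\<lambda>k. fls_mode \<chi>m (- k) * ?\<kappa> (k + j - 1)) = \<dots>" .
  have "- of_int j * ?\<kappa> (j - 1) + Sum_any (\<lambda>k. fls_mode \<chi>m (- k) * ?\<kappa> (k + j - 1)) = dressed_pairing \<chi>p \<chi>m i j"
    unfolding sum by (auto simp: dressed_pairing_def algebra_simps)
  with main show ?thesis
    by simp
qed

lemma dressed_self_anticommute:
  assumes field: "is_field \<psi>" and anti: "\<And>r s v. \<psi> r (\<psi> s v) + \<psi> s (\<psi> r v) = 0"
  shows "dressed_mode \<psi> \<chi> i (dressed_mode \<psi> \<chi> j v) + dressed_mode \<psi> \<chi> j (dressed_mode \<psi> \<chi> i v) = 0"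
proof -
  let ?G = "dressed_mode \<psi> \<chi>"
  have "\<psi> r (?G i v) + ?G i (\<psi> r v) = 0" for r i v
    using dressed_mode_anticommutator[OF field is_field_linear[OF field], of r "\<lambda>_. 0" \<chi> i v] by (simp add: anti)
  then have "?G i (\<psi> r v) + \<psi> r (?G i v) = pm_scale 0 v" for r i v
    by (simp add: add.commute)
  then show ?thesis
    using dressed_mode_anticommutator[OF field dressed_mode_linear[OF field], of \<chi> i "\<lambda>_. 0" \<chi> j v] by simp
qed

section \<open>The critical level action\<close>

lemma Sum_any_swap_finite:
  assumes "finite {(j, i). g j i \<noteq> 0}"
  shows "finite {(i, j). g j i \<noteq> 0}"
proof -
  have "{(i, j). g j i \<noteq> 0} = prod.swap ` {(j, i). g j i \<noteq> 0}"
    by auto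
  with assms show ?thesis by simp
qed

text \<open>
  When fermionic and bosonic factor both change sign under exchange, the commutator of two
  products of fields involves only the fermionic anticommutator, here a scalar \<open>c\<^bsub>ij\<^esub>\<close>.
\<close>

lemma tensor_field_commutator:
  assumes fields: "is_field A" "is_field A'" "is_field B" "is_field B'"
    and A: "\<And>i j x. A i (A' j x) + A' j (A i x) = pm_scale (c i j) x"
    and B: "\<And>i j y. B' j (B i y) = - B i (B' j y)"
  shows "tensor_field A B m (tensor_field A' B' n (tensor x y)) - tensor_field A' B' n (tensor_field A B m (tensor x y))
      = Sum_any (\<lambda>(i, j). pm_scale (c i j) (tensor x (B (m - i - 1) (B' (n - j - 1) y))))"
    and "finite {(i, j). pm_scale (c i j) (tensor x (B (m - i - 1) (B' (n - j - 1) y))) \<noteq> 0}"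
proof -
  let ?g = "\<lambda>i j. tensor (A i (A' j x)) (B (m - i - 1) (B' (n - j - 1) y))"
  let ?h = "\<lambda>j i. tensor (A' j (A i x)) (B' (n - j - 1) (B (m - i - 1) y))"
  have g: "finite {(i, j). ?g i j \<noteq> 0}"
    by (rule tensor_field_compose_finite) (rule fields)+
  have h: "finite {(i, j). ?h j i \<noteq> 0}"
    by (rule Sum_any_swap_finite, rule tensor_field_compose_finite) (rule fields)+
  have gh: "?g i j - ?h j i = pm_scale (c i j) (tensor x (B (m - i - 1) (B' (n - j - 1) y)))" for i j
  proof -
    have "?g i j - ?h j i = tensor (A i (A' j x) + A' j (A i x)) (B (m - i - 1) (B' (n - j - 1) y))"
      by (simp add: B tensor_simps)
    then show ?thesis
      by (simp only: A tensor_linear)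
  qed
  have "tensor_field A B m (tensor_field A' B' n (tensor x y)) - tensor_field A' B' n (tensor_field A B m (tensor x y))
      = Sum_any (\<lambda>(i, j). ?g i j) - Sum_any (\<lambda>(j, i). ?h j i)"
    using fields by (simp only: tensor_field_compose)
  also have "Sum_any (\<lambda>(j, i). ?h j i) = Sum_any (\<lambda>(i, j). ?h j i)"
    by (rule Sum_any_swap_pairs)
  also have "Sum_any (\<lambda>(i, j). ?g i j) - Sum_any (\<lambda>(i, j). ?h j i) = Sum_any (\<lambda>(i, j). ?g i j - ?h j i)"
    using g h by (simp add: case_prod_unfold Sum_any_diff)
  finally show "tensor_field A B m (tensor_field A' B' n (tensor x y)) - tensor_field A' B' n (tensor_field A B m (tensor x y))
      = Sum_any (\<lambda>(i, j). pm_scale (c i j) (tensor x (B (m - i - 1) (B' (n - j - 1) y))))"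
    by (simp only: gh)
  have "finite {(i, j). ?g i j - ?h j i \<noteq> 0}"
    using finite_support_diff[of "\<lambda>(i, j). ?g i j" "\<lambda>(i, j). ?h j i"] g h by (simp add: case_prod_unfold)
  then show "finite {(i, j). pm_scale (c i j) (tensor x (B (m - i - 1) (B' (n - j - 1) y))) \<noteq> 0}"
    by (simp only: gh)
qed

text \<open>
  On each line \<open>i + j = s\<close> the scalar \<open>{G\<^sup>+(i - 1/2), G\<^sup>-(j - 1/2)}\<close> is a polynomial of degree at most two
  in \<open>i\<close>, quadratic only for \<open>s = 1\<close>. Summing it against \<open>Y(e\<^sup>\<beta>,z) Y(e\<^bsup>-\<beta>\<^esup>,w)\<close> picks out the first two
  coefficients of the expansion on the diagonal: the quadratic term produces \<open>-2\<beta>\<close> and the level,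
  the linear terms produce \<open>\<chi>\<^sup>+ - \<chi>\<^sup>-\<close>.
\<close>

lemma tensor_field_ef_commutator:
  fixes \<chi>p \<chi>m :: "complex fls"
  defines "E \<equiv> tensor_field (dressed_mode psi_plus \<chi>p) (lattice_mode 1)"
    and "F \<equiv> tensor_field (dressed_mode psi_minus \<chi>m) (lattice_mode (- 1))"
  shows "E m (F n v) - F n (E m v) = pm_scale (- 2) (tensor_op id (beta (m + n)) v)
      + pm_scale (2 * T_mode \<chi>p \<chi>m (m + n) + (if m + n = 0 then - 2 * of_int m else 0)) v"
proof (rule pm_linear_eq_tensor[of "\<lambda>v. E m (F n v) - F n (E m v)"])
  show "pm_linear (\<lambda>v. E m (F n v) - F n (E m v))"
    unfolding E_def F_def
    by (intro pm_linear_diff pm_linear_compose[OF tensor_field_linear tensor_field_linear]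
        dressed_mode_field psi_plus_field psi_minus_field lattice_mode_field)
  show "pm_linear (\<lambda>v. pm_scale (- 2) (tensor_op id (beta (m + n)) v)
      + pm_scale (2 * T_mode \<chi>p \<chi>m (m + n) + (if m + n = 0 then - 2 * of_int m else 0)) v)"
    by (intro pm_linear_add pm_linear_scale pm_linear_tensor_op pm_linear_id)
next
  fix x :: fock and y :: lattice
  let ?c = "dressed_pairing \<chi>p \<chi>m"
  let ?g = "\<lambda>(i, j). pm_scale (?c i j) (tensor x (opposite_pair (m - i - 1) (n - j - 1) y))"
  note comm = tensor_field_commutator[OF dressed_mode_field[OF psi_plus_field] dressed_mode_field[OF psi_minus_field]
      lattice_mode_field lattice_mode_field dressed_plus_minus, of "- 1" 1,
      folded opposite_pair_def]
  have anti: "lattice_mode (- 1) j (lattice_mode 1 i y) = - opposite_pair i j y" for i j y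
    by (simp add: opposite_pair_swap)
  have EF: "E m (F n (tensor x y)) - F n (E m (tensor x y)) = Sum_any ?g"
    unfolding E_def F_def by (rule comm(1)[OF anti])
  have fin: "finite {p. ?g p \<noteq> 0}"
    using comm(2)[OF anti, of \<chi>p \<chi>m x m n y] by (simp only: case_prod_unfold)
  \<comment> \<open>Sum first along the lines \<open>i + j = s\<close>, where \<open>c\<^bsub>ij\<^esub>\<close> is a quadratic polynomial in \<open>a = m - i - 1\<close>.\<close>
  define h where "h = (\<lambda>(s, a). (m - 1 - a, s - m + 1 + a) :: int \<times> int)"
  have h: "bij h"
    by (rule bij_betw_byWitness[of _ "\<lambda>(i, j). (i + j, m - 1 - i)"]) (auto simp: h_def)
  define c2 where "c2 s = (if s = 1 then - 1 else 0 :: complex)" for s :: int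
  define c1 where "c1 s = (if s = 1 then 2 * of_int m - 3 else 0) + fls_mode \<chi>m (s - 1) - fls_mode \<chi>p (s - 1)" for s
  have "\<exists>c0. \<forall>a. ?c (m - 1 - a) (s - m + 1 + a) = c0 + c1 s * of_int a + c2 s * (of_int a)\<^sup>2" for s
  proof (intro exI allI)
    fix a
    have "(m - 1 - a) + (s - m + 1 + a) = s" by simp
    moreover have "s - m + 1 + a = s - (m - 1 - a)" by simp
    ultimately show "?c (m - 1 - a) (s - m + 1 + a)
        = ((if s = 1 then of_int ((m - 1) * (2 - m)) else 0) - of_int (m - 1) * fls_mode \<chi>m (s - 1)
            - of_int (s - m + 1) * fls_mode \<chi>p (s - 1) + Sum_any (\<lambda>k. fls_mode \<chi>m (- k) * fls_mode \<chi>p (s + k - 1)))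
          + c1 s * of_int a + c2 s * (of_int a)\<^sup>2"
      unfolding dressed_pairing_def c1_def c2_def
      by (auto simp: algebra_simps power2_eq_square)
  qed
  then obtain c0 where c: "\<And>s a. ?c (m - 1 - a) (s - m + 1 + a) = c0 s + c1 s * of_int a + c2 s * (of_int a)\<^sup>2"
    by metis
  let ?X = "\<lambda>s a. opposite_pair a (m + n - 2 - s - a) y"
  have gh: "?g (h (s, a)) = tensor x (pm_scale (c0 s + c1 s * of_int a + c2 s * (of_int a)\<^sup>2) (?X s a))" for s a
  proof -
    have "m - (m - 1 - a) - 1 = a" "n - (s - m + 1 + a) - 1 = m + n - 2 - s - a"
      by simp_all
    then show ?thesis
      by (simp only: h_def prod.case c tensor_linear)
  qed
  have "finite (h -` {p. ?g p \<noteq> 0})"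
    by (rule finite_vimageI[OF fin bij_is_inj[OF h]])
  also have "h -` {p. ?g p \<noteq> 0} = {(s, a). ?g (h (s, a)) \<noteq> 0}"
    by auto
  finally have fin': "finite {(s, a). ?g (h (s, a)) \<noteq> 0}" .
  have "Sum_any ?g = Sum_any (\<lambda>(s, a). ?g (h (s, a)))"
    by (rule Sum_any.reindex_cong[OF h]) auto
  also have "\<dots> = Sum_any (\<lambda>s. Sum_any (\<lambda>a. ?g (h (s, a))))"
    by (rule Sum_any_pairs[OF fin', symmetric])
  also have "\<dots> = Sum_any (\<lambda>s. tensor x (Sum_any (\<lambda>a. pm_scale (c0 s + c1 s * of_int a + c2 s * (of_int a)\<^sup>2) (?X s a))))"
    by (simp only: gh Sum_any_linear[OF tensor_pm_linear(2) opposite_pair_finite_scale])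
  also have "\<dots> = Sum_any (\<lambda>s. (if s = 1 then pm_scale (- 2) (tensor x (beta (m + n) y)) else 0)
      + (if s = m + n + 1 then pm_scale (3 * c2 s - c1 s) (tensor x y) else 0))"
  proof (rule Sum_any.cong)
    fix s
    have "m + n - 2 - s + 3 = m + n + 1 - s" "m + n - 2 - s = - 3 \<longleftrightarrow> s = m + n + 1"
      by auto
    then have "tensor x (Sum_any (\<lambda>a. pm_scale (c0 s + c1 s * of_int a + c2 s * (of_int a)\<^sup>2) (?X s a)))
        = tensor x (pm_scale (2 * c2 s) (beta (m + n + 1 - s) y) + pm_scale (if s = m + n + 1 then 3 * c2 s - c1 s else 0) y)"
      by (simp only: diagonal_quadratic)
    then show "tensor x (Sum_any (\<lambda>a. pm_scale (c0 s + c1 s * of_int a + c2 s * (of_int a)\<^sup>2) (?X s a)))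
        = (if s = 1 then pm_scale (- 2) (tensor x (beta (m + n) y)) else 0)
          + (if s = m + n + 1 then pm_scale (3 * c2 s - c1 s) (tensor x y) else 0)"
      by (auto simp: tensor_simps c2_def)
  qed
  also have "\<dots> = pm_scale (- 2) (tensor x (beta (m + n) y)) + pm_scale (3 * c2 (m + n + 1) - c1 (m + n + 1)) (tensor x y)"
  proof -
    have f1: "finite {s. (if s = 1 then pm_scale (- 2) (tensor x (beta (m + n) y)) else 0) \<noteq> 0}"
      by (rule finite_subset[of _ "{1}"]) auto
    have f2: "finite {s. (if s = m + n + 1 then pm_scale (3 * c2 s - c1 s) (tensor x y) else 0) \<noteq> 0}"
      by (rule finite_subset[of _ "{m + n + 1}"]) auto
    show ?thesis
      unfolding Sum_any.distrib[OF f1 f2] Sum_any.delta ..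
  qed
  also have "3 * c2 (m + n + 1) - c1 (m + n + 1)
      = 2 * T_mode \<chi>p \<chi>m (m + n) + (if m + n = 0 then - 2 * of_int m else 0)"
    by (simp add: c1_def c2_def T_mode_def)
  finally show "E m (F n (tensor x y)) - F n (E m (tensor x y))
      = pm_scale (- 2) (tensor_op id (beta (m + n)) (tensor x y))
        + pm_scale (2 * T_mode \<chi>p \<chi>m (m + n) + (if m + n = 0 then - 2 * of_int m else 0)) (tensor x y)"
    using EF by (simp add: tensor_op_tensor beta_pm_linear pm_linear_id[folded id_def])
qed

text \<open>
  The fermionic factor is antisymmetric and the bosonic anticommutator only depends on the sum of
  its two indices, so the double sum for the commutator cancels against itself.
\<close>

lemma tensor_field_self_commute:
  fixes \<chi> :: "complex fls"
  assumes field: "is_field \<psi>" and anti: "\<And>r s v. \<psi> r (\<psi> s v) + \<psi> s (\<psi> r v) = 0"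
    and s: "s = 1 \<or> s = -1"
  defines "E \<equiv> tensor_field (dressed_mode \<psi> \<chi>) (lattice_mode s)"
  shows "E m (E n v) = E n (E m v)"
proof (rule pm_linear_eq_tensor[of "\<lambda>v. E m (E n v)"])
  have lin: "pm_linear (\<lambda>v. E m (E n v))" for m n
    unfolding E_def
    by (intro pm_linear_compose[OF tensor_field_linear tensor_field_linear] dressed_mode_field field lattice_mode_field)
  show "pm_linear (\<lambda>v. E m (E n v))" "pm_linear (\<lambda>v. E n (E m v))"
    by (rule lin)+
next
  fix x :: fock and y :: lattice
  let ?G = "dressed_mode \<psi> \<chi>" and ?Y = "lattice_mode s"
  note fields = dressed_mode_field[OF field, of \<chi>] lattice_mode_field[of s]
  let ?g = "\<lambda>i j. tensor (?G i (?G j x)) (?Y (m - i - 1) (?Y (n - j - 1) y))"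
  let ?h = "\<lambda>j i. tensor (?G j (?G i x)) (?Y (n - j - 1) (?Y (m - i - 1) y))"
  let ?D = "\<lambda>i j. tensor (?G i (?G j x)) (?Y (m - i - 1) (?Y (n - j - 1) y) + ?Y (n - j - 1) (?Y (m - i - 1) y))"
  have G: "?G j (?G i x) = - ?G i (?G j x)" for i j
    using dressed_self_anticommute[OF field anti, of \<chi> j i x] by (simp add: eq_neg_iff_add_eq_0)
  have g: "finite {(i, j). ?g i j \<noteq> 0}"
    by (rule tensor_field_compose_finite) (rule fields)+
  have h: "finite {(i, j). ?h j i \<noteq> 0}"
    by (rule Sum_any_swap_finite, rule tensor_field_compose_finite) (rule fields)+
  have gh: "?g i j - ?h j i = ?D i j" for i j
    by (simp add: G[of j i] tensor_simps)
  have "finite {(i, j). ?g i j - ?h j i \<noteq> 0}"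
    using finite_support_diff[of "\<lambda>(i, j). ?g i j" "\<lambda>(i, j). ?h j i"] g h by (simp add: case_prod_unfold)
  then have fin: "finite {(i, j). ?D i j \<noteq> 0}"
    by (simp only: gh)
  have "E m (E n (tensor x y)) - E n (E m (tensor x y)) = Sum_any (\<lambda>(i, j). ?g i j) - Sum_any (\<lambda>(j, i). ?h j i)"
    unfolding E_def by (simp only: tensor_field_compose fields)
  also have "Sum_any (\<lambda>(j, i). ?h j i) = Sum_any (\<lambda>(i, j). ?h j i)"
    by (rule Sum_any_swap_pairs)
  also have "Sum_any (\<lambda>(i, j). ?g i j) - \<dots> = Sum_any (\<lambda>(i, j). ?g i j - ?h j i)"
    using g h by (simp add: case_prod_unfold Sum_any_diff)
  finally have diff: "E m (E n (tensor x y)) - E n (E m (tensor x y)) = Sum_any (\<lambda>(i, j). ?D i j)"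
    by (simp only: gh)
  have neg: "?D j i = - ?D i j" for i j
    using lattice_mode_self_anticommutator[OF s, of "m - j - 1" "n - i - 1" "m - i - 1" "n - j - 1" y]
    by (simp add: G[of j i] tensor_simps)
  have "Sum_any (\<lambda>(i, j). ?D i j) = Sum_any (\<lambda>(j, i). ?D i j)"
    by (rule Sum_any_swap_pairs)
  also have "\<dots> = Sum_any (\<lambda>(j, i). - ?D j i)"
    unfolding case_prod_unfold by (rule Sum_any.cong) (rule neg)
  also have "\<dots> = - Sum_any (\<lambda>(i, j). ?D i j)"
    using Sum_any_uminus[of "\<lambda>(i, j). ?D i j"] fin by (simp add: case_prod_unfold)
  finally have "Sum_any (\<lambda>(i, j). ?D i j) + Sum_any (\<lambda>(i, j). ?D i j) = 0"
    by (simp only: eq_neg_iff_add_eq_0)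
  then have "pm_scale 2 (Sum_any (\<lambda>(i, j). ?D i j)) = 0"
    by (simp only: pm.scale_left_distrib[of 1 1, simplified])
  with diff show "E m (E n (tensor x y)) = E n (E m (tensor x y))"
    by simp
qed

lemma pm_linear_id': "pm_linear id"
  using pm_linear_id by (simp add: id_def)

lemma beta_tensor_field:
  assumes A: "is_field A"
  shows "tensor_op id (beta k) (tensor_field A (lattice_mode l) n v)
    = tensor_field A (lattice_mode l) n (tensor_op id (beta k) v)
      - pm_scale (of_int l) (tensor_field A (lattice_mode l) (n + k) v)"
proof (rule pm_linear_eq_tensor[of "\<lambda>v. tensor_op id (beta k) (tensor_field A (lattice_mode l) n v)"])
  note lin = pm_linear_tensor_op tensor_field_linear[OF A lattice_mode_field]
  show "pm_linear (\<lambda>v. tensor_op id (beta k) (tensor_field A (lattice_mode l) n v))"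
    "pm_linear (\<lambda>v. tensor_field A (lattice_mode l) n (tensor_op id (beta k) v)
      - pm_scale (of_int l) (tensor_field A (lattice_mode l) (n + k) v))"
    by (intro pm_linear_diff pm_linear_scale pm_linear_compose[OF lin(1) lin(2)]
        pm_linear_compose[OF lin(2) lin(1)] lin)+
next
  fix x y
  note fin = tensor_field_finite_tensor[OF A lattice_mode_field]
  have "tensor_op id (beta k) (tensor_field A (lattice_mode l) n (tensor x y))
      = Sum_any (\<lambda>i. tensor (A i x) (beta k (lattice_mode l (n - i - 1) y)))"
    by (simp add: tensor_field_tensor[OF A lattice_mode_field] Sum_any_linear[OF pm_linear_tensor_op fin]
        tensor_op_tensor[OF pm_linear_id' beta_pm_linear])
  also have "\<dots> = Sum_any (\<lambda>i. tensor (A i x) (lattice_mode l (n - i - 1) (beta k y))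
      - pm_scale (of_int l) (tensor (A i x) (lattice_mode l (n + k - i - 1) y)))"
    by (simp add: beta_lattice_mode tensor_simps algebra_simps)
  also have "\<dots> = Sum_any (\<lambda>i. tensor (A i x) (lattice_mode l (n - i - 1) (beta k y)))
      - Sum_any (\<lambda>i. pm_scale (of_int l) (tensor (A i x) (lattice_mode l (n + k - i - 1) y)))"
    by (rule Sum_any_diff[OF fin finite_subset[OF _ fin]]) auto
  finally show "tensor_op id (beta k) (tensor_field A (lattice_mode l) n (tensor x y))
    = tensor_field A (lattice_mode l) n (tensor_op id (beta k) (tensor x y))
      - pm_scale (of_int l) (tensor_field A (lattice_mode l) (n + k) (tensor x y))"
    by (simp add: tensor_field_tensor[OF A lattice_mode_field] Sum_any_scale[OF fin]
        tensor_op_tensor[OF pm_linear_id' beta_pm_linear])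
qed

lemma charge_tensor_field:
  assumes A: "is_field A" and B: "is_field B"
    and q: "\<And>i x. charge (A i x) = A i (charge x) + pm_scale q (A i x)"
  shows "tensor_op charge id (tensor_field A B n v)
    = tensor_field A B n (tensor_op charge id v) + pm_scale q (tensor_field A B n v)"
proof (rule pm_linear_eq_tensor[of "\<lambda>v. tensor_op charge id (tensor_field A B n v)"])
  note lin = pm_linear_tensor_op tensor_field_linear[OF A B]
  show "pm_linear (\<lambda>v. tensor_op charge id (tensor_field A B n v))"
    "pm_linear (\<lambda>v. tensor_field A B n (tensor_op charge id v) + pm_scale q (tensor_field A B n v))"
    by (intro pm_linear_add pm_linear_scale pm_linear_compose[OF lin(1) lin(2)]
        pm_linear_compose[OF lin(2) lin(1)] lin)+
next
  fix x y
  note fin = tensor_field_finite_tensor[OF A B]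
  have "tensor_op charge id (tensor_field A B n (tensor x y)) = Sum_any (\<lambda>i. tensor (charge (A i x)) (B (n - i - 1) y))"
    by (simp add: tensor_field_tensor[OF A B] Sum_any_linear[OF pm_linear_tensor_op fin]
        tensor_op_tensor[OF charge_pm_linear pm_linear_id'])
  also have "\<dots> = Sum_any (\<lambda>i. tensor (A i (charge x)) (B (n - i - 1) y) + pm_scale q (tensor (A i x) (B (n - i - 1) y)))"
    by (simp add: q tensor_simps)
  also have "\<dots> = Sum_any (\<lambda>i. tensor (A i (charge x)) (B (n - i - 1) y)) + Sum_any (\<lambda>i. pm_scale q (tensor (A i x) (B (n - i - 1) y)))"
    by (rule Sum_any.distrib[OF fin finite_subset[OF _ fin]]) auto
  finally show "tensor_op charge id (tensor_field A B n (tensor x y))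
    = tensor_field A B n (tensor_op charge id (tensor x y)) + pm_scale q (tensor_field A B n (tensor x y))"
    by (simp add: tensor_field_tensor[OF A B] Sum_any_scale[OF fin]
        tensor_op_tensor[OF charge_pm_linear pm_linear_id'])
qed

lemma H0_linear: "pm_linear H0"
  unfolding H0_def[abs_def] by (intro pm_linear_add pm_linear_tensor_op)

lemma H0_tensor_field:
  assumes "is_field A" "\<And>i x. charge (A i x) = A i (charge x) + pm_scale (of_int l) (A i x)"
  shows "H0 (tensor_field A (lattice_mode l) n v) = tensor_field A (lattice_mode l) n (H0 v)"
  by (simp add: H0_def charge_tensor_field[OF assms(1) lattice_mode_field assms(2)]
      beta_tensor_field[OF assms(1)] pm_linear_simps[OF tensor_field_linear[OF assms(1) lattice_mode_field]])

lemma tensor_op_compose: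
  assumes "pm_linear A" "pm_linear A'" "pm_linear B" "pm_linear B'"
  shows "tensor_op A B (tensor_op A' B' v) = tensor_op (\<lambda>x. A (A' x)) (\<lambda>y. B (B' y)) v"
  by (rule pm_linear_eq_tensor[of "\<lambda>v. tensor_op A B (tensor_op A' B' v)"])
    (simp_all add: pm_linear_compose[OF pm_linear_tensor_op pm_linear_tensor_op] pm_linear_tensor_op
      tensor_op_tensor assms pm_linear_compose[OF assms(1,2)] pm_linear_compose[OF assms(3,4)])

lemma tensor_op_beta_commutator:
  "tensor_op id (beta m) (tensor_op id (beta n) v) - tensor_op id (beta n) (tensor_op id (beta m) v)
    = pm_scale (if m + n = 0 then - of_int m else 0) v"
proof (rule pm_linear_eq_tensor[of "\<lambda>v. tensor_op id (beta m) (tensor_op id (beta n) v) - tensor_op id (beta n) (tensor_op id (beta m) v)"])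
  fix x y
  have "tensor_op id (beta m) (tensor_op id (beta n) (tensor x y)) - tensor_op id (beta n) (tensor_op id (beta m) (tensor x y))
      = tensor x (beta m (beta n y) - beta n (beta m y))"
    by (simp add: tensor_op_tensor[OF pm_linear_id' beta_pm_linear] tensor_simps)
  then show "tensor_op id (beta m) (tensor_op id (beta n) (tensor x y)) - tensor_op id (beta n) (tensor_op id (beta m) (tensor x y))
    = pm_scale (if m + n = 0 then - of_int m else 0) (tensor x y)"
    by (simp only: beta_commutator tensor_linear)
qed (intro pm_linear_diff pm_linear_scale pm_linear_id pm_linear_compose[OF pm_linear_tensor_op pm_linear_tensor_op])+

lemma H0_beta: "H0 (tensor_op id (beta n) v) = tensor_op id (beta n) (H0 v)"
proof -
  have "tensor_op charge id (tensor_op id (beta n) v) = tensor_op id (beta n) (tensor_op charge id v)"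
    by (simp add: tensor_op_compose charge_pm_linear beta_pm_linear pm_linear_id')
  moreover have "tensor_op id (beta 0) (tensor_op id (beta n) v) = tensor_op id (beta n) (tensor_op id (beta 0) v)"
    using tensor_op_beta_commutator[of 0 n v] by (simp split: if_splits)
  ultimately show ?thesis
    by (simp add: H0_def pm_linear_simps[OF pm_linear_tensor_op])
qed

section \<open>The module structure\<close>

lemma affine_op_e: "affine_op \<chi>p \<chi>m (Mode sl2_e n) = tensor_field (dressed_mode psi_plus \<chi>p) (lattice_mode 1) n"
  by (simp add: fun_eq_iff tensor_field_def)

lemma affine_op_f: "affine_op \<chi>p \<chi>m (Mode sl2_f n) = tensor_field (dressed_mode psi_minus \<chi>m) (lattice_mode (- 1)) n"
  by (simp add: fun_eq_iff tensor_field_def)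

lemma affine_op_h: "affine_op \<chi>p \<chi>m (Mode sl2_h n) = (\<lambda>v. pm_scale (- 2) (tensor_op id (beta n) v) + pm_scale (2 * T_mode \<chi>p \<chi>m n) v)"
  by (simp add: fun_eq_iff)

lemmas plus_field = dressed_mode_field[OF psi_plus_field]
lemmas minus_field = dressed_mode_field[OF psi_minus_field]

lemma affine_op_linear: "pm_linear (affine_op \<chi>p \<chi>m b)"
proof (cases b)
  case (Mode a n)
  then show ?thesis
    by (cases a) (auto simp only: affine_op_e affine_op_f affine_op_h intro!: pm_linear_add pm_linear_scale
        pm_linear_id pm_linear_tensor_op tensor_field_linear plus_field minus_field lattice_mode_field)
next
  case Central
  moreover have "affine_op \<chi>p \<chi>m Central = (\<lambda>v. pm_scale (- 2) v)"
    by (simp add: fun_eq_iff)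
  ultimately show ?thesis
    by (simp only: pm_linear_scale pm_linear_id)
qed

lemma charge_dressed_plus:
  "charge (dressed_mode psi_plus \<chi> i x) = dressed_mode psi_plus \<chi> i (charge x) + pm_scale (of_int 1) (dressed_mode psi_plus \<chi> i x)"
  by (rule dressed_mode_charge[OF psi_plus_field]) (use charge_psi in \<open>simp add: diff_eq_eq add.commute\<close>)

lemma charge_dressed_minus:
  "charge (dressed_mode psi_minus \<chi> i x) = dressed_mode psi_minus \<chi> i (charge x) + pm_scale (of_int (- 1)) (dressed_mode psi_minus \<chi> i x)"
  by (rule dressed_mode_charge[OF psi_minus_field]) (use charge_psi in \<open>simp add: diff_eq_eq pm_scale_minus_one\<close>)

lemma H0_affine_op: "H0 (affine_op \<chi>p \<chi>m b v) = affine_op \<chi>p \<chi>m b (H0 v)"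
proof (cases b)
  case (Mode a n)
  show ?thesis
    by (cases a) (simp_all only: Mode affine_op_e affine_op_f affine_op_h H0_tensor_field[OF plus_field charge_dressed_plus]
        H0_tensor_field[OF minus_field charge_dressed_minus] pm_linear_simps[OF H0_linear] H0_beta)
next
  case Central
  then show ?thesis by (simp add: pm_linear_simps[OF H0_linear])
qed

lemma affine_act_bvec [simp]: "affine_act \<chi>p \<chi>m (bvec b) v = affine_op \<chi>p \<chi>m b v"
  by (simp add: affine_act_def)

lemma affine_act_linear_left: "pm_linear (\<lambda>x. affine_act \<chi>p \<chi>m x v)"
  by (simp add: affine_act_def linear_lin_ext)

lemma affine_act_linear_right: "pm_linear (affine_act \<chi>p \<chi>m x)"
proof -
  have "affine_act \<chi>p \<chi>m x = (\<lambda>v. \<Sum>b\<in>Poly_Mapping.keys x. pm_scale (Poly_Mapping.lookup x b) (affine_op \<chi>p \<chi>m b v))"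
    by (simp add: affine_act_def lin_ext_def fun_eq_iff)
  then show ?thesis
    by (simp only:) (intro pm_linear_sum pm_linear_scale affine_op_linear)
qed

lemmas affine_act_simps = pm_linear_simps[OF affine_act_linear_left] pm_linear_simps[OF affine_act_linear_right]

lemma affine_op_bracket:
  "affine_act \<chi>p \<chi>m (affine_bracket_basis a b) v
    = affine_op \<chi>p \<chi>m a (affine_op \<chi>p \<chi>m b v) - affine_op \<chi>p \<chi>m b (affine_op \<chi>p \<chi>m a v)"
proof -
  let ?op = "affine_op \<chi>p \<chi>m" and ?act = "affine_act \<chi>p \<chi>m"
  have h: "?op (Mode sl2_h m) (?op (Mode sl2_h n) v) - ?op (Mode sl2_h n) (?op (Mode sl2_h m) v)
      = pm_scale (if m + n = 0 then - 4 * of_int m else 0) v" for m n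
  proof -
    have "?op (Mode sl2_h m) (?op (Mode sl2_h n) v) - ?op (Mode sl2_h n) (?op (Mode sl2_h m) v)
        = pm_scale 4 (tensor_op id (beta m) (tensor_op id (beta n) v) - tensor_op id (beta n) (tensor_op id (beta m) v))"
      unfolding affine_op_h
      by (simp add: pm_linear_simps[OF pm_linear_tensor_op] pm.scale_right_distrib pm.scale_right_diff_distrib algebra_simps)
    then show ?thesis
      by (simp add: tensor_op_beta_commutator)
  qed
  have he: "?op (Mode sl2_h m) (?op (Mode sl2_e n) v) - ?op (Mode sl2_e n) (?op (Mode sl2_h m) v)
      = pm_scale 2 (?op (Mode sl2_e (m + n)) v)" for m n
    unfolding affine_op_h affine_op_e
    by (simp add: pm_linear_simps[OF tensor_field_linear[OF plus_field lattice_mode_field]]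
        beta_tensor_field[OF plus_field] pm.scale_right_diff_distrib add.commute)
  have hf: "?op (Mode sl2_h m) (?op (Mode sl2_f n) v) - ?op (Mode sl2_f n) (?op (Mode sl2_h m) v)
      = pm_scale (- 2) (?op (Mode sl2_f (m + n)) v)" for m n
    unfolding affine_op_h affine_op_f
    by (simp add: pm_linear_simps[OF tensor_field_linear[OF minus_field lattice_mode_field]]
        beta_tensor_field[OF minus_field] pm.scale_right_distrib add.commute)
  have ef: "?op (Mode sl2_e m) (?op (Mode sl2_f n) v) - ?op (Mode sl2_f n) (?op (Mode sl2_e m) v)
      = ?op (Mode sl2_h (m + n)) v + pm_scale (if m + n = 0 then - 2 * of_int m else 0) v" for m n
    unfolding affine_op_e affine_op_f affine_op_h tensor_field_ef_commutator
    by (simp only: pm.scale_left_distrib add.assoc)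
  have ee: "?op (Mode sl2_e m) (?op (Mode sl2_e n) v) = ?op (Mode sl2_e n) (?op (Mode sl2_e m) v)" for m n
    unfolding affine_op_e by (rule tensor_field_self_commute[OF psi_plus_field clifford_relations(2)]) simp
  have ff: "?op (Mode sl2_f m) (?op (Mode sl2_f n) v) = ?op (Mode sl2_f n) (?op (Mode sl2_f m) v)" for m n
    unfolding affine_op_f by (rule tensor_field_self_commute[OF psi_minus_field clifford_relations(3)]) simp
  have central: "?op Central v = pm_scale (- 2) v" for v
    by simp
  \<comment> \<open>By antisymmetry, only one of the two orders of each pair of generators has to be treated.\<close>
  have swap: "?act (affine_bracket_basis a b) v = ?op a (?op b v) - ?op b (?op a v)"
    if "?act (affine_bracket_basis b a) v = ?op b (?op a v) - ?op a (?op b v)" for a b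
    unfolding affine_bracket_basis_swap[of a b] affine_act_simps that by simp
  note simps = affine_act_simps affine_act_bvec lin_ext_scale lin_ext_bvec lin_ext_zero
  have eq: "?act (affine_bracket_basis (Mode x m) (Mode y n)) v = ?op (Mode x m) (?op (Mode y n) v) - ?op (Mode y n) (?op (Mode x m) v)"
    if "(x, y) \<in> {(sl2_h, sl2_h), (sl2_h, sl2_e), (sl2_h, sl2_f), (sl2_e, sl2_f), (sl2_e, sl2_e), (sl2_f, sl2_f)}" for x y m n
    using that
    by (elim insertE emptyE)
      (auto simp: h he hf ef ee[of m n] ff[of m n] simps simp del: affine_op.simps(1-3) pm.scale_minus_left)
  show ?thesis
  proof (cases a; cases b)
    fix x m y n assume ab: "a = Mode x m" "b = Mode y n"
    show ?thesis
      unfolding ab using eq[of x y m n] swap[OF eq[of y x n m]] by (cases x; cases y) simp_all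
  qed (simp_all add: affine_act_simps pm_linear_simps[OF affine_op_linear] del: affine_op.simps(1-3))
qed

lemma affine_act_bracket:
  "affine_act \<chi>p \<chi>m (affine_bracket x y) v
    = affine_act \<chi>p \<chi>m x (affine_act \<chi>p \<chi>m y v) - affine_act \<chi>p \<chi>m y (affine_act \<chi>p \<chi>m x v)"
proof -
  let ?act = "affine_act \<chi>p \<chi>m"
  have bracket: "pm_linear (\<lambda>x. affine_bracket x y)" "pm_linear (affine_bracket x)" for x y
    by (rule pm_linearI; simp add: affine_bracket_linear)+
  have lin: "pm_linear (\<lambda>x. ?act (affine_bracket x y) v)" "pm_linear (\<lambda>y. ?act (affine_bracket x y) v)"
    "pm_linear (\<lambda>x. ?act x (?act y v) - ?act y (?act x v))" "pm_linear (\<lambda>y. ?act x (?act y v) - ?act y (?act x v))" for x y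
    by (intro pm_linear_diff pm_linear_compose[OF affine_act_linear_left bracket(1)]
        pm_linear_compose[OF affine_act_linear_left bracket(2)] affine_act_linear_left
        pm_linear_compose[OF affine_act_linear_right affine_act_linear_left])+
  have "?act (affine_bracket (bvec a) y) v = ?act (bvec a) (?act y v) - ?act y (?act (bvec a) v)" for a y
    by (rule pm_linear_eqI[OF lin(2)[of "bvec a"] lin(4)[of "bvec a"]]) (simp add: affine_op_bracket del: affine_op.simps)
  then show ?thesis
    by (rule pm_linear_eqI[OF lin(1)[of y] lin(3)[of y]])
qed

theorem L0_lie_module: "lie_module pm_scale affine_bracket pm_scale (L0 \<chi>p \<chi>m)"
proof unfold_locales
  show "pm.subspace (rep_space (L0 \<chi>p \<chi>m))"
    by (simp add: L0_def pm.subspace_def pm_linear_simps[OF H0_linear])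
next
  fix x v
  have "H0 (affine_act \<chi>p \<chi>m x v) = affine_act \<chi>p \<chi>m x (H0 v)"
    by (simp add: affine_act_def lin_ext_def pm_linear_simps[OF H0_linear] H0_affine_op)
  then show "rep_act (L0 \<chi>p \<chi>m) x v \<in> rep_space (L0 \<chi>p \<chi>m)" if "v \<in> rep_space (L0 \<chi>p \<chi>m)"
    using that by (simp add: L0_def affine_act_simps)
next
  fix x y v w c
  show "rep_act (L0 \<chi>p \<chi>m) (x + y) v = rep_act (L0 \<chi>p \<chi>m) x v + rep_act (L0 \<chi>p \<chi>m) y v"
    "rep_act (L0 \<chi>p \<chi>m) (pm_scale c x) v = pm_scale c (rep_act (L0 \<chi>p \<chi>m) x v)"
    "rep_act (L0 \<chi>p \<chi>m) x (v + w) = rep_act (L0 \<chi>p \<chi>m) x v + rep_act (L0 \<chi>p \<chi>m) x w"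
    "rep_act (L0 \<chi>p \<chi>m) x (pm_scale c v) = pm_scale c (rep_act (L0 \<chi>p \<chi>m) x v)"
    by (simp_all add: L0_def affine_act_simps)
  show "rep_act (L0 \<chi>p \<chi>m) (affine_bracket x y) v
      = rep_act (L0 \<chi>p \<chi>m) x (rep_act (L0 \<chi>p \<chi>m) y v) - rep_act (L0 \<chi>p \<chi>m) y (rep_act (L0 \<chi>p \<chi>m) x v)"
    by (simp add: L0_def affine_act_bracket)
qed

section \<open>Coefficients of vectors and of diagonal operators\<close>

lemma lookup_tensor: "Poly_Mapping.lookup (tensor x y) (a, b) = Poly_Mapping.lookup x a * Poly_Mapping.lookup y b"
proof -
  have "Poly_Mapping.lookup (tensor (bvec a') y) (a, b) = (if a' = a then 1 else 0) * Poly_Mapping.lookup y b" for a'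
    by (rule lookup_linear_basis[OF tensor_pm_linear(2)]) auto
  then have "Poly_Mapping.lookup (tensor x y) (a, b) = Poly_Mapping.lookup y b * Poly_Mapping.lookup x a"
    by (intro lookup_linear_basis[OF tensor_pm_linear(1)]) auto
  then show ?thesis by simp
qed

lemma lookup_diagonal:
  assumes "pm_linear f" "\<And>b. f (bvec b) = pm_scale (c b) (bvec b)"
  shows "Poly_Mapping.lookup (f v) k = c k * Poly_Mapping.lookup v k"
  by (rule lookup_linear_basis[OF assms(1)]) (auto simp: assms(2))

text \<open>
  A subspace stable under a diagonal operator contains the components of its vectors in the
  eigenspaces: on a given vector only finitely many eigenvalues occur, so the projection is an
  interpolation polynomial in the operator.
\<close>

lemma eigenprojection:
  assumes U: "pm.subspace U" "u \<in> U" and f: "\<And>v. v \<in> U \<Longrightarrow> f v \<in> U"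
    and diag: "\<And>v b. Poly_Mapping.lookup (f v) b = c b * Poly_Mapping.lookup v b"
  shows "\<exists>v\<in>U. \<forall>b. Poly_Mapping.lookup v b = (if c b = \<gamma> then Poly_Mapping.lookup u b else 0)"
proof -
  have poly: "\<exists>v\<in>U. \<forall>b. Poly_Mapping.lookup v b = (\<Prod>x\<in>C. (c b - x) / (\<gamma> - x)) * Poly_Mapping.lookup u b"
    if "finite C" for C
    using that
  proof (induction C)
    case empty
    show ?case using U by auto
  next
    case (insert x C)
    then obtain v where v: "v \<in> U"
      "\<And>b. Poly_Mapping.lookup v b = (\<Prod>x\<in>C. (c b - x) / (\<gamma> - x)) * Poly_Mapping.lookup u b"
      by blast
    have "pm_scale (1 / (\<gamma> - x)) (f v - pm_scale x v) \<in> U"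
      by (intro pm.subspace_scale pm.subspace_diff U(1) f v(1))
    moreover have "Poly_Mapping.lookup (pm_scale (1 / (\<gamma> - x)) (f v - pm_scale x v)) b
        = (\<Prod>x\<in>insert x C. (c b - x) / (\<gamma> - x)) * Poly_Mapping.lookup u b" for b
      using insert.hyps by (simp add: lookup_minus diag v(2) left_diff_distrib right_diff_distrib diff_divide_distrib mult.assoc)
    ultimately show ?case by blast
  qed
  define C where "C = c ` Poly_Mapping.keys u - {\<gamma>}"
  have fin: "finite C" by (simp add: C_def)
  obtain v where v: "v \<in> U"
    "\<And>b. Poly_Mapping.lookup v b = (\<Prod>x\<in>C. (c b - x) / (\<gamma> - x)) * Poly_Mapping.lookup u b"
    using poly[OF fin] by blast
  have "Poly_Mapping.lookup v b = (if c b = \<gamma> then Poly_Mapping.lookup u b else 0)" for b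
  proof (cases "b \<in> Poly_Mapping.keys u")
    case True
    show ?thesis
    proof (cases "c b = \<gamma>")
      case True
      have "(\<Prod>x\<in>C. (c b - x) / (\<gamma> - x)) = 1"
        by (rule prod.neutral) (auto simp: True C_def)
      with True show ?thesis by (simp add: v(2))
    next
      case False
      have "(\<Prod>x\<in>C. (c b - x) / (\<gamma> - x)) = 0"
        by (rule prod_zero[OF fin]) (use True False in \<open>auto simp: C_def intro!: bexI[of _ "c b"]\<close>)
      with False show ?thesis by (simp add: v(2))
    qed
  next
    case False
    then show ?thesis by (simp add: v(2) in_keys_iff)
  qed
  with v(1) show ?thesis by blast
qed

definition fock_charge :: "int fset \<Rightarrow> int" where
  "fock_charge D = int (fcard (ffilter (\<lambda>i. i < 0) D)) - int (fcard (ffilter (\<lambda>i. i \<ge> 0) D))"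

lemma lookup_charge: "Poly_Mapping.lookup (charge v) D = of_int (fock_charge D) * Poly_Mapping.lookup v D"
  by (rule lookup_diagonal[OF charge_pm_linear]) (simp add: charge_def fock_charge_def)

lemma tensor_op_bvec: "tensor_op A B (bvec (a, b)) = tensor (A (bvec a)) (B (bvec b))"
  by (simp add: tensor_op_def)

lemma lookup_tensor_beta_0:
  "Poly_Mapping.lookup (tensor_op id (beta 0) v) b = - of_int (fst (snd b)) * Poly_Mapping.lookup v b"
  by (rule lookup_diagonal[OF pm_linear_tensor_op]) (auto simp: tensor_op_bvec beta_bvec tensor_simps split_paired_all)

lemma lookup_H0:
  "Poly_Mapping.lookup (H0 v) b = of_int (fock_charge (fst b) - fst (snd b)) * Poly_Mapping.lookup v b"
proof (rule lookup_diagonal[OF H0_linear])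
  fix b :: "int fset \<times> int \<times> nat multiset"
  obtain D m \<mu> where b: "b = (D, m, \<mu>)" by (metis prod_cases3)
  have "charge (bvec D) = pm_scale (of_int (fock_charge D)) (bvec D)"
    by (rule poly_mapping_eqI) (simp add: lookup_charge)
  then show "H0 (bvec b) = pm_scale (of_int (fock_charge (fst b) - fst (snd b))) (bvec b)"
    by (simp add: H0_def b tensor_op_bvec beta_bvec tensor_simps pm.scale_left_diff_distrib)
qed

lemma lookup_tensor_beta_pos:
  assumes "j \<ge> 1"
  shows "Poly_Mapping.lookup (tensor_op id (beta (int j)) v) (D, m, \<mu>)
    = - of_nat j * of_nat (Suc (count \<mu> (j - 1))) * Poly_Mapping.lookup v (D, m, add_mset (j - 1) \<mu>)"
  by (rule lookup_linear_basis[OF pm_linear_tensor_op])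
    (auto simp: tensor_op_bvec lookup_tensor lookup_beta_pos[OF assms] split_paired_all)

lemma tensor_beta_number_bvec:
  "tensor_op id (beta (- int (Suc j))) (tensor_op id (beta (int (Suc j))) (bvec (D, m, \<mu>)))
    = pm_scale (- of_nat (Suc j) * of_nat (count \<mu> j)) (bvec (D, m, \<mu>))"
proof -
  have "tensor_op id (beta (- int (Suc j))) (tensor_op id (beta (int (Suc j))) (bvec (D, m, \<mu>)))
      = tensor (bvec D) (beta (- int (Suc j)) (beta (int (Suc j)) (bvec (m, \<mu>))))"
    by (simp add: tensor_op_bvec tensor_op_tensor[OF pm_linear_id' beta_pm_linear])
  also have "beta (- int (Suc j)) (beta (int (Suc j)) (bvec (m, \<mu>)))
      = pm_scale (- of_nat (Suc j) * of_nat (count \<mu> j)) (bvec (m, \<mu>))"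
  proof -
    have "beta (- int (Suc j)) (bvec (m, \<mu> - {#j#})) = bvec (m, add_mset j (\<mu> - {#j#}))"
      by (simp add: beta_bvec)
    then have "beta (- int (Suc j)) (beta (int (Suc j)) (bvec (m, \<mu>)))
        = pm_scale (- of_nat (Suc j) * of_nat (count \<mu> j)) (bvec (m, add_mset j (\<mu> - {#j#})))"
      using beta_pos_bvec[of "Suc j" m \<mu>] by (simp only: beta_linear One_nat_def Suc_le_mono le0 diff_Suc_Suc minus_nat.diff_0)
    then show ?thesis
      by (cases "j \<in># \<mu>") (simp_all add: not_in_iff)
  qed
  finally show ?thesis
    by (simp only: tensor_linear tensor_bvec)
qed

section \<open>Irreducibility\<close>

text \<open>The embedding of \<open>F\<close> into the kernel of \<open>H(0)\<close>, each charge paired with its vacuum \<open>e\<^bsup>m\<beta>\<^esup>\<close>.\<close>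

definition vac_embed :: "fock \<Rightarrow> state" where
  "vac_embed = lin_ext (\<lambda>D. bvec (D, fock_charge D, {#}))"

lemma vac_embed_linear: "pm_linear vac_embed"
  by (simp add: vac_embed_def linear_lin_ext)

lemma vac_embed_bvec [simp]: "vac_embed (bvec D) = bvec (D, fock_charge D, {#})"
  by (simp add: vac_embed_def)

lemma lookup_vac_embed:
  "Poly_Mapping.lookup (vac_embed w) (D, m, \<mu>) = (if m = fock_charge D \<and> \<mu> = {#} then Poly_Mapping.lookup w D else 0)"
  using lookup_linear_basis[OF vac_embed_linear, of "(D, m, \<mu>)" D "if m = fock_charge D \<and> \<mu> = {#} then 1 else 0" w]
  by (auto simp: vac_embed_def)

text \<open>
  The modes of \<open>h(z)\<close> are those of \<open>\<beta>(z)\<close> up to scalars, so every submodule is of this kind.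
\<close>

locale beta_stable_subspace =
  fixes U :: "state set"
  assumes subspace: "pm.subspace U" and kernel: "v \<in> U \<Longrightarrow> H0 v = 0"
    and beta_stable: "v \<in> U \<Longrightarrow> tensor_op id (beta n) v \<in> U"
begin

lemma kernel_support: "v \<in> U \<Longrightarrow> Poly_Mapping.lookup v (D, m, \<mu>) \<noteq> 0 \<Longrightarrow> m = fock_charge D"
  using lookup_H0[of v "(D, m, \<mu>)"] kernel[of v] by (simp flip: of_int_diff)

text \<open>
  \<open>\<beta>(-j-1) \<beta>(j+1)\<close> is diagonal and its eigenvalue determines the multiplicity of the label \<open>j\<close>. Finitely
  many labels suffice to single out one partition among those that occur in a given vector.
\<close>

lemma partition_projection:
  assumes "u \<in> U"
  shows "\<exists>v\<in>U. \<forall>D m \<nu>. Poly_Mapping.lookup v (D, m, \<nu>) = (if \<nu> = \<mu> then Poly_Mapping.lookup u (D, m, \<nu>) else 0)"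
proof -
  have proj: "\<exists>v\<in>U. \<forall>D m \<nu>. Poly_Mapping.lookup v (D, m, \<nu>)
      = (if \<forall>j\<in>J. count \<nu> j = count \<mu> j then Poly_Mapping.lookup u (D, m, \<nu>) else 0)" if "finite J" for J
    using that
  proof (induction J)
    case empty
    show ?case using assms by auto
  next
    case (insert j J)
    then obtain v where v: "v \<in> U" "\<And>D m \<nu>. Poly_Mapping.lookup v (D, m, \<nu>)
      = (if \<forall>j\<in>J. count \<nu> j = count \<mu> j then Poly_Mapping.lookup u (D, m, \<nu>) else 0)"
      by blast
    let ?f = "\<lambda>v. tensor_op id (beta (- int (Suc j))) (tensor_op id (beta (int (Suc j))) v)"
    let ?c = "\<lambda>b::int fset \<times> int \<times> nat multiset. - of_nat (Suc j) * of_nat (count (snd (snd b)) j) :: complex"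
    have f: "?f v \<in> U" if "v \<in> U" for v
      using that by (intro beta_stable)
    have "Poly_Mapping.lookup (?f v) b = ?c b * Poly_Mapping.lookup v b" for v b
    proof (rule lookup_diagonal[OF pm_linear_compose[OF pm_linear_tensor_op pm_linear_tensor_op]])
      fix b :: "int fset \<times> int \<times> nat multiset"
      obtain D m \<nu> where "b = (D, m, \<nu>)" by (metis prod_cases3)
      then show "?f (bvec b) = pm_scale (?c b) (bvec b)"
        by (simp only: tensor_beta_number_bvec snd_conv)
    qed
    from eigenprojection[OF subspace v(1) f this, of "- of_nat (Suc j) * of_nat (count \<mu> j)"]
    obtain w where w: "w \<in> U" "\<And>b. Poly_Mapping.lookup w b
        = (if ?c b = - of_nat (Suc j) * of_nat (count \<mu> j) then Poly_Mapping.lookup v b else 0)"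
      by blast
    have "Poly_Mapping.lookup w (D, m, \<nu>)
        = (if \<forall>j\<in>insert j J. count \<nu> j = count \<mu> j then Poly_Mapping.lookup u (D, m, \<nu>) else 0)" for D m \<nu>
      unfolding w(2) v(2) by (simp del: of_nat_Suc)
    with w(1) show ?case by blast
  qed
  let ?J = "set_mset \<mu> \<union> (\<Union>b\<in>Poly_Mapping.keys u. set_mset (snd (snd b)))"
  obtain v where v: "v \<in> U" "\<And>D m \<nu>. Poly_Mapping.lookup v (D, m, \<nu>)
      = (if \<forall>j\<in>?J. count \<nu> j = count \<mu> j then Poly_Mapping.lookup u (D, m, \<nu>) else 0)"
    using proj[of ?J] by auto
  have "Poly_Mapping.lookup v (D, m, \<nu>) = (if \<nu> = \<mu> then Poly_Mapping.lookup u (D, m, \<nu>) else 0)" for D m \<nu>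
  proof (cases "(D, m, \<nu>) \<in> Poly_Mapping.keys u")
    case True
    have "\<nu> = \<mu>" if eq: "\<forall>j\<in>?J. count \<nu> j = count \<mu> j"
    proof (rule multiset_eqI)
      fix j
      show "count \<nu> j = count \<mu> j"
      proof (cases "j \<in> ?J")
        case False
        with True have "j \<notin># \<nu>" "j \<notin># \<mu>" by force+
        then show ?thesis by (simp add: not_in_iff)
      qed (use eq in blast)
    qed
    then show ?thesis by (auto simp: v(2))
  qed (simp add: v(2) in_keys_iff)
  with v(1) show ?thesis by blast
qed

definition vacuum_vectors :: "fock set" where
  "vacuum_vectors = {w. vac_embed w \<in> U}"

lemma vacuum_vectors_subspace: "pm.subspace vacuum_vectors"
  using subspace by (simp add: vacuum_vectors_def pm.subspace_def pm_linear_simps[OF vac_embed_linear])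

lemma vacuum_vectors_charge_component:
  assumes "w \<in> vacuum_vectors"
  shows "\<exists>w'\<in>vacuum_vectors. \<forall>D. Poly_Mapping.lookup w' D = (if fock_charge D = m then Poly_Mapping.lookup w D else 0)"
proof -
  have "vac_embed w \<in> U"
    using assms by (simp add: vacuum_vectors_def)
  from eigenprojection[OF subspace this beta_stable[of _ 0] lookup_tensor_beta_0, of "- of_int m"]
  obtain v where v: "v \<in> U" "\<And>b. Poly_Mapping.lookup v b = (if fst (snd b) = m then Poly_Mapping.lookup (vac_embed w) b else 0)"
    by auto
  define w' where "w' = lin_ext (\<lambda>D. if fock_charge D = m then bvec D else 0) w"
  have w': "Poly_Mapping.lookup w' D = (if fock_charge D = m then Poly_Mapping.lookup w D else 0)" for D
  proof -
    have "Poly_Mapping.lookup w' D = (if fock_charge D = m then 1 else 0) * Poly_Mapping.lookup w D"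
      unfolding w'_def
      by (rule lookup_diagonal[OF linear_lin_ext, where c = "\<lambda>D. if fock_charge D = m then 1 else 0"]) simp
    then show ?thesis by simp
  qed
  have "vac_embed w' = v"
    by (rule poly_mapping_eqI) (auto simp: split_paired_all v(2) lookup_vac_embed w')
  with v(1) w' show ?thesis
    by (auto simp: vacuum_vectors_def)
qed

text \<open>
  The vacuum component of \<open>A(z) \<otimes> Y(e\<^bsup>l\<beta>\<^esup>,z)\<close> on \<open>w \<otimes> e\<^bsup>m\<beta>\<^esup>\<close> is \<open>z\<^bsup>-lm\<^esup> A(z) w \<otimes> e\<^bsup>(m+l)\<beta>\<^esup>\<close>. So if
  \<open>U\<close> is stable under the product field then its vacuum vectors are stable under \<open>A(z)\<close>.
\<close>

lemma vacuum_vectors_stable_homogeneous: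
  assumes A: "is_field A" "\<And>i x. charge (A i x) = A i (charge x) + pm_scale (of_int l) (A i x)"
    and stable: "\<And>n v. v \<in> U \<Longrightarrow> tensor_field A (lattice_mode l) n v \<in> U"
    and w: "w \<in> vacuum_vectors" "\<And>D. D \<in> Poly_Mapping.keys w \<Longrightarrow> fock_charge D = m"
  shows "A i w \<in> vacuum_vectors"
proof -
  have tensor: "vac_embed w = tensor w (vac m)"
    by (rule poly_mapping_eqI) (use w(2) in \<open>auto simp: split_paired_all lookup_vac_embed lookup_tensor in_keys_iff\<close>)
  have "charge w = pm_scale (of_int m) w"
    by (rule poly_mapping_eqI) (use w(2) in \<open>auto simp: lookup_charge in_keys_iff\<close>)
  then have "charge (A i w) = pm_scale (of_int (m + l)) (A i w)"
    by (simp add: A(2) pm_linear_simps[OF is_field_linear[OF A(1)]] pm.scale_left_distrib)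
  then have charge: "fock_charge D = m + l" if "Poly_Mapping.lookup (A i w) D \<noteq> 0" for D
    using that lookup_charge[of "A i w" D] by (simp flip: of_int_add)
  define n where "n = i + l * m"
  let ?u = "tensor_field A (lattice_mode l) n (tensor w (vac m))"
  have "?u \<in> U"
    using stable w(1) by (simp add: vacuum_vectors_def flip: tensor)
  from partition_projection[OF this, of "{#}"]
  obtain v where v: "v \<in> U" "\<And>D m' \<nu>. Poly_Mapping.lookup v (D, m', \<nu>) = (if \<nu> = {#} then Poly_Mapping.lookup ?u (D, m', \<nu>) else 0)"
    by blast
  have u: "Poly_Mapping.lookup ?u (D, m', {#}) = (if m' = m + l then Poly_Mapping.lookup (A i w) D else 0)" for D m'
  proof -
    have "Poly_Mapping.lookup ?u (D, m', {#})
        = Sum_any (\<lambda>k. Poly_Mapping.lookup (A k w) D * Poly_Mapping.lookup (lattice_mode l (n - k - 1) (vac m)) (m', {#}))"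
      by (simp add: tensor_field_tensor[OF A(1) lattice_mode_field] lookup_tensor
          lookup_Sum_any[OF tensor_field_finite_tensor[OF A(1) lattice_mode_field]])
    also have "\<dots> = Sum_any (\<lambda>k. if k = i then (if m' = m + l then Poly_Mapping.lookup (A k w) D else 0) else 0)"
    proof (rule Sum_any.cong)
      fix k
      show "Poly_Mapping.lookup (A k w) D * Poly_Mapping.lookup (lattice_mode l (n - k - 1) (vac m)) (m', {#})
          = (if k = i then (if m' = m + l then Poly_Mapping.lookup (A k w) D else 0) else 0)"
        using lookup_lattice_mode_charge[OF beta_0_vac[of m], of m' l "n - k - 1" "{#}"]
        by (cases "m' = m + l") (auto simp: lookup_lattice_mode_vac n_def)
    qed
    finally show ?thesis by simp
  qed
  have "vac_embed (A i w) = v"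
    by (rule poly_mapping_eqI) (use charge in \<open>force simp: split_paired_all v(2) u lookup_vac_embed\<close>)
  with v(1) show ?thesis
    by (simp add: vacuum_vectors_def)
qed

lemma vacuum_vectors_stable:
  assumes A: "is_field A" "\<And>i x. charge (A i x) = A i (charge x) + pm_scale (of_int l) (A i x)"
    and stable: "\<And>n v. v \<in> U \<Longrightarrow> tensor_field A (lattice_mode l) n v \<in> U"
    and w: "w \<in> vacuum_vectors"
  shows "A i w \<in> vacuum_vectors"
proof -
  obtain c where c: "\<And>m. c m \<in> vacuum_vectors"
    "\<And>m D. Poly_Mapping.lookup (c m) D = (if fock_charge D = m then Poly_Mapping.lookup w D else 0)"
    using vacuum_vectors_charge_component[OF w] by metis
  have "w = (\<Sum>m\<in>fock_charge ` Poly_Mapping.keys w. c m)"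
    by (rule poly_mapping_eqI) (auto simp: lookup_sum c(2) in_keys_iff)
  then have "A i w = (\<Sum>m\<in>fock_charge ` Poly_Mapping.keys w. A i (c m))"
    by (metis pm_linear_simps(6) is_field_linear A(1))
  moreover have "A i (c m) \<in> vacuum_vectors" for m
    by (rule vacuum_vectors_stable_homogeneous[OF A stable c(1)]) (auto simp: in_keys_iff c(2) split: if_splits)
  ultimately show ?thesis
    by (simp add: pm.subspace_sum vacuum_vectors_subspace)
qed

text \<open>
  After projection to a single partition, the modes \<open>\<beta>(j)\<close> with \<open>j > 0\<close> strip off its labels one by one
  without killing the vector.
\<close>

lemma trivial_if_no_vacuum_vectors:
  assumes "vacuum_vectors = {0}"
  shows "U = {0}"
proof -
  have homogeneous: "v = 0" if "v \<in> U" "\<And>D m \<nu>. Poly_Mapping.lookup v (D, m, \<nu>) \<noteq> 0 \<Longrightarrow> \<nu> = \<mu>" for v \<mu>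
    using that
  proof (induction \<mu> arbitrary: v)
    case empty
    have v: "v = vac_embed (lin_ext (\<lambda>(D, _). bvec D) v)"
    proof -
      have "vac_embed (lin_ext (\<lambda>(D, _). bvec D) v)
          = (\<Sum>b\<in>Poly_Mapping.keys v. pm_scale (Poly_Mapping.lookup v b) (bvec (fst b, fock_charge (fst b), {#})))"
        by (simp add: lin_ext_def[of _ v] pm_linear_simps[OF vac_embed_linear] split_beta)
      also have "\<dots> = lin_ext bvec v"
        unfolding lin_ext_def
      proof (intro sum.cong refl)
        fix b assume "b \<in> Poly_Mapping.keys v"
        moreover obtain D m \<nu> where "b = (D, m, \<nu>)" by (metis prod_cases3)
        ultimately have "b = (fst b, fock_charge (fst b), {#})"
          using empty.prems(2)[of D m \<nu>] kernel_support[OF empty.prems(1), of D m \<nu>]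
          by (simp add: in_keys_iff)
        then show "pm_scale (Poly_Mapping.lookup v b) (bvec (fst b, fock_charge (fst b), {#}))
            = pm_scale (Poly_Mapping.lookup v b) (bvec b)"
          by simp
      qed
      finally show ?thesis
        by (simp flip: bvec_expand)
    qed
    then have "lin_ext (\<lambda>(D, _). bvec D) v \<in> vacuum_vectors"
      using empty.prems(1) by (simp add: vacuum_vectors_def)
    then show ?case
      using v assms by (simp add: pm_linear_simps[OF vac_embed_linear])
  next
    case (add j \<mu>)
    have B: "Poly_Mapping.lookup (tensor_op id (beta (int (Suc j))) v) (D, m, \<nu>)
        = - of_nat (Suc j) * of_nat (Suc (count \<nu> j)) * Poly_Mapping.lookup v (D, m, add_mset j \<nu>)" for D m \<nu>
      using lookup_tensor_beta_pos[of "Suc j" v D m \<nu>] by simp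
    have "tensor_op id (beta (int (Suc j))) v = 0"
    proof (rule add.IH)
      show "tensor_op id (beta (int (Suc j))) v \<in> U"
        by (rule beta_stable[OF add.prems(1)])
      show "\<nu> = \<mu>" if "Poly_Mapping.lookup (tensor_op id (beta (int (Suc j))) v) (D, m, \<nu>) \<noteq> 0" for D m \<nu>
        using that add.prems(2)[of D m "add_mset j \<nu>"] unfolding B by (simp del: of_nat_Suc)
    qed
    then have zero: "Poly_Mapping.lookup v (D, m, add_mset j \<mu>) = 0" for D m
      using B[of D m \<mu>] by (simp del: of_nat_Suc)
    show ?case
    proof (rule poly_mapping_eqI)
      fix b
      show "Poly_Mapping.lookup v b = Poly_Mapping.lookup 0 b"
        using add.prems(2)[of "fst b" "fst (snd b)" "snd (snd b)"] zero[of "fst b" "fst (snd b)"]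
        by (cases b) auto
    qed
  qed
  have "u = 0" if u: "u \<in> U" for u
  proof (rule poly_mapping_eqI)
    fix b :: "int fset \<times> int \<times> nat multiset"
    obtain D m \<mu> where b: "b = (D, m, \<mu>)" by (metis prod_cases3)
    obtain v where v: "v \<in> U" "\<And>D m \<nu>. Poly_Mapping.lookup v (D, m, \<nu>) = (if \<nu> = \<mu> then Poly_Mapping.lookup u (D, m, \<nu>) else 0)"
      using partition_projection[OF u, of \<mu>] by blast
    have "v = 0"
      by (rule homogeneous[OF v(1), of \<mu>]) (auto simp: v(2) split: if_splits)
    then show "Poly_Mapping.lookup u b = Poly_Mapping.lookup 0 b"
      using v(2)[of D m \<mu>] by (simp add: b)
  qed
  with pm.subspace_0[OF subspace] show ?thesis by blast
qed

lemma full_if_all_vacuum_vectors: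
  assumes "vacuum_vectors = UNIV"
  shows "U = {v. H0 v = 0}"
proof -
  have basis: "bvec (D, fock_charge D, \<mu>) \<in> U" for D \<mu>
  proof (induction \<mu>)
    case empty
    have "bvec D \<in> vacuum_vectors"
      using assms by simp
    then show ?case by (simp add: vacuum_vectors_def)
  next
    case (add j \<mu>)
    have "tensor_op id (beta (- int (Suc j))) (bvec (D, fock_charge D, \<mu>)) = bvec (D, fock_charge D, add_mset j \<mu>)"
      by (simp add: tensor_op_bvec beta_bvec)
    then show ?case
      using beta_stable[OF add] by metis
  qed
  have "v \<in> U" if v: "H0 v = 0" for v
  proof -
    have "bvec b \<in> U" if "b \<in> Poly_Mapping.keys v" for b
    proof -
      have "fst (snd b) = fock_charge (fst b)"
        using that lookup_H0[of v b] v by (simp add: in_keys_iff flip: of_int_diff)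
      then have "b = (fst b, fock_charge (fst b), snd (snd b))"
        by (simp add: prod_eq_iff)
      then show ?thesis using basis by metis
    qed
    then have "lin_ext bvec v \<in> U"
      unfolding lin_ext_def by (intro pm.subspace_sum pm.subspace_scale subspace)
    then show ?thesis by (simp flip: bvec_expand)
  qed
  with kernel show ?thesis by blast
qed

end

text \<open>The factors \<open>\<lambda> - i\<close> are all nonzero exactly when \<open>\<lambda>\<close> is not an integer.\<close>

lemma dressed_mode_over_z:
  "dressed_mode \<psi> (fls_const lam / fls_X) i v = pm_scale (lam - of_int i) (\<psi> (i - 1) v)"
proof -
  have "pm_scale (fls_mode (fls_const lam / fls_X) (- k)) (\<psi> (k + i - 1) v)
      = (if k = 0 then pm_scale lam (\<psi> (k + i - 1) v) else 0)" for k
    unfolding fls_mode_over_z by simp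
  then have "dressed_mode \<psi> (fls_const lam / fls_X) i v
      = pm_scale (- of_int i) (\<psi> (i - 1) v) + pm_scale lam (\<psi> (0 + i - 1) v)"
    by (simp only: dressed_mode_def Sum_any.delta)
  then show ?thesis
    by (simp add: pm.scale_left_diff_distrib)
qed

text \<open>
  If \<open>\<chi>\<close> has a pole of order \<open>p + 1\<close>, the dressed mode of index \<open>i\<close> is a nonzero multiple of the
  fermionic mode of index \<open>i - p - 1\<close>, plus a combination of modes of higher index. The factor is
  \<open>\<chi>\<^sub>p\<close> for \<open>p > 0\<close>, but \<open>\<chi>\<^sub>0 - i\<close> for \<open>p = 0\<close>, where the derivative contributes to the same mode. As the modes of high index vanish
  on a given vector, the fermionic modes are recovered from the dressed ones by downward recursion.
\<close>

lemma undress_modes: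
  assumes field: "is_field \<psi>" and W: "pm.subspace W" "w \<in> W"
    and stable: "\<And>i w. w \<in> W \<Longrightarrow> dressed_mode \<psi> \<chi> i w \<in> W"
    and zero: "\<And>n. n > int p \<Longrightarrow> fls_mode \<chi> n = 0"
    and leading: "fls_mode \<chi> (int p) \<noteq> 0" and p0: "p = 0 \<Longrightarrow> fls_mode \<chi> 0 \<notin> \<int>"
  shows "\<psi> n w \<in> W"
proof -
  obtain N where N: "\<And>n. n \<ge> N \<Longrightarrow> \<psi> n w = 0"
    using field is_field_truncation by metis
  show ?thesis
  proof (induction "nat (N - n)" arbitrary: n rule: less_induct)
    case less
    have higher: "\<psi> r w \<in> W" if "r > n" for r
      using that less[of r] N[of r] pm.subspace_0[OF W(1)] by (cases "r \<ge> N") auto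
    define i where "i = n + 1 + int p"
    define t where "t = (\<lambda>k. pm_scale (fls_mode \<chi> (- k)) (\<psi> (k + i - 1) w))"
    have fin: "finite {k. t k \<noteq> 0}"
      unfolding t_def by (rule dressed_mode_finite_id[OF field])
    have lead: "t (- int p) = pm_scale (fls_mode \<chi> (int p)) (\<psi> n w)"
      by (simp add: t_def i_def)
    have "t k \<in> W" if "k \<noteq> - int p" for k
    proof (cases "k > - int p")
      case True
      then show ?thesis
        unfolding t_def by (intro pm.subspace_scale W(1) higher) (simp add: i_def)
    next
      case False
      with that show ?thesis
        using pm.subspace_0[OF W(1)] by (simp add: t_def zero)
    qed
    then have rest: "(\<Sum>k\<in>{k. t k \<noteq> 0} - {- int p}. t k) \<in> W"
      by (intro pm.subspace_sum W(1)) auto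
    have "Sum_any t = t (- int p) + (\<Sum>k\<in>{k. t k \<noteq> 0} - {- int p}. t k)"
      using fin by (cases "t (- int p) = 0") (auto simp: Sum_any.expand_set sum.remove)
    then have dressed: "dressed_mode \<psi> \<chi> i w = pm_scale (- of_int i) (\<psi> (i - 1) w)
        + (pm_scale (fls_mode \<chi> (int p)) (\<psi> n w) + (\<Sum>k\<in>{k. t k \<noteq> 0} - {- int p}. t k))"
      unfolding dressed_mode_def t_def[symmetric] by (simp only: lead)
    have G: "dressed_mode \<psi> \<chi> i w \<in> W"
      by (rule stable[OF W(2)])
    have "\<exists>c. c \<noteq> 0 \<and> pm_scale c (\<psi> n w) \<in> W"
    proof (cases "p = 0")
      case True
      let ?c = "fls_mode \<chi> 0 - of_int i"
      have "?c \<noteq> 0"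
        using p0[OF True] by (metis Ints_of_int eq_iff_diff_eq_0)
      moreover have "pm_scale ?c (\<psi> n w) = dressed_mode \<psi> \<chi> i w - (\<Sum>k\<in>{k. t k \<noteq> 0} - {- int p}. t k)"
        unfolding dressed using True by (simp add: i_def pm.scale_left_diff_distrib pm.scale_left_distrib)
      moreover have "\<dots> \<in> W"
        by (rule pm.subspace_diff[OF W(1) G rest])
      ultimately show ?thesis by metis
    next
      case False
      have "pm_scale (fls_mode \<chi> (int p)) (\<psi> n w) = dressed_mode \<psi> \<chi> i w - pm_scale (- of_int i) (\<psi> (i - 1) w)
          - (\<Sum>k\<in>{k. t k \<noteq> 0} - {- int p}. t k)"
        unfolding dressed by simp
      moreover have "\<psi> (i - 1) w \<in> W"
        by (rule higher) (use False in \<open>simp add: i_def\<close>)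
      then have "dressed_mode \<psi> \<chi> i w - pm_scale (- of_int i) (\<psi> (i - 1) w)
          - (\<Sum>k\<in>{k. t k \<noteq> 0} - {- int p}. t k) \<in> W"
        by (intro pm.subspace_diff pm.subspace_scale W(1) G rest)
      ultimately show ?thesis
        using leading by metis
    qed
    then obtain c where c: "c \<noteq> 0" "pm_scale c (\<psi> n w) \<in> W"
      by blast
    have "pm_scale (1 / c) (pm_scale c (\<psi> n w)) \<in> W"
      by (rule pm.subspace_scale[OF W(1) c(2)])
    with c(1) show ?case by simp
  qed
qed

theorem theorem9p1:
  fixes lam :: complex and p :: nat and \<chi> :: "complex fls"
  assumes "lam \<notin> \<int>"
    and "\<And>n. n > int p \<Longrightarrow> fls_mode \<chi> n = 0"
    and "fls_mode \<chi> (int p) \<noteq> 0"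
    and "p = 0 \<Longrightarrow> fls_mode \<chi> 0 \<notin> \<int>"
  shows "\<exists>M :: (affine, state) lie_rep.
      rep_space M = Pi0
    \<and> irreducible_lie_module pm_scale affine_bracket pm_scale M
    \<and> lie_module_isomorphic pm_scale affine_bracket pm_scale M
        pm_scale (L0 (fls_const lam / fls_X) \<chi>)"
proof (intro exI conjI)
  let ?\<chi>p = "fls_const lam / fls_X" and ?M = "L0 (fls_const lam / fls_X) \<chi>"
  show "rep_space ?M = Pi0"
    by (simp add: L0_def Pi0_def)
  show "lie_module_isomorphic pm_scale affine_bracket pm_scale ?M pm_scale ?M"
    unfolding lie_module_isomorphic_def
    by (intro conjI L0_lie_module exI[of _ id]) simp_all
  show "irreducible_lie_module pm_scale affine_bracket pm_scale ?M"
  proof (intro irreducible_lie_module.intro irreducible_lie_module_axioms.intro L0_lie_module)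
    have "ffilter P {||} = {||}" for P :: "int \<Rightarrow> bool"
      by auto
    then have "H0 (bvec ({||}, 0, {#})) = 0"
      by (intro poly_mapping_eqI) (auto simp: lookup_H0 fock_charge_def)
    moreover have "bvec ({||}, 0, {#}) \<noteq> (0 :: state)"
      by (metis lookup_bvec lookup_zero zero_neq_one)
    ultimately show "rep_space ?M \<noteq> {0}"
      by (auto simp: L0_def)
  next
    fix U
    assume U: "U \<subseteq> rep_space ?M" "pm.subspace U" "\<And>x u. u \<in> U \<Longrightarrow> rep_act ?M x u \<in> U"
    have op: "affine_op ?\<chi>p \<chi> b u \<in> U" if "u \<in> U" for b u
      using U(3)[OF that, of "bvec b"] by (simp add: L0_def)
    interpret beta_stable_subspace U
    proof
      fix v n assume v: "v \<in> U"
      have "affine_op ?\<chi>p \<chi> (Mode sl2_h n) v - pm_scale (2 * T_mode ?\<chi>p \<chi> n) v \<in> U"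
        by (intro pm.subspace_diff pm.subspace_scale U(2) op v)
      then have "pm_scale (- 2) (tensor_op id (beta n) v) \<in> U"
        unfolding affine_op_h by (simp only: add_diff_cancel_right')
      then have "pm_scale (- 1 / 2) (pm_scale (- 2) (tensor_op id (beta n) v)) \<in> U"
        by (rule pm.subspace_scale[OF U(2)])
      then have "pm_scale (- 1 / 2 * - 2) (tensor_op id (beta n) v) \<in> U"
        by (simp only: pm.scale_scale)
      then show "tensor_op id (beta n) v \<in> U"
        by simp
    qed (use U(1,2) in \<open>auto simp: L0_def\<close>)
    let ?W = vacuum_vectors
    have e: "tensor_field (dressed_mode psi_plus ?\<chi>p) (lattice_mode 1) n v \<in> U" if "v \<in> U" for n v
      using op[OF that, of "Mode sl2_e n"] unfolding affine_op_e .
    have f: "tensor_field (dressed_mode psi_minus \<chi>) (lattice_mode (- 1)) n v \<in> U" if "v \<in> U" for n v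
      using op[OF that, of "Mode sl2_f n"] unfolding affine_op_f .
    have plus: "psi_plus n w \<in> ?W" if "w \<in> ?W" for n w
    proof -
      have "dressed_mode psi_plus ?\<chi>p (n + 1) w \<in> ?W"
        by (rule vacuum_vectors_stable[OF plus_field charge_dressed_plus e that])
      then have "pm_scale (lam - of_int (n + 1)) (psi_plus (n + 1 - 1) w) \<in> ?W"
        by (simp only: dressed_mode_over_z)
      then have "pm_scale (1 / (lam - of_int (n + 1))) (pm_scale (lam - of_int (n + 1)) (psi_plus (n + 1 - 1) w)) \<in> ?W"
        by (rule pm.subspace_scale[OF vacuum_vectors_subspace])
      moreover have "lam - of_int (n + 1) \<noteq> 0"
        using assms(1) by (metis Ints_of_int eq_iff_diff_eq_0)
      ultimately show ?thesis
        by simp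
    qed
    have minus: "psi_minus n w \<in> ?W" if "w \<in> ?W" for n w
      by (rule undress_modes[OF psi_minus_field vacuum_vectors_subspace that
            vacuum_vectors_stable[OF minus_field charge_dressed_minus f] assms(2-4)])
    show "U = {0} \<or> U = rep_space ?M"
    proof (cases "?W = {0}")
      case True
      then show ?thesis using trivial_if_no_vacuum_vectors by blast
    next
      case False
      then have "?W = UNIV"
        by (rule fock_irreducible[OF vacuum_vectors_subspace _ plus minus])
      then show ?thesis
        using full_if_all_vacuum_vectors by (simp add: L0_def)
    qed
  qed
qed

end
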